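(* Let $K$ be an algebraically closed field of characteristic zero, let $G$ be an arbitrary (abstract) group, and let $\rho: G \to \mathrm{GL}(V)$ be a finite-dimensional representation of $G$ over $K$. Then $d(G,V)=\dim V$ if and only if the determinant map takes only finitely many values on $\rho(G)$, i.e. the set $\{\det \rho(g) : g\in G\}$ is finite.
   Context: For a finite-dimensional representation $W$ of $G$ over $K$, $\mathrm{TS}_G(W)$ denotes the number of trivial summands (summands isomorphic to the one-dimensional trivial representation), counted with multiplicity, when $W$ is written as a direct sum of indecomposable representations of $G$. Define $d(G,V)=\limsup_{n\to\infty}\mathrm{TS}_G(V^{\otimes n})^{1/n}$. *)

theory Defs
  imports
    "Jordan_Normal_Form.Determinant"
    "HOL-Library.FuncSet"
    "HOL-Library.Function_Algebras"
    "HOL-Library.Extended_Real"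
    "HOL-Library.Liminf_Limsup"
begin

text \<open>
  A vector space is given by a scalar multiplication \<open>s\<close> on an abelian group, as in
  \<^theory>\<open>HOL.Vector_Spaces\<close>.  An action of \<open>G\<close> is a function \<open>\<sigma>\<close> sending each element of the
  carrier to an operator.
\<close>

definition GL :: "('k::field \<Rightarrow> 'v::ab_group_add \<Rightarrow> 'v) \<Rightarrow> ('v \<Rightarrow> 'v) monoid" where
  "GL s = \<lparr>carrier = {f. Vector_Spaces.linear s s f \<and> bij f}, monoid.mult = (\<circ>), one = id\<rparr>"

text \<open>Determinant of an endomorphism: determinant of its matrix with respect to an (arbitrarily
  chosen) ordered basis of the whole space.\<close>

definition endo_matrix ::
    "('k::field \<Rightarrow> 'v::ab_group_add \<Rightarrow> 'v) \<Rightarrow> 'v list \<Rightarrow> ('v \<Rightarrow> 'v) \<Rightarrow> 'k mat" where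
  "endo_matrix s bs f = mat (length bs) (length bs)
     (\<lambda>(i, j). Modules.module.representation s (set bs) (f (bs ! j)) (bs ! i))"

definition ordered_basis :: "('k::field \<Rightarrow> 'v::ab_group_add \<Rightarrow> 'v) \<Rightarrow> 'v list \<Rightarrow> bool" where
  "ordered_basis s bs \<longleftrightarrow> distinct bs \<and> \<not> Modules.module.dependent s (set bs)
     \<and> Modules.module.span s (set bs) = UNIV"

definition endo_det :: "('k::field \<Rightarrow> 'v::ab_group_add \<Rightarrow> 'v) \<Rightarrow> ('v \<Rightarrow> 'v) \<Rightarrow> 'k" where
  "endo_det s f = det (endo_matrix s (SOME bs. ordered_basis s bs) f)"


section \<open>Subrepresentations and trivial summands\<close>

definition subrep ::
    "('g, 'm) monoid_scheme \<Rightarrow> ('k::field \<Rightarrow> 'w::ab_group_add \<Rightarrow> 'w) \<Rightarrow> ('g \<Rightarrow> 'w \<Rightarrow> 'w) \<Rightarrow> 'w set \<Rightarrow> bool"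
  where
  "subrep G s \<sigma> U \<longleftrightarrow> Modules.module.subspace s U \<and> (\<forall>g\<in>carrier G. \<forall>u\<in>U. \<sigma> g u \<in> U)"

definition indecomposable_subrep ::
    "('g, 'm) monoid_scheme \<Rightarrow> ('k::field \<Rightarrow> 'w::ab_group_add \<Rightarrow> 'w) \<Rightarrow> ('g \<Rightarrow> 'w \<Rightarrow> 'w) \<Rightarrow> 'w set \<Rightarrow> bool"
  where
  "indecomposable_subrep G s \<sigma> U \<longleftrightarrow> subrep G s \<sigma> U \<and> U \<noteq> {0} \<and>
     (\<forall>A B. subrep G s \<sigma> A \<and> subrep G s \<sigma> B \<and> A \<inter> B = {0} \<and> {a + b | a b. a \<in> A \<and> b \<in> B} = U
        \<longrightarrow> A = {0} \<or> B = {0})"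

definition trivial_subrep ::
    "('g, 'm) monoid_scheme \<Rightarrow> ('k::field \<Rightarrow> 'w::ab_group_add \<Rightarrow> 'w) \<Rightarrow> ('g \<Rightarrow> 'w \<Rightarrow> 'w) \<Rightarrow> 'w set \<Rightarrow> bool"
  where
  "trivial_subrep G s \<sigma> U \<longleftrightarrow> subrep G s \<sigma> U \<and> vector_space.dim s U = 1
     \<and> (\<forall>g\<in>carrier G. \<forall>u\<in>U. \<sigma> g u = u)"

text \<open>The addition map from the product of the members of \<open>\<U>\<close> to \<open>W\<close> is bijective.  A set of
  summands (rather than an indexed family) loses no multiplicities: distinct nonzero summands of
  an internal direct sum are distinct subspaces, even when they are isomorphic.\<close>

definition internal_direct_sum :: "'w::ab_group_add set set \<Rightarrow> 'w set \<Rightarrow> bool" where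
  "internal_direct_sum \<U> W \<longleftrightarrow> finite \<U> \<and>
     bij_betw (\<lambda>u. \<Sum>U\<in>\<U>. u U) (\<Pi>\<^sub>E U\<in>\<U>. U) W"

definition indecomposable_decomposition ::
    "('g, 'm) monoid_scheme \<Rightarrow> ('k::field \<Rightarrow> 'w::ab_group_add \<Rightarrow> 'w) \<Rightarrow> ('g \<Rightarrow> 'w \<Rightarrow> 'w) \<Rightarrow> 'w set
       \<Rightarrow> 'w set set \<Rightarrow> bool" where
  "indecomposable_decomposition G s \<sigma> W \<U> \<longleftrightarrow>
     internal_direct_sum \<U> W \<and> (\<forall>U\<in>\<U>. indecomposable_subrep G s \<sigma> U)"

text \<open>For finite-dimensional \<open>W\<close> the number described here exists and is unique, by the
  Krull--Schmidt theorem.\<close>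

definition trivial_summands ::
    "('g, 'm) monoid_scheme \<Rightarrow> ('k::field \<Rightarrow> 'w::ab_group_add \<Rightarrow> 'w) \<Rightarrow> ('g \<Rightarrow> 'w \<Rightarrow> 'w) \<Rightarrow> 'w set \<Rightarrow> nat"
  where
  "trivial_summands G s \<sigma> W = (THE k. \<exists>\<U>. indecomposable_decomposition G s \<sigma> W \<U>
     \<and> k = card {U \<in> \<U>. trivial_subrep G s \<sigma> U})"


section \<open>Tensor powers\<close>

text \<open>
  Tensors are realised as functions on tuples of linear functionals: \<open>v\<^sub>1 \<otimes> \<dots> \<otimes> v\<^sub>n\<close> is
  \<open>(\<phi>\<^sub>1, \<dots>, \<phi>\<^sub>n) \<mapsto> \<phi>\<^sub>1 v\<^sub>1 \<cdots> \<phi>\<^sub>n v\<^sub>n\<close>, and the tensor power is the span of these.  Over a field the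
  canonical map from the abstract tensor power is an isomorphism onto this span.  Lists that are not
  tuples of \<open>n\<close> linear functionals are sent to 0.
\<close>

definition fun_scale :: "'k::field \<Rightarrow> ('a \<Rightarrow> 'k) \<Rightarrow> 'a \<Rightarrow> 'k" where
  "fun_scale c t = (\<lambda>x. c * t x)"

definition pure_tensor ::
    "('k::field \<Rightarrow> 'v::ab_group_add \<Rightarrow> 'v) \<Rightarrow> 'v list \<Rightarrow> ('v \<Rightarrow> 'k) list \<Rightarrow> 'k" where
  "pure_tensor s vs = (\<lambda>\<phi>s.
     if length \<phi>s = length vs \<and> (\<forall>\<phi>\<in>set \<phi>s. Vector_Spaces.linear s (*) \<phi>)
     then \<Prod>i<length vs. (\<phi>s ! i) (vs ! i) else 0)"

definition tensor_power ::
    "('k::field \<Rightarrow> 'v::ab_group_add \<Rightarrow> 'v) \<Rightarrow> nat \<Rightarrow> (('v \<Rightarrow> 'k) list \<Rightarrow> 'k) set" where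
  "tensor_power s n = Modules.module.span fun_scale {pure_tensor s vs | vs. length vs = n}"

text \<open>The diagonal action; see \<open>tensor_action_pure_tensor\<close> below.\<close>

definition tensor_action ::
    "('g \<Rightarrow> 'v \<Rightarrow> 'v) \<Rightarrow> 'g \<Rightarrow> (('v \<Rightarrow> 'k) list \<Rightarrow> 'k) \<Rightarrow> ('v \<Rightarrow> 'k) list \<Rightarrow> 'k" where
  "tensor_action \<rho> g t = (\<lambda>\<phi>s. t (map (\<lambda>\<phi>. \<phi> \<circ> \<rho> g) \<phi>s))"

definition trivial_growth ::
    "('g, 'm) monoid_scheme \<Rightarrow> ('k::field \<Rightarrow> 'v::ab_group_add \<Rightarrow> 'v) \<Rightarrow> ('g \<Rightarrow> 'v \<Rightarrow> 'v) \<Rightarrow> ereal"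
  where
  "trivial_growth G s \<rho> = limsup (\<lambda>n. ereal (root n (real
     (trivial_summands G fun_scale (tensor_action \<rho>) (tensor_power s n)))))"


section \<open>The model of the tensor power\<close>

lemma vector_space_fun_scale: "vector_space (fun_scale :: 'k::field \<Rightarrow> ('a \<Rightarrow> 'k) \<Rightarrow> 'a \<Rightarrow> 'k)"
  by unfold_locales (auto simp: fun_scale_def fun_eq_iff algebra_simps)

lemma tensor_action_pure_tensor:
  fixes s :: "'k::field \<Rightarrow> 'v::ab_group_add \<Rightarrow> 'v"
  assumes "\<rho> g \<in> carrier (GL s)"
  shows "tensor_action \<rho> g (pure_tensor s vs) = pure_tensor s (map (\<rho> g) vs)"
proof -
  have lin: "Vector_Spaces.linear s s (\<rho> g)" and bij: "bij (\<rho> g)"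
    using assms by (auto simp: GL_def)
  have eq: "Vector_Spaces.linear s (*) (\<phi> \<circ> \<rho> g) \<longleftrightarrow> Vector_Spaces.linear s (*) \<phi>" for \<phi> :: "'v \<Rightarrow> 'k"
  proof
    assume "Vector_Spaces.linear s (*) \<phi>"
    then show "Vector_Spaces.linear s (*) (\<phi> \<circ> \<rho> g)"
      using lin by (rule Vector_Spaces.linear_compose[rotated])
  next
    assume l: "Vector_Spaces.linear s (*) (\<phi> \<circ> \<rho> g)"
    interpret vector_space_pair s s
      using lin by (auto simp: vector_space_pair_def Vector_Spaces.linear_def)
    have "\<exists>h. Vector_Spaces.linear s s h \<and> \<rho> g \<circ> h = id"
      using linear_surjective_right_inverse[OF lin] bij by (simp add: bij_def)
    then obtain h where h: "Vector_Spaces.linear s s h" "\<rho> g \<circ> h = id" by blast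
    have "Vector_Spaces.linear s (*) ((\<phi> \<circ> \<rho> g) \<circ> h)"
      using h(1) l by (rule Vector_Spaces.linear_compose)
    also have "(\<phi> \<circ> \<rho> g) \<circ> h = \<phi>" using h(2) by (simp add: comp_assoc)
    finally show "Vector_Spaces.linear s (*) \<phi>" .
  qed
  show ?thesis
    by (rule ext) (auto simp: tensor_action_def pure_tensor_def eq)
qed

lemma pure_tensor_span:
  fixes s :: "'k::field \<Rightarrow> 'v::ab_group_add \<Rightarrow> 'v"
  assumes vs: "vector_space s" and B: "Modules.module.span s B = UNIV"
  shows "pure_tensor s (xs @ ws) \<in> Modules.module.span fun_scale
           {pure_tensor s (us @ ws) | us. set us \<subseteq> B \<and> length us = length xs}"
proof (induction xs arbitrary: ws rule: rev_induct)
  case Nil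
  interpret F: vector_space "fun_scale :: 'k \<Rightarrow> (('v \<Rightarrow> 'k) list \<Rightarrow> 'k) \<Rightarrow> _"
    by (rule vector_space_fun_scale)
  show ?case by (auto intro!: F.span_base)
next
  case (snoc x xs)
  interpret vector_space s by fact
  interpret F: vector_space "fun_scale :: 'k \<Rightarrow> (('v \<Rightarrow> 'k) list \<Rightarrow> 'k) \<Rightarrow> _"
    by (rule vector_space_fun_scale)
  let ?S = "{pure_tensor s (us @ ws) | us. set us \<subseteq> B \<and> length us = Suc (length xs)}"
  define n where "n = length xs"
  have pt: "pure_tensor s (xs @ y # ws) \<phi>s =
     (if length \<phi>s = Suc (n + length ws) \<and> (\<forall>\<phi>\<in>set \<phi>s. Vector_Spaces.linear s (*) \<phi>)
      then (\<phi>s ! n) y * (\<Prod>i\<in>{..<Suc (n + length ws)} - {n}. (\<phi>s ! i) ((xs @ 0 # ws) ! i)) else 0)"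
    for y \<phi>s
  proof -
    have "(\<Prod>i<Suc (n + length ws). (\<phi>s ! i) ((xs @ y # ws) ! i)) =
      (\<phi>s ! n) y * (\<Prod>i\<in>{..<Suc (n + length ws)} - {n}. (\<phi>s ! i) ((xs @ y # ws) ! i))"
      by (subst prod.remove[of _ n]) (auto simp: n_def)
    also have "(\<Prod>i\<in>{..<Suc (n + length ws)} - {n}. (\<phi>s ! i) ((xs @ y # ws) ! i)) =
       (\<Prod>i\<in>{..<Suc (n + length ws)} - {n}. (\<phi>s ! i) ((xs @ 0 # ws) ! i))"
      by (rule prod.cong) (auto simp: n_def nth_append nth_Cons split: nat.splits)
    finally show ?thesis by (simp add: pure_tensor_def n_def)
  qed
  have lin0: "\<phi> 0 = 0" and linadd: "\<phi> (a + b) = \<phi> a + \<phi> b" and linsc: "\<phi> (s c a) = c * \<phi> a"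
    if "Vector_Spaces.linear s (*) \<phi>" for \<phi> :: "'v \<Rightarrow> 'k" and a b c
  proof -
    interpret l: Vector_Spaces.linear s "(*)" \<phi> by fact
    show "\<phi> 0 = 0" "\<phi> (a + b) = \<phi> a + \<phi> b" "\<phi> (s c a) = c * \<phi> a"
      by (simp_all add: l.add l.scale l.zero)
  qed
  have lin: "\<phi>s ! n \<in> set \<phi>s" if "length \<phi>s = Suc (n + length ws)" for \<phi>s :: "('v \<Rightarrow> 'k) list"
    using that by simp
  have "x \<in> span B" using B by simp
  then have "pure_tensor s (xs @ x # ws) \<in> F.span ?S"
  proof (induction rule: span_induct_alt)
    case base
    have eq: "pure_tensor s (xs @ 0 # ws) = 0"
      using lin by (auto simp: fun_eq_iff pt lin0)
    show ?case unfolding eq by (rule F.span_zero)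
  next
    case (step c b y)
    have "pure_tensor s (xs @ (s c b + y) # ws) =
       fun_scale c (pure_tensor s (xs @ b # ws)) + pure_tensor s (xs @ y # ws)"
      using lin by (auto simp: fun_eq_iff pt linadd linsc fun_scale_def algebra_simps)
    note eq = this
    have b: "pure_tensor s (xs @ b # ws) \<in> F.span ?S"
    proof -
      have "{pure_tensor s (us @ b # ws) | us. set us \<subseteq> B \<and> length us = length xs} \<subseteq> ?S"
      proof clarify
        fix us assume "set us \<subseteq> B" "length us = length xs"
        then show "\<exists>us'. pure_tensor s (us @ b # ws) = pure_tensor s (us' @ ws) \<and>
            set us' \<subseteq> B \<and> length us' = Suc (length xs)"
          using step(1) by (intro exI[of _ "us @ [b]"]) auto
      qed
      from F.span_mono[OF this] show ?thesis
        using snoc[of "b # ws"] by blast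
    qed
    show ?case
      unfolding eq by (rule F.span_add[OF F.span_scale[OF b] step(2)])
  qed
  then show ?case by simp
qed

text \<open>The pure tensors of basis vectors form a basis of the tensor power.\<close>

lemma tensor_power_eq_span:
  fixes s :: "'k::field \<Rightarrow> 'v::ab_group_add \<Rightarrow> 'v"
  assumes "vector_space s" and "Modules.module.span s B = UNIV"
  shows "tensor_power s n =
    Modules.module.span fun_scale (pure_tensor s ` {us. set us \<subseteq> B \<and> length us = n})"
proof -
  interpret F: vector_space "fun_scale :: 'k \<Rightarrow> (('v \<Rightarrow> 'k) list \<Rightarrow> 'k) \<Rightarrow> _"
    by (rule vector_space_fun_scale)
  have "pure_tensor s xs \<in> F.span (pure_tensor s ` {us. set us \<subseteq> B \<and> length us = n})"
    if "length xs = n" for xs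
  proof -
    have "{pure_tensor s us | us. set us \<subseteq> B \<and> length us = n}
        = pure_tensor s ` {us. set us \<subseteq> B \<and> length us = n}" by blast
    then show ?thesis using pure_tensor_span[OF assms, of xs "[]"] that by simp
  qed
  then show ?thesis
    unfolding tensor_power_def
    by (intro antisym F.span_minimal F.span_mono F.subspace_span) auto
qed

lemma pure_tensor_independent:
  fixes s :: "'k::field \<Rightarrow> 'v::ab_group_add \<Rightarrow> 'v"
  assumes "vector_space s" and B: "\<not> Modules.module.dependent s B" and fin: "finite B"
  shows "inj_on (pure_tensor s) {us. set us \<subseteq> B \<and> length us = n}"
    and "\<not> Modules.module.dependent fun_scale (pure_tensor s ` {us. set us \<subseteq> B \<and> length us = n})"
proof -
  interpret vector_space s by fact
  interpret F: vector_space "fun_scale :: 'k \<Rightarrow> (('v \<Rightarrow> 'k) list \<Rightarrow> 'k) \<Rightarrow> _"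
    by (rule vector_space_fun_scale)
  interpret P: vector_space_pair s "(*) :: 'k \<Rightarrow> 'k \<Rightarrow> 'k"
    by unfold_locales (auto simp: algebra_simps)
  let ?I = "{us. set us \<subseteq> B \<and> length us = n}"
  define dual :: "'v \<Rightarrow> 'v \<Rightarrow> 'k" where
    "dual b = P.construct B (\<lambda>x. if x = b then 1 else 0)" for b
  have dual: "Vector_Spaces.linear s (*) (dual b)" for b
    unfolding dual_def by (rule P.linear_construct[OF B])
  have dual_eq: "dual b x = (if x = b then 1 else 0)" if "x \<in> B" for b x
    unfolding dual_def by (rule P.construct_basis[OF B that])
  have delta: "pure_tensor s us (map dual ws) = (if us = ws then 1 else 0)"
    if "us \<in> ?I" "ws \<in> ?I" for us ws
  proof -
    have "pure_tensor s us (map dual ws) = (\<Prod>i<n. dual (ws ! i) (us ! i))"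
      using that dual by (auto simp: pure_tensor_def)
    also have "\<dots> = (\<Prod>i<n. if us ! i = ws ! i then 1 else 0)"
      using that by (intro prod.cong) (auto simp: dual_eq subset_iff)
    also have "\<dots> = (if us = ws then 1 else 0)"
    proof (cases "us = ws")
      case False
      have "length us = n" "length ws = n" using that by auto
      then have "\<exists>i<n. us ! i \<noteq> ws ! i" using False by (simp add: list_eq_iff_nth_eq)
      then obtain i where "i < n" "us ! i \<noteq> ws ! i" by blast
      then have "(\<Prod>i<n. if us ! i = ws ! i then 1 else 0) = (0 :: 'k)"
        by (intro prod_zero) auto
      then show ?thesis using False by simp
    qed simp
    finally show ?thesis .
  qed
  show inj: "inj_on (pure_tensor s) ?I"
  proof (rule inj_onI)
    fix us ws assume "us \<in> ?I" "ws \<in> ?I" "pure_tensor s us = pure_tensor s ws"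
    then have "(if us = ws then 1 else 0) = (1 :: 'k)"
      using delta[of us ws] delta[of ws ws] by metis
    then show "us = ws" by (simp split: if_splits)
  qed
  have finI: "finite ?I" using fin by (rule finite_lists_length_eq)
  show "\<not> F.dependent (pure_tensor s ` ?I)"
  proof (rule F.independent_if_scalars_zero)
    show "finite (pure_tensor s ` ?I)" using finI by simp
  next
    fix f t assume 0: "(\<Sum>x\<in>pure_tensor s ` ?I. fun_scale (f x) x) = 0" and "t \<in> pure_tensor s ` ?I"
    then obtain ws where ws: "ws \<in> ?I" "t = pure_tensor s ws" by blast
    have sum_app: "(\<Sum>x\<in>A. h x) \<phi>s = (\<Sum>x\<in>A. h x \<phi>s)"
      for A :: "'i set" and h :: "'i \<Rightarrow> ('v \<Rightarrow> 'k) list \<Rightarrow> 'k" and \<phi>s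
      by (induction A rule: infinite_finite_induct) auto
    have "0 = (\<Sum>x\<in>pure_tensor s ` ?I. fun_scale (f x) x) (map dual ws)" using 0 by simp
    also have "\<dots> = (\<Sum>us\<in>?I. f (pure_tensor s us) * pure_tensor s us (map dual ws))"
      by (simp add: sum_app sum.reindex[OF inj] fun_scale_def del: mem_Collect_eq)
    also have "\<dots> = (\<Sum>us\<in>?I. if us = ws then f t else 0)"
      by (intro sum.cong) (auto simp: delta ws simp del: mem_Collect_eq)
    also have "\<dots> = f t" using ws(1) finI by (subst sum.delta) auto
    finally show "f t = 0" by simp
  qed
qed

lemma dim_tensor_power:
  fixes s :: "'k::field \<Rightarrow> 'v::ab_group_add \<Rightarrow> 'v"
  assumes "finite_dimensional_vector_space s B"
  shows "vector_space.dim fun_scale (tensor_power s n) = vector_space.dim s UNIV ^ n"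
proof -
  interpret finite_dimensional_vector_space s B by fact
  interpret F: vector_space "fun_scale :: 'k \<Rightarrow> (('v \<Rightarrow> 'k) list \<Rightarrow> 'k) \<Rightarrow> _"
    by (rule vector_space_fun_scale)
  note ind = pure_tensor_independent[OF vector_space_axioms independent_Basis finite_Basis, of n]
  have "F.dim (tensor_power s n) = card {us. set us \<subseteq> B \<and> length us = n}"
    unfolding tensor_power_eq_span[OF vector_space_axioms span_Basis]
    using F.dim_span_eq_card_independent[OF ind(2)] card_image[OF ind(1)] by simp
  also have "\<dots> = card B ^ n" by (rule card_lists_length_eq[OF finite_Basis])
  also have "card B = dim UNIV" by (simp add: dim_UNIV dimension_def)
  finally show ?thesis .
qed

end

theory Submission
  imports
    Defs
    "Jordan_Normal_Form.Char_Poly"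
    "HOL-Library.List_Lexorder"
    "HOL-Combinatorics.Multiset_Permutations"
    "HOL-Real_Asymp.Real_Asymp"
begin

text \<open>
  The number of trivial summands of \<open>W\<close> is the largest size of a linearly independent set of
  invariant vectors in \<open>W\<close> whose span meets the common kernel of the invariant functionals only in \<open>0\<close>.

  If the determinant takes finitely many values, then \<open>det\<^sup>M = 1\<close> on the group for some \<open>M > 0\<close>, and
  products of \<open>M\<close> copies of the determinant, one for each block of a partition of the \<open>d M\<close> tensor
  positions into blocks of size \<open>d\<close>, give invariant tensors and invariant functionals with the same
  integer coordinates.  Positivity of their Gram matrix shows that all independent ones among them
  split off.  The lexicographically least words occurring in them include all
  balanced ballot words, whose number thus bounds the trivial summands from below and grows like \<open>d\<^sup>n\<close>.

  If the determinant takes infinitely many values, its orders are unbounded.  An invariant tensor is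
  fixed by each single \<open>g\<close>, so the invariants have dimension at most the number of words of length
  \<open>n\<close> in the eigenvalues of \<open>g\<close> with product \<open>1\<close>.  Choosing elements \<open>g\<close> of unbounded determinant order
  that satisfy as many independent multiplicative relations as possible yields real weights with
  nonzero sum, the same for all \<open>n\<close>, that vanish on all these words for a suitable \<open>g\<close>; a
  Chernoff bound then gives at most \<open>c\<^sup>n\<close> such words with \<open>c < d\<close>.
\<close>

section \<open>Internal direct sums\<close>

text \<open>The group is abstract and the representation need not be semisimple: an invariant vector
  need not span a direct summand, and counting invariants bounds the trivial summands only from
  above. The lower bound therefore needs invariant functionals as well. Determinants supply both at
  once, because a matrix and its transpose have the same determinant. Integer coordinates matter
  because the field carries no order: nondegeneracy of the pairing is decided over the rationals and
  carried to characteristic zero.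

  For infinitely many determinant values the obstacle is uniformity. All determinants may be roots
  of unity of unbounded order, and then a single \<open>g\<close> need not give an exponential
  saving for all \<open>n\<close>. The element is allowed to depend on \<open>n\<close>, while the
  weights, and with them the base \<open>c\<close>, are not.

  The invariants built here live only in degrees divisible by \<open>d\<close>; the growth rate is a
  limsup, so a suitable subsequence of degrees suffices.\<close>

context vector_space
begin

lemma internal_direct_sum_iff:
  assumes "\<And>U. U \<in> \<U> \<Longrightarrow> subspace U"
  shows "internal_direct_sum \<U> W \<longleftrightarrow>
    finite \<U> \<and> W = {\<Sum>U\<in>\<U>. u U | u. \<forall>U\<in>\<U>. u U \<in> U} \<and>
    (\<forall>u. (\<forall>U\<in>\<U>. u U \<in> U) \<and> (\<Sum>U\<in>\<U>. u U) = 0 \<longrightarrow> (\<forall>U\<in>\<U>. u U = 0))"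
proof -
  let ?f = "\<lambda>u. \<Sum>U\<in>\<U>. u U" and ?P = "\<Pi>\<^sub>E U\<in>\<U>. U"
  have img: "?f ` ?P = {\<Sum>U\<in>\<U>. u U | u. \<forall>U\<in>\<U>. u U \<in> U}"
  proof (intro equalityI subsetI)
    fix w assume "w \<in> {\<Sum>U\<in>\<U>. u U | u. \<forall>U\<in>\<U>. u U \<in> U}"
    then obtain u where u: "w = (\<Sum>U\<in>\<U>. u U)" "\<forall>U\<in>\<U>. u U \<in> U" by blast
    then have "w = ?f (restrict u \<U>)" "restrict u \<U> \<in> ?P" by auto
    then show "w \<in> ?f ` ?P" by blast
  qed auto
  have inj: "inj_on ?f ?P \<longleftrightarrow>
    (\<forall>u. (\<forall>U\<in>\<U>. u U \<in> U) \<and> (\<Sum>U\<in>\<U>. u U) = 0 \<longrightarrow> (\<forall>U\<in>\<U>. u U = 0))" (is "?L \<longleftrightarrow> ?R")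
  proof
    assume L: ?L
    show ?R
    proof clarify
      fix u U assume u: "\<forall>U\<in>\<U>. u U \<in> U" "(\<Sum>U\<in>\<U>. u U) = 0" and U: "U \<in> \<U>"
      have "restrict u \<U> = restrict (\<lambda>_. 0) \<U>"
        by (rule inj_onD[OF L]) (use u assms subspace_0 in auto)
      then show "u U = 0" using U by (metis restrict_apply')
    qed
  next
    assume R: ?R
    show ?L
    proof (rule inj_onI)
      fix u v assume u: "u \<in> ?P" and v: "v \<in> ?P" and eq: "?f u = ?f v"
      have "(\<forall>U\<in>\<U>. u U - v U \<in> U) \<and> (\<Sum>U\<in>\<U>. u U - v U) = 0"
        using u v eq assms by (auto simp: sum_subtractf intro!: subspace_diff)
      then have "\<forall>U\<in>\<U>. u U - v U = 0" by (rule spec[OF R, of "\<lambda>U. u U - v U", THEN mp])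
      then show "u = v" using u v by (intro PiE_ext[OF u v]) auto
    qed
  qed
  have "(a \<and> b \<and> X = Y) = (a \<and> Y = X \<and> b)" for a b and X Y :: "'b set" by blast
  then show ?thesis unfolding internal_direct_sum_def bij_betw_def img inj .
qed

lemma subspace_sum_set:
  assumes "\<And>U. U \<in> \<U> \<Longrightarrow> subspace U"
  shows "subspace {\<Sum>U\<in>\<U>. u U | u. \<forall>U\<in>\<U>. u U \<in> U}" (is "subspace ?S")
proof (rule subspaceI)
  show "0 \<in> ?S" using assms subspace_0 by (intro CollectI exI[of _ "\<lambda>_. 0"]) auto
next
  fix x y assume "x \<in> ?S" "y \<in> ?S"
  then obtain p q where "x = (\<Sum>U\<in>\<U>. p U)" "y = (\<Sum>U\<in>\<U>. q U)"
    "\<forall>U\<in>\<U>. p U \<in> U" "\<forall>U\<in>\<U>. q U \<in> U" by blast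
  then have "x + y = (\<Sum>U\<in>\<U>. p U + q U)" "\<forall>U\<in>\<U>. p U + q U \<in> U"
    using assms subspace_add by (auto simp: sum.distrib)
  then show "x + y \<in> ?S" by blast
next
  fix c x assume "x \<in> ?S"
  then obtain p where "x = (\<Sum>U\<in>\<U>. p U)" "\<forall>U\<in>\<U>. p U \<in> U" by blast
  then have "scale c x = (\<Sum>U\<in>\<U>. scale c (p U))" "\<forall>U\<in>\<U>. scale c (p U) \<in> U"
    using assms subspace_scale by (auto simp: scale_sum_right)
  then show "scale c x \<in> ?S" by blast
qed

lemma subset_sum_set:
  assumes "finite \<U>" "\<And>U. U \<in> \<U> \<Longrightarrow> subspace U" "V \<in> \<U>"
  shows "V \<subseteq> {\<Sum>U\<in>\<U>. u U | u. \<forall>U\<in>\<U>. u U \<in> U}"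
proof
  fix x assume x: "x \<in> V"
  have "x = (\<Sum>U\<in>\<U>. if U = V then x else 0)" using assms(1,3) by simp
  moreover have "\<forall>U\<in>\<U>. (if U = V then x else 0) \<in> U" using x assms(2) subspace_0 by auto
  ultimately show "x \<in> {\<Sum>U\<in>\<U>. u U | u. \<forall>U\<in>\<U>. u U \<in> U}"
    by (intro CollectI exI[of _ "\<lambda>U. if U = V then x else 0"] conjI)
qed

text \<open>A subspace belonging to both families lies in \<open>A \<inter> B\<close> and is zero,
  so with nonzero members the union of the two sets merges no summands.\<close>

lemma internal_direct_sum_Un:
  assumes A: "internal_direct_sum \<A> A" and B: "internal_direct_sum \<B> B"
    and sub: "\<And>U. U \<in> \<A> \<union> \<B> \<Longrightarrow> subspace U \<and> U \<noteq> {0}"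
    and AB: "A \<inter> B = {0}"
  shows "\<A> \<inter> \<B> = {}" "internal_direct_sum (\<A> \<union> \<B>) {a + b | a b. a \<in> A \<and> b \<in> B}"
proof -
  have "internal_direct_sum \<A> A \<longleftrightarrow> finite \<A> \<and> A = {\<Sum>U\<in>\<A>. u U | u. \<forall>U\<in>\<A>. u U \<in> U} \<and>
    (\<forall>u. (\<forall>U\<in>\<A>. u U \<in> U) \<and> (\<Sum>U\<in>\<A>. u U) = 0 \<longrightarrow> (\<forall>U\<in>\<A>. u U = 0))"
    by (rule internal_direct_sum_iff) (use sub in auto)
  with A have finA: "finite \<A>" and A_eq: "A = {\<Sum>U\<in>\<A>. u U | u. \<forall>U\<in>\<A>. u U \<in> U}"
    and A0: "\<And>u. (\<forall>U\<in>\<A>. u U \<in> U) \<Longrightarrow> (\<Sum>U\<in>\<A>. u U) = 0 \<Longrightarrow> (\<forall>U\<in>\<A>. u U = 0)"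
    by blast+
  have "internal_direct_sum \<B> B \<longleftrightarrow> finite \<B> \<and> B = {\<Sum>U\<in>\<B>. u U | u. \<forall>U\<in>\<B>. u U \<in> U} \<and>
    (\<forall>u. (\<forall>U\<in>\<B>. u U \<in> U) \<and> (\<Sum>U\<in>\<B>. u U) = 0 \<longrightarrow> (\<forall>U\<in>\<B>. u U = 0))"
    by (rule internal_direct_sum_iff) (use sub in auto)
  with B have finB: "finite \<B>" and B_eq: "B = {\<Sum>U\<in>\<B>. u U | u. \<forall>U\<in>\<B>. u U \<in> U}"
    and B0: "\<And>u. (\<forall>U\<in>\<B>. u U \<in> U) \<Longrightarrow> (\<Sum>U\<in>\<B>. u U) = 0 \<Longrightarrow> (\<forall>U\<in>\<B>. u U = 0)"
    by blast+
  have memA: "U \<subseteq> A" if "U \<in> \<A>" for U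
    unfolding A_eq by (rule subset_sum_set[OF finA _ that]) (use sub in blast)
  have memB: "U \<subseteq> B" if "U \<in> \<B>" for U
    unfolding B_eq by (rule subset_sum_set[OF finB _ that]) (use sub in blast)
  show disj: "\<A> \<inter> \<B> = {}"
  proof (rule ccontr)
    assume "\<A> \<inter> \<B> \<noteq> {}"
    then obtain U where U: "U \<in> \<A>" "U \<in> \<B>" by blast
    then have "U \<subseteq> {0}" using memA[of U] memB[of U] AB by blast
    then show False using sub[of U] U subspace_0[of U] by auto
  qed
  have split: "(\<Sum>U\<in>\<A> \<union> \<B>. u U) = (\<Sum>U\<in>\<A>. u U) + (\<Sum>U\<in>\<B>. u U)" for u :: "'b set \<Rightarrow> 'b"
    using finA finB disj by (rule sum.union_disjoint)
  have sums: "{a + b | a b. a \<in> A \<and> b \<in> B} = {\<Sum>U\<in>\<A> \<union> \<B>. u U | u. \<forall>U\<in>\<A> \<union> \<B>. u U \<in> U}"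
  proof (intro equalityI subsetI)
    fix w assume "w \<in> {a + b | a b. a \<in> A \<and> b \<in> B}"
    then obtain u v where w: "w = (\<Sum>U\<in>\<A>. u U) + (\<Sum>U\<in>\<B>. v U)"
      and u: "\<forall>U\<in>\<A>. u U \<in> U" and v: "\<forall>U\<in>\<B>. v U \<in> U"
      unfolding A_eq B_eq by blast
    let ?t = "\<lambda>U. if U \<in> \<A> then u U else v U"
    have "(\<Sum>U\<in>\<B>. ?t U) = (\<Sum>U\<in>\<B>. v U)"
      by (rule sum.cong) (use disj in auto)
    then have "w = (\<Sum>U\<in>\<A> \<union> \<B>. ?t U)" unfolding split w by simp
    moreover have "\<forall>U\<in>\<A> \<union> \<B>. ?t U \<in> U" using u v by auto
    ultimately show "w \<in> {\<Sum>U\<in>\<A> \<union> \<B>. u U | u. \<forall>U\<in>\<A> \<union> \<B>. u U \<in> U}" by blast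
  next
    fix w assume "w \<in> {\<Sum>U\<in>\<A> \<union> \<B>. u U | u. \<forall>U\<in>\<A> \<union> \<B>. u U \<in> U}"
    then obtain u where w: "w = (\<Sum>U\<in>\<A> \<union> \<B>. u U)" and u: "\<forall>U\<in>\<A> \<union> \<B>. u U \<in> U" by blast
    have "w = (\<Sum>U\<in>\<A>. u U) + (\<Sum>U\<in>\<B>. u U)" unfolding w by (rule split)
    moreover have "(\<Sum>U\<in>\<A>. u U) \<in> A" "(\<Sum>U\<in>\<B>. u U) \<in> B"
      unfolding A_eq B_eq by (intro CollectI exI[of _ u] conjI refl; use u in simp)+
    ultimately show "w \<in> {a + b | a b. a \<in> A \<and> b \<in> B}" by blast
  qed
  have zero: "\<forall>U\<in>\<A> \<union> \<B>. u U = 0" if u: "\<forall>U\<in>\<A> \<union> \<B>. u U \<in> U" "(\<Sum>U\<in>\<A> \<union> \<B>. u U) = 0" for u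
  proof -
    have a: "(\<Sum>U\<in>\<A>. u U) \<in> A"
      unfolding A_eq by (intro CollectI exI[of _ u] conjI refl; use u(1) in simp)
    have b: "(\<Sum>U\<in>\<B>. u U) \<in> B"
      unfolding B_eq by (intro CollectI exI[of _ u] conjI refl; use u(1) in simp)
    have "subspace B" unfolding B_eq by (rule subspace_sum_set) (use sub in auto)
    moreover have "(\<Sum>U\<in>\<A>. u U) = - (\<Sum>U\<in>\<B>. u U)" using u(2) split eq_neg_iff_add_eq_0 by metis
    ultimately have "(\<Sum>U\<in>\<A>. u U) \<in> B" using b subspace_neg by simp
    then have "(\<Sum>U\<in>\<A>. u U) = 0" using a AB by blast
    moreover from this have "(\<Sum>U\<in>\<B>. u U) = 0" using u(2) by (simp only: split add_0_left)
    ultimately show ?thesis using A0[of u] B0[of u] u(1) by blast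
  qed
  have sub': "subspace U" if "U \<in> \<A> \<union> \<B>" for U using sub that by blast
  have "finite (\<A> \<union> \<B>)" using finA finB by simp
  then show "internal_direct_sum (\<A> \<union> \<B>) {a + b | a b. a \<in> A \<and> b \<in> B}"
    unfolding sums using zero
    by (intro iffD2[OF internal_direct_sum_iff[OF sub']] conjI refl allI impI) blast+
qed

text \<open>The finite spanning set \<open>T\<close> takes the place of a finite-dimensional ambient
  space, since tensors live in an infinite-dimensional function space. A basis of \<open>A\<close>
  extends properly to one of \<open>W\<close>.\<close>

lemma dim_less_of_psubset:
  assumes "subspace A" "A \<subset> W" "W \<subseteq> span T" "finite T"
  shows "dim A < dim W"
proof -
  obtain C where C: "C \<subseteq> A" "independent C" "A \<subseteq> span C" "card C = dim A"
    by (rule basis_exists[of A])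
  have CW: "C \<subseteq> W" by (rule subset_trans[OF C(1) psubset_imp_subset[OF assms(2)]])
  obtain D where D: "C \<subseteq> D" "D \<subseteq> W" "independent D" "W \<subseteq> span D"
    by (rule maximal_independent_subset_extend[OF CW C(2)])
  have "finite D" using independent_span_bound[OF assms(4) D(3) subset_trans[OF D(2) assms(3)]] by simp
  moreover have "C \<noteq> D"
  proof
    assume "C = D"
    then have "W \<subseteq> A" using subset_trans[OF D(4)] span_minimal[OF C(1) assms(1)] by simp
    then show False using assms(2) by blast
  qed
  ultimately have "card C < card D" using D(1) by (intro psubset_card_mono psubsetI)
  then show ?thesis using C(4) basis_card_eq_dim[OF D(2,4,3)] by simp
qed

end

section \<open>Trivial summands and split invariants\<close>

locale linear_action = vector_space s
  for s :: "'k::field \<Rightarrow> 'w::ab_group_add \<Rightarrow> 'w" (infixr "*s" 75) +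
  fixes G :: "('g, 'm) monoid_scheme" and \<sigma> :: "'g \<Rightarrow> 'w \<Rightarrow> 'w"
  assumes linear_action: "g \<in> carrier G \<Longrightarrow> Vector_Spaces.linear s s (\<sigma> g)"
begin

lemma
  assumes "g \<in> carrier G"
  shows action_zero: "\<sigma> g 0 = 0" and action_add: "\<sigma> g (x + y) = \<sigma> g x + \<sigma> g y"
    and action_scale: "\<sigma> g (c *s x) = c *s \<sigma> g x"
    and action_sum: "\<sigma> g (\<Sum>i\<in>I. f i) = (\<Sum>i\<in>I. \<sigma> g (f i))"
proof -
  interpret l: Vector_Spaces.linear s s "\<sigma> g" using assms by (rule linear_action)
  show "\<sigma> g 0 = 0" "\<sigma> g (x + y) = \<sigma> g x + \<sigma> g y" "\<sigma> g (c *s x) = c *s \<sigma> g x"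
    "\<sigma> g (\<Sum>i\<in>I. f i) = (\<Sum>i\<in>I. \<sigma> g (f i))"
    by (simp_all add: l.add l.scale l.zero l.sum)
qed

lemma subrep_sum_set:
  assumes "\<And>U. U \<in> \<U> \<Longrightarrow> subrep G s \<sigma> U"
  shows "subrep G s \<sigma> {\<Sum>U\<in>\<U>. u U | u. \<forall>U\<in>\<U>. u U \<in> U}"
  unfolding subrep_def
proof (intro conjI ballI)
  show "subspace {\<Sum>U\<in>\<U>. u U | u. \<forall>U\<in>\<U>. u U \<in> U}"
    by (rule subspace_sum_set) (use assms in \<open>auto simp: subrep_def\<close>)
next
  fix g x assume g: "g \<in> carrier G" and "x \<in> {\<Sum>U\<in>\<U>. u U | u. \<forall>U\<in>\<U>. u U \<in> U}"
  then obtain u where u: "x = (\<Sum>U\<in>\<U>. u U)" "\<forall>U\<in>\<U>. u U \<in> U" by blast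
  then have "\<sigma> g x = (\<Sum>U\<in>\<U>. \<sigma> g (u U))" "\<forall>U\<in>\<U>. \<sigma> g (u U) \<in> U"
    using g assms by (auto simp: action_sum subrep_def)
  then show "\<sigma> g x \<in> {\<Sum>U\<in>\<U>. u U | u. \<forall>U\<in>\<U>. u U \<in> U}" by blast
qed

text \<open>Induction on the dimension: a decomposable space is the sum of two proper
  subrepresentations, both of smaller dimension. The zero space receives the empty family, since
  indecomposables are nonzero.\<close>

lemma indecomposable_decomposition_exists:
  assumes "subrep G s \<sigma> W" "W \<subseteq> span T" "finite T"
  shows "\<exists>\<U>. indecomposable_decomposition G s \<sigma> W \<U>"
  using assms(1,2)
proof (induction "dim W" arbitrary: W rule: less_induct)
  case less
  have sub: "subspace W" using less.prems(1) by (simp add: subrep_def)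
  consider "W = {0}" | "indecomposable_subrep G s \<sigma> W" | A B where
    "subrep G s \<sigma> A" "subrep G s \<sigma> B" "A \<inter> B = {0}" "{a + b | a b. a \<in> A \<and> b \<in> B} = W"
    "A \<noteq> {0}" "B \<noteq> {0}"
    using less.prems(1) unfolding indecomposable_subrep_def by blast
  then show ?case
  proof cases
    case 1
    have "internal_direct_sum {} W \<longleftrightarrow> finite ({} :: 'w set set) \<and>
        W = {\<Sum>U\<in>{}. u U | u :: 'w set \<Rightarrow> 'w. \<forall>U\<in>{}. u U \<in> U} \<and>
        (\<forall>u :: 'w set \<Rightarrow> 'w. (\<forall>U\<in>{}. u U \<in> U) \<and> (\<Sum>U\<in>{}. u U) = 0 \<longrightarrow> (\<forall>U\<in>{}. u U = 0))"
      by (rule internal_direct_sum_iff) simp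
    then have "indecomposable_decomposition G s \<sigma> W {}"
      using 1 by (simp add: indecomposable_decomposition_def)
    then show ?thesis ..
  next
    case 2
    have "internal_direct_sum {W} W \<longleftrightarrow> finite {W} \<and>
        W = {\<Sum>U\<in>{W}. u U | u :: 'w set \<Rightarrow> 'w. \<forall>U\<in>{W}. u U \<in> U} \<and>
        (\<forall>u :: 'w set \<Rightarrow> 'w. (\<forall>U\<in>{W}. u U \<in> U) \<and> (\<Sum>U\<in>{W}. u U) = 0 \<longrightarrow> (\<forall>U\<in>{W}. u U = 0))"
      by (rule internal_direct_sum_iff) (use sub in simp)
    moreover have "W = {u W | u :: 'w set \<Rightarrow> 'w. u W \<in> W}"
    proof (intro equalityI subsetI)
      fix w assume "w \<in> W"
      then show "w \<in> {u W | u :: 'w set \<Rightarrow> 'w. u W \<in> W}"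
        by (intro CollectI exI[of _ "\<lambda>_. w"]) simp
    qed auto
    ultimately have "indecomposable_decomposition G s \<sigma> W {W}"
      using 2 by (simp add: indecomposable_decomposition_def)
    then show ?thesis ..
  next
    case (3 A B)
    have sA: "subspace A" and sB: "subspace B" using 3(1,2) by (auto simp: subrep_def)
    have AW: "A \<subseteq> W" unfolding 3(4)[symmetric] using subspace_0[OF sB] by force
    have BW: "B \<subseteq> W" unfolding 3(4)[symmetric] using subspace_0[OF sA] by force
    have "A \<noteq> W" "B \<noteq> W" using AW BW 3(3,5,6) by blast+
    then have "dim A < dim W" "dim B < dim W"
      using dim_less_of_psubset[OF _ _ less.prems(2) assms(3)] AW BW sA sB by blast+
    then obtain \<A> \<B> where A: "indecomposable_decomposition G s \<sigma> A \<A>"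
      and B: "indecomposable_decomposition G s \<sigma> B \<B>"
      using less.hyps 3(1,2) AW BW less.prems(2) by (metis subset_trans)
    have "internal_direct_sum (\<A> \<union> \<B>) W"
      unfolding 3(4)[symmetric]
      by (rule internal_direct_sum_Un[OF _ _ _ 3(3)])
         (use A B in \<open>auto simp: indecomposable_decomposition_def indecomposable_subrep_def subrep_def\<close>)
    then have "indecomposable_decomposition G s \<sigma> W (\<A> \<union> \<B>)"
      using A B by (auto simp: indecomposable_decomposition_def)
    then show ?thesis ..
  qed
qed

text \<open>For \<open>v\<close> in \<open>W\<close>, the part of \<open>H\<close> inside
  \<open>W\<close> is an invariant complement of the line of \<open>v\<close>. When \<open>v\<close>
  is invariant, \<open>G\<close> acts trivially on \<open>W\<close> modulo this part, so
  \<open>H\<close> plays the role of the kernel of an invariant functional that is nonzero at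
  \<open>v\<close>. \<open>H\<close> may leave \<open>W\<close>, which allows the same
  \<open>H\<close> to be used for a summand of \<open>W\<close>.\<close>

definition split_by :: "'w set \<Rightarrow> 'w \<Rightarrow> 'w set \<Rightarrow> bool" where
  "split_by W v H \<longleftrightarrow> subrep G s \<sigma> H \<and> v \<notin> H \<and> (\<forall>w\<in>W. \<exists>c. w - c *s v \<in> H)"

text \<open>The splitting condition is imposed on the whole span: each member of \<open>S\<close>
  may split off although some combination of them does not.\<close>

definition split_invariants :: "'w set \<Rightarrow> 'w set \<Rightarrow> bool" where
  "split_invariants W S \<longleftrightarrow> finite S \<and> S \<subseteq> W \<and> independent S \<and>
     (\<forall>v\<in>S. \<forall>g\<in>carrier G. \<sigma> g v = v) \<and> (\<forall>v\<in>span S. v \<noteq> 0 \<longrightarrow> (\<exists>H. split_by W v H))"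

lemma subspace_dim_one:
  assumes "subspace U" "dim U = 1"
  obtains u where "u \<noteq> 0" "u \<in> U" "U = span {u}"
proof -
  obtain C where C: "C \<subseteq> U" "independent C" "U \<subseteq> span C" "card C = dim U"
    by (rule basis_exists[of U])
  then obtain u where u: "C = {u}" using assms(2) card_1_singletonE by metis
  then have "U = span {u}" using C span_minimal[OF C(1) assms(1)] by auto
  then show ?thesis using that[of u] C u by auto
qed

text \<open>The line of \<open>v\<close> and \<open>U \<inter> H\<close> are complementary
  subrepresentations of \<open>U\<close>; the line is nonzero, so indecomposability forces
  \<open>U \<inter> H\<close> to vanish and \<open>U\<close> to be the line.\<close>

lemma indecomposable_split_trivial:
  assumes U: "indecomposable_subrep G s \<sigma> U" and v: "v \<in> U" "\<And>g. g \<in> carrier G \<Longrightarrow> \<sigma> g v = v"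
    and H: "split_by U v H"
  shows "trivial_subrep G s \<sigma> U"
proof -
  have sU: "subrep G s \<sigma> U" "subspace U" using U by (auto simp: indecomposable_subrep_def subrep_def)
  have sH: "subrep G s \<sigma> H" "subspace H" "v \<notin> H" using H by (auto simp: split_by_def subrep_def)
  have v0: "v \<noteq> 0" using sH subspace_0 by metis
  have sp: "span {v} \<subseteq> U" using v sU by (intro span_minimal) auto
  have fixv: "\<sigma> g x = x" if "g \<in> carrier G" "x \<in> span {v}" for g x
    using that v(2) by (auto simp: span_singleton action_scale)
  have 1: "subrep G s \<sigma> (span {v})" using fixv by (simp add: subrep_def)
  have 2: "subrep G s \<sigma> (U \<inter> H)" using sU sH by (auto simp: subrep_def subspace_inter)
  have 3: "span {v} \<inter> (U \<inter> H) = {0}"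
  proof -
    have "x = 0" if x: "x \<in> span {v}" "x \<in> H" for x
    proof -
      obtain c where c: "x = c *s v" using x(1) by (auto simp: span_singleton)
      have "c = 0"
      proof (rule ccontr)
        assume "c \<noteq> 0"
        then have "v = inverse c *s x" using c by simp
        then show False using sH subspace_scale x(2) by metis
      qed
      then show ?thesis using c by simp
    qed
    then show ?thesis using sU sH subspace_0 span_zero by auto
  qed
  have 4: "{a + b | a b. a \<in> span {v} \<and> b \<in> U \<inter> H} = U"
  proof (intro equalityI subsetI)
    fix x assume "x \<in> {a + b | a b. a \<in> span {v} \<and> b \<in> U \<inter> H}"
    then show "x \<in> U" using sp sU subspace_add by auto
  next
    fix x assume x: "x \<in> U"
    then obtain c where c: "x - c *s v \<in> H" using H by (auto simp: split_by_def)
    moreover have "c *s v \<in> span {v}" by (simp add: span_base span_scale)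
    moreover from this have "x - c *s v \<in> U" using x sp sU subspace_diff by auto
    moreover have "x = c *s v + (x - c *s v)" by simp
    ultimately show "x \<in> {a + b | a b. a \<in> span {v} \<and> b \<in> U \<inter> H}" by blast
  qed
  have "span {v} \<noteq> {0}" using v0 span_base by blast
  then have "U \<inter> H = {0}" using U 1 2 3 4 unfolding indecomposable_subrep_def by blast
  then have Uv: "U = span {v}" using 4 by auto
  then have "dim U = 1" using v0 dim_span_eq_card_independent[of "{v}"] by simp
  then show ?thesis unfolding trivial_subrep_def using sU fixv Uv by simp
qed

section \<open>Trivial summands of a fixed decomposition\<close>

context
  fixes W \<U>
  assumes dec: "indecomposable_decomposition G s \<sigma> W \<U>"
begin

lemma
  shows decomposition_finite: "finite \<U>"
    and decomposition_sum: "W = {\<Sum>U\<in>\<U>. u U | u. \<forall>U\<in>\<U>. u U \<in> U}"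
    and decomposition_zero: "\<forall>U\<in>\<U>. u U \<in> U \<Longrightarrow> (\<Sum>U\<in>\<U>. u U) = 0 \<Longrightarrow> U \<in> \<U> \<Longrightarrow> u U = 0"
    and decomposition_subrep: "U \<in> \<U> \<Longrightarrow> subrep G s \<sigma> U"
    and decomposition_subspace: "U \<in> \<U> \<Longrightarrow> subspace U"
proof -
  have sr: "subrep G s \<sigma> V" if "V \<in> \<U>" for V
    using dec that by (auto simp: indecomposable_decomposition_def indecomposable_subrep_def)
  then have ss: "subspace V" if "V \<in> \<U>" for V
    using that by (auto simp: subrep_def)
  have "internal_direct_sum \<U> W" using dec by (simp add: indecomposable_decomposition_def)
  then have *: "finite \<U> \<and> W = {\<Sum>U\<in>\<U>. u U | u. \<forall>U\<in>\<U>. u U \<in> U} \<and>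
    (\<forall>u. (\<forall>U\<in>\<U>. u U \<in> U) \<and> (\<Sum>U\<in>\<U>. u U) = 0 \<longrightarrow> (\<forall>U\<in>\<U>. u U = 0))"
    by (rule iffD1[OF internal_direct_sum_iff, rotated]) (rule ss)
  show "finite \<U>" "W = {\<Sum>U\<in>\<U>. u U | u. \<forall>U\<in>\<U>. u U \<in> U}" using * by blast+
  show "\<forall>U\<in>\<U>. u U \<in> U \<Longrightarrow> (\<Sum>U\<in>\<U>. u U) = 0 \<Longrightarrow> U \<in> \<U> \<Longrightarrow> u U = 0" using * by blast
  show "U \<in> \<U> \<Longrightarrow> subrep G s \<sigma> U" by (rule sr)
  show "U \<in> \<U> \<Longrightarrow> subspace U" by (rule ss)
qed

lemma decomposition_subset: "U \<in> \<U> \<Longrightarrow> U \<subseteq> W"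
  by (subst decomposition_sum)
     (rule subset_sum_set[OF decomposition_finite decomposition_subspace])

abbreviation "triv \<equiv> {U \<in> \<U>. trivial_subrep G s \<sigma> U}"

abbreviation "nontriv_sum \<equiv> {\<Sum>U\<in>\<U> - triv. u U | u. \<forall>U\<in>\<U> - triv. u U \<in> U}"

text \<open>One generator is taken from each trivial summand. A nonzero vector of their span has a
  nonzero component in some trivial summand, and the sum of all the other summands, trivial or not,
  is its complement.\<close>

lemma trivial_generators:
  obtains S where "split_invariants W S" "card S = card triv"
    "\<And>w. w \<in> W \<Longrightarrow> \<exists>q\<in>span S. w - q \<in> nontriv_sum"
proof -
  have "\<exists>u. u \<noteq> 0 \<and> u \<in> U \<and> U = span {u}" if "U \<in> triv" for U
  proof -
    have "subspace U" "dim U = 1" using that by (auto simp: trivial_subrep_def subrep_def)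
    then show ?thesis using subspace_dim_one by metis
  qed
  then obtain e where e: "\<And>U. U \<in> triv \<Longrightarrow> e U \<noteq> 0 \<and> e U \<in> U \<and> U = span {e U}" by metis
  have fin: "finite triv" using decomposition_finite by simp
  have inj: "inj_on e triv" by (rule inj_onI) (metis e)
  let ?S = "e ` triv"
  have lift: "\<forall>U\<in>triv. c U = 0" if c: "(\<Sum>U\<in>triv. c U *s e U) = 0" for c
  proof
    fix U assume U: "U \<in> triv"
    let ?u = "\<lambda>U. if U \<in> triv then c U *s e U else 0"
    have "(\<Sum>U\<in>\<U>. ?u U) = (\<Sum>U\<in>triv. c U *s e U)"
      using decomposition_finite by (intro sum.mono_neutral_cong_right) auto
    moreover have "\<forall>U\<in>\<U>. ?u U \<in> U"
      using e decomposition_subspace subspace_scale subspace_0 by auto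
    ultimately have "?u U = 0" using c U decomposition_zero[of ?u U] by simp
    then show "c U = 0" using U e by auto
  qed
  have indep: "independent ?S"
  proof (rule independent_if_scalars_zero)
    fix f x assume 0: "(\<Sum>x\<in>?S. f x *s x) = 0" and x: "x \<in> ?S"
    have "(\<Sum>U\<in>triv. f (e U) *s e U) = 0" using 0 by (simp add: sum.reindex[OF inj])
    then show "f x = 0" using lift[of "\<lambda>U. f (e U)"] x by auto
  qed (use fin in simp)
  have split: "\<exists>H. split_by W v H" if v: "v \<in> span ?S" "v \<noteq> 0" for v
  proof -
    obtain f where f: "v = (\<Sum>x\<in>?S. f x *s x)"
      using v(1) fin by (auto simp: span_finite)
    define u where "u U = (if U \<in> triv then f (e U) *s e U else 0)" for U
    have uU: "\<forall>U\<in>\<U>. u U \<in> U"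
      using e decomposition_subspace subspace_scale subspace_0 by (auto simp: u_def)
    have vu: "v = (\<Sum>U\<in>\<U>. u U)"
      unfolding f sum.reindex[OF inj] u_def using decomposition_finite
      by (intro sum.mono_neutral_cong_left) auto
    obtain U0 where U0: "U0 \<in> \<U>" "u U0 \<noteq> 0" using v(2) vu by (metis sum.neutral)
    then have U0t: "U0 \<in> triv" "f (e U0) \<noteq> 0" by (auto simp: u_def split: if_splits)
    define H where "H = {\<Sum>U\<in>\<U> - {U0}. h U | h. \<forall>U\<in>\<U> - {U0}. h U \<in> U}"
    have rem: "(\<Sum>U\<in>\<U>. h U) = h U0 + (\<Sum>U\<in>\<U> - {U0}. h U)" for h :: "'w set \<Rightarrow> 'w"
      using decomposition_finite U0(1) by (rule sum.remove)
    have "subrep G s \<sigma> H"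
      unfolding H_def by (rule subrep_sum_set) (use decomposition_subrep in auto)
    moreover have "v \<notin> H"
    proof
      assume "v \<in> H"
      then obtain h where h: "v = (\<Sum>U\<in>\<U> - {U0}. h U)" "\<forall>U\<in>\<U> - {U0}. h U \<in> U"
        unfolding H_def by blast
      let ?d = "\<lambda>U. u U - (if U = U0 then 0 else h U)"
      have "\<forall>U\<in>\<U>. ?d U \<in> U"
        using uU h(2) decomposition_subspace subspace_diff subspace_0 by auto
      moreover have "(\<Sum>U\<in>\<U> - {U0}. if U = U0 then 0 else h U) = (\<Sum>U\<in>\<U> - {U0}. h U)"
        by (rule sum.cong) auto
      then have "(\<Sum>U\<in>\<U>. ?d U) = 0"
        unfolding sum_subtractf vu[symmetric] rem[of "\<lambda>U. if U = U0 then 0 else h U"]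
        using h(1) by simp
      ultimately have "?d U0 = 0" using decomposition_zero[of ?d U0] U0(1) by blast
      then show False using U0(2) by simp
    qed
    moreover have "\<exists>c. w - c *s v \<in> H" if w: "w \<in> W" for w
    proof -
      obtain x where x: "w = (\<Sum>U\<in>\<U>. x U)" "\<forall>U\<in>\<U>. x U \<in> U"
        using w unfolding decomposition_sum by blast
      have "x U0 \<in> span {e U0}" using x(2) U0(1) U0t(1) e by blast
      then obtain a where a: "x U0 = a *s e U0" by (auto simp: span_singleton)
      define c where "c = a / f (e U0)"
      have "x U0 - c *s u U0 = 0" using U0t a by (simp add: u_def c_def)
      moreover have "w - c *s v = (\<Sum>U\<in>\<U>. x U - c *s u U)"
        unfolding x(1) vu by (simp add: sum_subtractf scale_sum_right)
      ultimately have "w - c *s v = (\<Sum>U\<in>\<U> - {U0}. x U - c *s u U)"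
        using rem[of "\<lambda>U. x U - c *s u U"] by simp
      moreover have "\<forall>U\<in>\<U> - {U0}. x U - c *s u U \<in> U"
        using x(2) uU decomposition_subspace subspace_diff subspace_scale by auto
      ultimately have "w - c *s v \<in> H" unfolding H_def by blast
      then show ?thesis ..
    qed
    ultimately show ?thesis by (auto simp: split_by_def)
  qed
  have sub: "?S \<subseteq> W" using e decomposition_subset by blast
  have inv: "\<forall>v\<in>?S. \<forall>g\<in>carrier G. \<sigma> g v = v" using e by (auto simp: trivial_subrep_def)
  have "split_invariants W ?S"
    unfolding split_invariants_def using fin indep split sub inv by blast
  moreover have "card ?S = card triv" using inj by (rule card_image)
  moreover have "\<exists>q\<in>span ?S. w - q \<in> nontriv_sum" if w: "w \<in> W" for w
  proof -
    obtain x where x: "w = (\<Sum>U\<in>\<U>. x U)" "\<forall>U\<in>\<U>. x U \<in> U"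
      using w unfolding decomposition_sum by blast
    have "(\<Sum>U\<in>triv. x U) \<in> span ?S"
    proof (rule span_sum)
      fix U assume U: "U \<in> triv"
      then have "x U \<in> span {e U}" using x(2) e by blast
      moreover have "span {e U} \<subseteq> span ?S" using U by (intro span_mono) auto
      ultimately show "x U \<in> span ?S" by blast
    qed
    moreover have "w - (\<Sum>U\<in>triv. x U) = (\<Sum>U\<in>\<U> - triv. x U)"
      unfolding x(1) using sum.subset_diff[of triv \<U> x] decomposition_finite by simp
    then have "w - (\<Sum>U\<in>triv. x U) \<in> nontriv_sum" using x(2) by blast
    ultimately show ?thesis by blast
  qed
  ultimately show ?thesis using that[of ?S] by blast
qed

text \<open>The components of an invariant vector are invariant, because the summands are stable and
  the sum is direct. If \<open>H\<close> splits off \<open>v\<close>, some component lies outside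
  \<open>H\<close> and is split off its own summand by \<open>H\<close>, which would make that
  nontrivial summand trivial.\<close>

lemma nontriv_sum_not_split:
  assumes v: "v \<in> nontriv_sum" "\<And>g. g \<in> carrier G \<Longrightarrow> \<sigma> g v = v" and H: "split_by W v H"
  shows False
proof -
  obtain x where x: "v = (\<Sum>U\<in>\<U> - triv. x U)" "\<forall>U\<in>\<U> - triv. x U \<in> U"
    using v(1) by blast
  have sH: "subspace H" "v \<notin> H" "subrep G s \<sigma> H" using H by (auto simp: split_by_def subrep_def)
  obtain U where U: "U \<in> \<U> - triv" "x U \<notin> H"
  proof -
    have "(\<Sum>U\<in>\<U> - triv. x U) \<in> H" if "\<And>U. U \<in> \<U> - triv \<Longrightarrow> x U \<in> H"
      using that by (rule subspace_sum[OF sH(1)])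
    then show ?thesis using that x(1) sH(2) by metis
  qed
  have inv: "\<sigma> g (x U) = x U" if g: "g \<in> carrier G" for g
  proof -
    let ?d = "\<lambda>V. if V \<in> \<U> - triv then \<sigma> g (x V) - x V else 0"
    have "(\<Sum>V\<in>\<U>. ?d V) = (\<Sum>V\<in>\<U> - triv. \<sigma> g (x V) - x V)"
      using decomposition_finite by (intro sum.mono_neutral_cong_right) auto
    also have "\<dots> = \<sigma> g v - v" unfolding x(1) action_sum[OF g] by (rule sum_subtractf)
    finally have "(\<Sum>V\<in>\<U>. ?d V) = 0" using v(2)[OF g] by simp
    moreover have "\<forall>V\<in>\<U>. ?d V \<in> V"
      using x(2) decomposition_subrep g by (auto simp: subrep_def intro!: subspace_diff subspace_0)
    ultimately have "?d U = 0" using decomposition_zero[of ?d U] U(1) by blast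
    then show ?thesis using U(1) by (simp split: if_splits)
  qed
  have xW: "x U \<in> W" using x(2) U(1) decomposition_subset by blast
  have "split_by U (x U) H"
    unfolding split_by_def
  proof (intro conjI ballI sH(3) U(2))
    fix w assume "w \<in> U"
    then have "w \<in> W" using U(1) decomposition_subset by blast
    then obtain c where c: "w - c *s v \<in> H" using H by (auto simp: split_by_def)
    \<comment> \<open>Modulo \<open>H\<close> the component \<open>x U\<close> is \<open>d\<close>
      times \<open>v\<close>, with \<open>d\<close> nonzero because \<open>x U\<close> lies outside
      \<open>H\<close>; so it can replace \<open>v\<close>.\<close>
    obtain d where d: "x U - d *s v \<in> H" using H xW by (auto simp: split_by_def)
    have "d \<noteq> 0" using d U(2) by auto
    then have "w - (c / d) *s x U = (w - c *s v) - (c / d) *s (x U - d *s v)"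
      by (simp add: algebra_simps)
    then show "\<exists>c. w - c *s x U \<in> H"
      using c d sH(1) subspace_diff subspace_scale by metis
  qed
  moreover have "indecomposable_subrep G s \<sigma> U"
    using dec U(1) by (auto simp: indecomposable_decomposition_def)
  ultimately have "trivial_subrep G s \<sigma> U"
    using indecomposable_split_trivial[of U "x U" H] inv x(2) U(1) by blast
  then show False using U(1) by blast
qed

text \<open>Projection to the trivial summands is injective on the span of \<open>S'\<close>: a
  vector of its kernel is an invariant vector in the sum of the nontrivial summands, which cannot be
  split off.\<close>

lemma card_split_invariants_le:
  assumes S': "split_invariants W S'"
  shows "card S' \<le> card triv"
proof -
  obtain S where S: "split_invariants W S" "card S = card triv"
    and proj: "\<And>w. w \<in> W \<Longrightarrow> \<exists>q\<in>span S. w - q \<in> nontriv_sum"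
    using trivial_generators by blast
  interpret P: vector_space_pair s s by unfold_locales
  have sub: "S' \<subseteq> W" and indep: "independent S'" and fin: "finite S"
    and inv: "\<forall>v\<in>S'. \<forall>g\<in>carrier G. \<sigma> g v = v"
    using S' S by (auto simp: split_invariants_def)
  obtain q where q: "\<And>w. w \<in> W \<Longrightarrow> q w \<in> span S \<and> w - q w \<in> nontriv_sum"
  proof -
    have "\<forall>w\<in>W. \<exists>q. q \<in> span S \<and> w - q \<in> nontriv_sum" using proj by (simp only: Bex_def) simp
    then obtain q where q: "\<forall>w\<in>W. q w \<in> span S \<and> w - q w \<in> nontriv_sum" by (rule bchoice[THEN exE])
    show ?thesis by (rule that[of q]) (rule bspec[OF q])
  qed
  define Q where "Q = P.construct S' q"
  have lin: "Vector_Spaces.linear s s Q" unfolding Q_def by (rule P.linear_construct[OF indep])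
  interpret Q: Vector_Spaces.linear s s Q by (rule lin)
  have Qq: "Q v = q v" if "v \<in> S'" for v unfolding Q_def by (rule P.construct_basis[OF indep that])
  have sN: "subspace nontriv_sum" by (rule subspace_sum_set) (use decomposition_subspace in auto)
  have N: "v - Q v \<in> nontriv_sum \<and> (\<forall>g\<in>carrier G. \<sigma> g v = v)" if "v \<in> span S'" for v
    using that
  proof (induction rule: span_induct_alt)
    case base
    show ?case using subspace_0[OF sN] action_zero by (simp add: Q.zero)
  next
    case (step c x y)
    have *: "c *s x + y - Q (c *s x + y) = c *s (x - q x) + (y - Q y)"
      by (simp add: Q.add Q.scale Qq[OF step(1)] scale_right_diff_distrib)
    have "c *s (x - q x) + (y - Q y) \<in> nontriv_sum"
      by (intro subspace_add[OF sN] subspace_scale[OF sN]) (use q step sub in auto)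
    then show ?case unfolding * using step inv by (simp add: action_add action_scale)
  qed
  have "inj_on Q (span S')"
    unfolding Q.inj_on_iff_eq_0[OF subspace_span]
  proof (intro ballI impI, rule ccontr)
    fix v assume v: "v \<in> span S'" "Q v = 0" "v \<noteq> 0"
    then obtain H where "split_by W v H" using S' by (auto simp: split_invariants_def)
    then show False using nontriv_sum_not_split[of v H] N[OF v(1)] v(2) by simp
  qed
  then have Qi: "independent (Q ` S')" "inj_on Q S'"
    using indep Q.independent_injective_image inj_on_subset span_superset by blast+
  have "Q ` S' \<subseteq> span S" using q Qq sub by auto
  then have "card (Q ` S') \<le> card S" using independent_span_bound[OF fin Qi(1)] by blast
  then show ?thesis using card_image[OF Qi(2)] S(2) by simp
qed

end

text \<open>The generators of one decomposition are split invariants, so their number is bounded by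
  the trivial count of any other. By symmetry the counts agree, which is the part of Krull--Schmidt
  that makes \<open>trivial_summands\<close> well defined, and the common count is the maximal size
  of a family of split invariants.\<close>

lemma
  assumes "subrep G s \<sigma> W" "W \<subseteq> span T" "finite T"
  shows card_split_invariants_le_trivial_summands:
      "split_invariants W S \<Longrightarrow> card S \<le> trivial_summands G s \<sigma> W"
    and trivial_summands_attained:
      "\<exists>S. split_invariants W S \<and> card S = trivial_summands G s \<sigma> W"
proof -
  obtain \<U> where \<U>: "indecomposable_decomposition G s \<sigma> W \<U>"
    using indecomposable_decomposition_exists[OF assms] by blast
  let ?c = "\<lambda>\<U>. card {U \<in> \<U>. trivial_subrep G s \<sigma> U}"
  have le: "?c \<V> \<le> ?c \<V>'" if "indecomposable_decomposition G s \<sigma> W \<V>"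
      "indecomposable_decomposition G s \<sigma> W \<V>'" for \<V> \<V>'
    using trivial_generators[OF that(1)] card_split_invariants_le[OF that(2)] by metis
  have eq: "trivial_summands G s \<sigma> W = ?c \<U>"
    unfolding trivial_summands_def
  proof (rule the_equality)
    show "\<exists>\<V>. indecomposable_decomposition G s \<sigma> W \<V> \<and> ?c \<U> = ?c \<V>" using \<U> by blast
    show "k = ?c \<U>" if k: "\<exists>\<V>. indecomposable_decomposition G s \<sigma> W \<V> \<and> k = ?c \<V>" for k
    proof -
      obtain \<V> where \<V>: "indecomposable_decomposition G s \<sigma> W \<V>" "k = ?c \<V>" using k by blast
      show ?thesis unfolding \<V>(2) by (rule antisym[OF le[OF \<V>(1) \<U>] le[OF \<U> \<V>(1)]])
    qed
  qed
  show "split_invariants W S \<Longrightarrow> card S \<le> trivial_summands G s \<sigma> W"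
    unfolding eq by (rule card_split_invariants_le[OF \<U>])
  show "\<exists>S. split_invariants W S \<and> card S = trivial_summands G s \<sigma> W"
    unfolding eq using trivial_generators[OF \<U>] by metis
qed

end

section \<open>Words and Kronecker powers\<close>

definition words :: "nat \<Rightarrow> nat \<Rightarrow> nat list set" where
  "words d n = {us. set us \<subseteq> {..<d} \<and> length us = n}"

lemma finite_words [simp]: "finite (words d n)"
  unfolding words_def by (intro finite_lists_length_eq) simp

lemma card_words: "card (words d n) = d ^ n"
  unfolding words_def by (subst card_lists_length_eq) auto

lemma length_words: "z \<in> words d n \<Longrightarrow> length z = n"
  by (simp add: words_def)

lemma nth_words: "z \<in> words d n \<Longrightarrow> i < n \<Longrightarrow> z ! i < d"
  unfolding words_def using nth_mem[of i z] by blast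

lemma prod_sum_words:
  fixes f :: "nat \<Rightarrow> nat \<Rightarrow> 'a::comm_semiring_1"
  shows "(\<Prod>i<n. \<Sum>j<d. f i j) = (\<Sum>z\<in>words d n. \<Prod>i<n. f i (z ! i))"
proof (induction n arbitrary: f)
  case 0
  have "words d 0 = {[]}" by (auto simp: words_def)
  then show ?case by simp
next
  case (Suc n)
  have eq: "words d (Suc n) = (\<lambda>(j, z). j # z) ` ({..<d} \<times> words d n)"
  proof (intro equalityI subsetI)
    fix u assume "u \<in> words d (Suc n)"
    then obtain j z where "u = j # z" "j < d" "z \<in> words d n"
      by (cases u) (auto simp: words_def)
    then show "u \<in> (\<lambda>(j, z). j # z) ` ({..<d} \<times> words d n)" by auto
  qed (auto simp: words_def)
  have inj: "inj_on (\<lambda>(j, z). j # z) ({..<d} \<times> words d n)" by (auto simp: inj_on_def)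
  have "(\<Prod>i<Suc n. \<Sum>j<d. f i j) = (\<Sum>j<d. f 0 j) * (\<Prod>i<n. \<Sum>j<d. f (Suc i) j)"
    by (rule prod.lessThan_Suc_shift)
  also have "\<dots> = (\<Sum>j<d. f 0 j) * (\<Sum>z\<in>words d n. \<Prod>i<n. f (Suc i) (z ! i))"
    by (simp only: Suc.IH[of "\<lambda>i. f (Suc i)"])
  also have "\<dots> = (\<Sum>(j, z)\<in>{..<d} \<times> words d n. f 0 j * (\<Prod>i<n. f (Suc i) (z ! i)))"
    by (simp add: sum_product sum.cartesian_product)
  also have "\<dots> = (\<Sum>z\<in>words d (Suc n). \<Prod>i<Suc n. f i (z ! i))"
    unfolding eq sum.reindex[OF inj]
    by (rule sum.cong) (auto simp: prod.lessThan_Suc_shift simp del: prod.lessThan_Suc)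
  finally show ?case .
qed

text \<open>Coordinates of the \<open>n\<close>-fold Kronecker power of \<open>M\<close> applied to
  the tensor with coefficients \<open>c\<close>; indices are words instead of numbers below
  \<open>d ^ n\<close>.\<close>

definition kron :: "nat \<Rightarrow> nat \<Rightarrow> 'a::comm_ring_1 mat \<Rightarrow> (nat list \<Rightarrow> 'a) \<Rightarrow> nat list \<Rightarrow> 'a" where
  "kron d n M c y = (\<Sum>z\<in>words d n. (\<Prod>i<n. M $$ (y ! i, z ! i)) * c z)"

lemma kron_cong: "(\<And>z. z \<in> words d n \<Longrightarrow> c z = c' z) \<Longrightarrow> kron d n M c y = kron d n M c' y"
  unfolding kron_def by (intro sum.cong) auto

lemma kron_mult:
  assumes A: "A \<in> carrier_mat d d" and B: "B \<in> carrier_mat d d" and y: "y \<in> words d n"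
  shows "kron d n (A * B) c y = kron d n A (kron d n B c) y"
proof -
  have "kron d n (A * B) c y = (\<Sum>z\<in>words d n. (\<Prod>i<n. \<Sum>j<d. A $$ (y ! i, j) * B $$ (j, z ! i)) * c z)"
    unfolding kron_def
  proof (intro sum.cong arg_cong2[of _ _ _ _ "(*)"] prod.cong refl)
    fix z i assume "z \<in> words d n" "i \<in> {..<n}"
    then have "y ! i < d" "z ! i < d" using y by (auto intro: nth_words)
    then show "(A * B) $$ (y ! i, z ! i) = (\<Sum>j<d. A $$ (y ! i, j) * B $$ (j, z ! i))"
      using A B by (auto simp: scalar_prod_def lessThan_atLeast0 intro!: sum.cong)
  qed
  also have "\<dots> = (\<Sum>z\<in>words d n. \<Sum>x\<in>words d n.
      (\<Prod>i<n. A $$ (y ! i, x ! i)) * ((\<Prod>i<n. B $$ (x ! i, z ! i)) * c z))"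
    by (simp add: prod_sum_words sum_distrib_right prod.distrib mult.assoc)
  also have "\<dots> = kron d n A (kron d n B c) y"
    unfolding kron_def by (subst sum.swap) (simp add: sum_distrib_left)
  finally show ?thesis .
qed

lemma kron_one:
  assumes y: "y \<in> words d n"
  shows "kron d n (1\<^sub>m d) c y = c y"
proof -
  have "(\<Prod>i<n. (1\<^sub>m d :: 'a mat) $$ (y ! i, z ! i)) * c z = (if z = y then c y else 0)"
    if z: "z \<in> words d n" for z
  proof (cases "z = y")
    case True
    then show ?thesis using y by (auto simp: nth_words)
  next
    case False
    then obtain i where i: "i < n" "y ! i \<noteq> z ! i"
      using y z by (metis length_words nth_equalityI)
    then have "(1\<^sub>m d :: 'a mat) $$ (y ! i, z ! i) = 0" using y z by (simp add: nth_words)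
    then have "(\<Prod>i<n. (1\<^sub>m d :: 'a mat) $$ (y ! i, z ! i)) = 0" using i(1) by (intro prod_zero) auto
    then show ?thesis using False by simp
  qed
  then show ?thesis unfolding kron_def using y by simp
qed

text \<open>A Gram matrix of integer vectors is invertible over the rationals, as the form is positive
  definite there, and hence over every field of characteristic zero.\<close>

lemma gram_nonsingular:
  fixes \<omega> :: "'x \<Rightarrow> 'y \<Rightarrow> int" and c :: "'x \<Rightarrow> 'k::field_char_0"
  assumes X: "finite X" and Y: "finite Y"
    and indep: "\<And>a. (\<And>y. y \<in> Y \<Longrightarrow> (\<Sum>x\<in>X. a x * \<omega> x y) = 0) \<Longrightarrow> \<forall>x\<in>X. a x = 0"
    and zero: "\<And>x. x \<in> X \<Longrightarrow> (\<Sum>x'\<in>X. of_int (\<Sum>y\<in>Y. \<omega> x y * \<omega> x' y) * c x') = 0"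
  shows "\<forall>x\<in>X. c x = 0"
proof -
  obtain xs where xs: "set xs = X" "distinct xs" using X finite_distinct_list by blast
  define N where "N = length xs"
  define A where "A = mat N N (\<lambda>(i, j). \<Sum>y\<in>Y. \<omega> (xs ! i) y * \<omega> (xs ! j) y)"
  have A: "A \<in> carrier_mat N N" by (simp add: A_def)
  have bij: "bij_betw (\<lambda>i. xs ! i) {..<N} X"
    using bij_betw_nth[OF xs(2), of "{..<N}" X] xs(1) by (simp add: N_def)
  have reidx: "(\<Sum>i<N. f (xs ! i)) = (\<Sum>x\<in>X. f x)" for f :: "'x \<Rightarrow> 'z::comm_monoid_add"
    using sum.reindex_bij_betw[OF bij] .
  have "det A \<noteq> 0"
  proof
    assume "det A = 0"
    then obtain v where v: "v \<in> carrier_vec N" "v \<noteq> 0\<^sub>v N" "A *\<^sub>v v = 0\<^sub>v N"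
      using det_0_iff_vec_prod_zero[OF A] by blast
    have row: "(\<Sum>j<N. (\<Sum>y\<in>Y. \<omega> (xs ! i) y * \<omega> (xs ! j) y) * v $ j) = 0" if i: "i < N" for i
    proof -
      have "(A *\<^sub>v v) $ i = 0" using v(3) i by simp
      then show ?thesis using i v(1) A
        by (simp add: A_def scalar_prod_def lessThan_atLeast0)
    qed
    \<comment> \<open>This is the quadratic form of \<open>A\<close> at \<open>v\<close>, a sum of
      squares of integers; it vanishes on the kernel, so every square does.\<close>
    have "(\<Sum>y\<in>Y. (\<Sum>i<N. v $ i * \<omega> (xs ! i) y)\<^sup>2)
        = (\<Sum>i<N. v $ i * (\<Sum>j<N. (\<Sum>y\<in>Y. \<omega> (xs ! i) y * \<omega> (xs ! j) y) * v $ j))"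
    proof -
      have "(\<Sum>y\<in>Y. (\<Sum>i<N. v $ i * \<omega> (xs ! i) y)\<^sup>2)
        = (\<Sum>y\<in>Y. \<Sum>i<N. \<Sum>j<N. v $ i * \<omega> (xs ! i) y * (v $ j * \<omega> (xs ! j) y))"
        by (simp add: power2_eq_square sum_product)
      also have "\<dots> = (\<Sum>i<N. \<Sum>j<N. \<Sum>y\<in>Y. v $ i * \<omega> (xs ! i) y * (v $ j * \<omega> (xs ! j) y))"
        by (subst sum.swap, rule sum.cong[OF refl], rule sum.swap)
      also have "\<dots> = (\<Sum>i<N. v $ i * (\<Sum>j<N. (\<Sum>y\<in>Y. \<omega> (xs ! i) y * \<omega> (xs ! j) y) * v $ j))"
        by (simp add: sum_distrib_left sum_distrib_right algebra_simps)
      finally show ?thesis .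
    qed
    also have "\<dots> = 0" using row by simp
    finally have "\<forall>y\<in>Y. (\<Sum>i<N. v $ i * \<omega> (xs ! i) y)\<^sup>2 = 0"
      using Y by (subst (asm) sum_nonneg_eq_0_iff) auto
    then have comb: "(\<Sum>i<N. v $ i * \<omega> (xs ! i) y) = 0" if "y \<in> Y" for y using that by simp
    define a where "a x = v $ (inv_into {..<N} (\<lambda>i. xs ! i) x)" for x
    have a: "a (xs ! i) = v $ i" if "i < N" for i
      using bij that by (simp add: a_def bij_betw_def inv_into_f_f)
    have "\<forall>x\<in>X. a x = 0"
    proof (rule indep)
      fix y assume "y \<in> Y"
      have "(\<Sum>x\<in>X. a x * \<omega> x y) = (\<Sum>i<N. a (xs ! i) * \<omega> (xs ! i) y)"
        by (rule reidx[symmetric])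
      also have "\<dots> = (\<Sum>i<N. v $ i * \<omega> (xs ! i) y)" using a by (intro sum.cong) auto
      finally show "(\<Sum>x\<in>X. a x * \<omega> x y) = 0" using comb[OF \<open>y \<in> Y\<close>] by simp
    qed
    then have "v $ i = 0" if "i < N" for i using that a bij_betwE[OF bij] by force
    then have "v = 0\<^sub>v N" using v(1) by (intro eq_vecI) auto
    then show False using v(2) by simp
  qed
  then have "det (map_mat of_int A :: 'k mat) \<noteq> 0" by (simp add: of_int_hom.hom_det)
  moreover have A': "(map_mat of_int A :: 'k mat) \<in> carrier_mat N N" using A by simp
  moreover have "(map_mat of_int A :: 'k mat) *\<^sub>v vec N (\<lambda>i. c (xs ! i)) = 0\<^sub>v N"
  proof (intro eq_vecI)
    fix i assume "i < dim_vec (0\<^sub>v N :: 'k vec)"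
    then have i: "i < N" by simp
    have "((map_mat of_int A :: 'k mat) *\<^sub>v vec N (\<lambda>i. c (xs ! i))) $ i
      = (\<Sum>j<N. of_int (\<Sum>y\<in>Y. \<omega> (xs ! i) y * \<omega> (xs ! j) y) * c (xs ! j))"
      using i by (simp add: A_def scalar_prod_def lessThan_atLeast0)
    also have "\<dots> = (\<Sum>x'\<in>X. of_int (\<Sum>y\<in>Y. \<omega> (xs ! i) y * \<omega> x' y) * c x')" by (rule reidx)
    also have "\<dots> = 0" using i xs by (intro zero) (auto simp: N_def)
    finally show "((map_mat of_int A :: 'k mat) *\<^sub>v vec N (\<lambda>i. c (xs ! i))) $ i = 0\<^sub>v N $ i" using i by simp
  qed (use A in simp)
  ultimately have "vec N (\<lambda>i. c (xs ! i)) = 0\<^sub>v N"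
    using det_0_iff_vec_prod_zero[OF A'] by (metis vec_carrier)
  then have "c (xs ! i) = 0" if "i < N" for i using that by (metis index_vec index_zero_vec(1))
  then show ?thesis using xs by (auto simp: N_def in_set_conv_nth)
qed

section \<open>Coordinates on tensor powers\<close>

lemma sum_fun_apply: "(\<Sum>i\<in>A. f i) x = (\<Sum>i\<in>A. f i x)" for f :: "'i \<Rightarrow> 'a \<Rightarrow> 'b::comm_monoid_add"
  by (induction A rule: infinite_finite_induct) auto

locale tensor_rep = vector_space s
  for s :: "'k::field \<Rightarrow> 'v::ab_group_add \<Rightarrow> 'v" +
  fixes G :: "('g, 'm) monoid_scheme" and \<rho> :: "'g \<Rightarrow> 'v \<Rightarrow> 'v" and bs :: "'v list"
  assumes basis: "ordered_basis s bs"
    and action: "g \<in> carrier G \<Longrightarrow> \<rho> g \<in> carrier (GL s)"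
begin

definition d :: nat where "d = length bs"

definition coord :: "nat \<Rightarrow> 'v \<Rightarrow> 'k" where
  "coord i v = representation (set bs) v (bs ! i)"

definition M :: "'g \<Rightarrow> 'k mat" where "M g = endo_matrix s bs (\<rho> g)"

text \<open>Tensors are functions on tuples of functionals, so evaluation at a tuple of the dual
  basis reads off a coefficient.\<close>

definition tcoord :: "(('v \<Rightarrow> 'k) list \<Rightarrow> 'k) \<Rightarrow> nat list \<Rightarrow> 'k" where
  "tcoord t y = t (map coord y)"

definition tensor_of :: "nat \<Rightarrow> (nat list \<Rightarrow> 'k) \<Rightarrow> ('v \<Rightarrow> 'k) list \<Rightarrow> 'k" where
  "tensor_of n c = (\<Sum>z\<in>words d n. fun_scale (c z) (pure_tensor s (map ((!) bs) z)))"

sublocale F: vector_space "fun_scale :: 'k \<Rightarrow> (('v \<Rightarrow> 'k) list \<Rightarrow> 'k) \<Rightarrow> _"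
  by (rule vector_space_fun_scale)

sublocale T: linear_action "fun_scale :: 'k \<Rightarrow> (('v \<Rightarrow> 'k) list \<Rightarrow> 'k) \<Rightarrow> _" G "tensor_action \<rho>"
  by unfold_locales (auto simp: tensor_action_def fun_scale_def)

lemma indep: "independent (set bs)" and span_bs: "span (set bs) = UNIV" and dist: "distinct bs"
  using basis by (auto simp: ordered_basis_def)

lemma linear_coord: "Vector_Spaces.linear s (*) (coord i)"
  unfolding coord_def[abs_def] by (rule linear_representation[OF indep span_bs])

lemma linear_rho: "g \<in> carrier G \<Longrightarrow> Vector_Spaces.linear s s (\<rho> g)"
  using action by (auto simp: GL_def)

lemma M_carrier: "M g \<in> carrier_mat d d"
  by (simp add: M_def endo_matrix_def d_def)

lemma M_index: "i < d \<Longrightarrow> j < d \<Longrightarrow> M g $$ (i, j) = coord i (\<rho> g (bs ! j))"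
  by (simp add: M_def endo_matrix_def d_def coord_def)

lemma coord_basis: "i < d \<Longrightarrow> j < d \<Longrightarrow> coord i (bs ! j) = (if i = j then 1 else 0)"
  using dist by (auto simp: coord_def representation_basis[OF indep] d_def nth_eq_iff_index_eq)

lemma coord_expand: "(\<Sum>j<d. s (coord j v) (bs ! j)) = v"
proof -
  have "(\<Sum>b\<in>set bs. s (representation (set bs) v b) b) = v"
    by (rule sum_representation_eq) (use indep span_bs in auto)
  moreover have "bij_betw (\<lambda>i. bs ! i) {..<d} (set bs)"
    using bij_betw_nth[OF dist] by (simp add: d_def)
  ultimately show ?thesis
    unfolding coord_def using sum.reindex_bij_betw[of "(!) bs" "{..<d}" "set bs"
      "\<lambda>b. s (representation (set bs) v b) b"] by simp
qed

lemma tensor_power_induct [consumes 1, case_names zero step]: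
  assumes "t \<in> tensor_power s n" "P 0"
    and "\<And>c vs t. length vs = n \<Longrightarrow> P t \<Longrightarrow> P (fun_scale c (pure_tensor s vs) + t)"
  shows "P t"
  using assms(1) unfolding tensor_power_def
proof (induction rule: F.span_induct_alt)
  case (step c x y)
  then obtain vs where "x = pure_tensor s vs" "length vs = n" by blast
  then show ?case using assms(3)[OF _ step(2)] by blast
qed (rule assms(2))

text \<open>A tensor is linear in each functional, and a functional is known from its values on the
  basis, so the coefficients determine the tensor. The zero branch is the convention built into
  \<open>pure_tensor\<close>.\<close>

lemma tensor_power_apply:
  assumes "t \<in> tensor_power s n"
  shows "t \<phi>s = (if length \<phi>s = n \<and> (\<forall>\<phi>\<in>set \<phi>s. Vector_Spaces.linear s (*) \<phi>)
    then \<Sum>z\<in>words d n. (\<Prod>i<n. (\<phi>s ! i) (bs ! (z ! i))) * tcoord t z else 0)"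
  using assms
proof (induction rule: tensor_power_induct)
  case zero
  show ?case by (simp add: tcoord_def)
next
  case (step c vs t)
  have "pure_tensor s vs \<phi>s = (\<Sum>z\<in>words d n. (\<Prod>i<n. (\<phi>s ! i) (bs ! (z ! i))) * tcoord (pure_tensor s vs) z)"
    if \<phi>: "length \<phi>s = n" "\<forall>\<phi>\<in>set \<phi>s. Vector_Spaces.linear s (*) \<phi>"
  proof -
    have "pure_tensor s vs \<phi>s = (\<Prod>i<n. (\<phi>s ! i) (vs ! i))"
      using \<phi> step(1) by (simp add: pure_tensor_def)
    also have "\<dots> = (\<Prod>i<n. \<Sum>j<d. (\<phi>s ! i) (bs ! j) * coord j (vs ! i))"
    proof (rule prod.cong[OF refl])
      fix i assume "i \<in> {..<n}"
      then have "Vector_Spaces.linear s (*) (\<phi>s ! i)" using \<phi> by simp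
      then interpret l: Vector_Spaces.linear s "(*)" "\<phi>s ! i" .
      have "(\<phi>s ! i) (vs ! i) = (\<phi>s ! i) (\<Sum>j<d. s (coord j (vs ! i)) (bs ! j))"
        by (simp only: coord_expand)
      then show "(\<phi>s ! i) (vs ! i) = (\<Sum>j<d. (\<phi>s ! i) (bs ! j) * coord j (vs ! i))"
        by (simp add: l.sum l.scale mult.commute)
    qed
    also have "\<dots> = (\<Sum>z\<in>words d n. (\<Prod>i<n. (\<phi>s ! i) (bs ! (z ! i))) * (\<Prod>i<n. coord (z ! i) (vs ! i)))"
      by (simp add: prod_sum_words prod.distrib)
    also have "\<dots> = (\<Sum>z\<in>words d n. (\<Prod>i<n. (\<phi>s ! i) (bs ! (z ! i))) * tcoord (pure_tensor s vs) z)"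
      using linear_coord step(1)
      by (intro sum.cong) (auto simp: tcoord_def pure_tensor_def length_words)
    finally show ?thesis .
  qed
  moreover have "pure_tensor s vs \<phi>s = 0"
    if "\<not> (length \<phi>s = n \<and> (\<forall>\<phi>\<in>set \<phi>s. Vector_Spaces.linear s (*) \<phi>))"
    using that step(1) by (auto simp: pure_tensor_def)
  ultimately show ?case
    using step(2)
    by (auto simp: fun_scale_def tcoord_def algebra_simps sum.distrib sum_distrib_left)
qed

lemma tensor_power_eqI:
  assumes "t \<in> tensor_power s n" "u \<in> tensor_power s n"
    and "\<And>y. y \<in> words d n \<Longrightarrow> tcoord t y = tcoord u y"
  shows "t = u"
  by (rule ext) (simp add: tensor_power_apply[OF assms(1)] tensor_power_apply[OF assms(2)] assms(3))

lemma tcoord_action: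
  assumes "g \<in> carrier G" "t \<in> tensor_power s n" "y \<in> words d n"
  shows "tcoord (tensor_action \<rho> g t) y = kron d n (M g) (tcoord t) y"
proof -
  have lin: "Vector_Spaces.linear s (*) (coord i \<circ> \<rho> g)" for i
    using linear_rho[OF assms(1)] linear_coord by (rule Vector_Spaces.linear_compose)
  let ?\<phi>s = "map (\<lambda>j. coord j \<circ> \<rho> g) y"
  have "tcoord (tensor_action \<rho> g t) y = t ?\<phi>s"
    by (simp add: tcoord_def tensor_action_def comp_def)
  also have "\<dots> = (\<Sum>z\<in>words d n. (\<Prod>i<n. (?\<phi>s ! i) (bs ! (z ! i))) * tcoord t z)"
    by (subst tensor_power_apply[OF assms(2)]) (use assms(3) lin in \<open>auto simp: length_words\<close>)
  also have "\<dots> = kron d n (M g) (tcoord t) y"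
    unfolding kron_def
    by (intro sum.cong arg_cong2[of _ _ _ _ "(*)"] prod.cong refl)
       (use assms(3) in \<open>auto simp: M_index nth_words length_words\<close>)
  finally show ?thesis .
qed

lemma tensor_of_mem: "tensor_of n c \<in> tensor_power s n"
  unfolding tensor_of_def tensor_power_def
  by (intro F.span_sum F.span_scale F.span_base) (auto simp: length_words)

lemma tcoord_tensor_of:
  assumes y: "y \<in> words d n"
  shows "tcoord (tensor_of n c) y = c y"
proof -
  have "tcoord (pure_tensor s (map ((!) bs) z)) y = (if z = y then 1 else 0)" if z: "z \<in> words d n" for z
  proof -
    have "tcoord (pure_tensor s (map ((!) bs) z)) y = (\<Prod>i<n. coord (y ! i) (bs ! (z ! i)))"
      using y z linear_coord by (auto simp: tcoord_def pure_tensor_def length_words)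
    also have "\<dots> = (\<Prod>i<n. if y ! i = z ! i then 1 else 0)"
      using y z by (intro prod.cong) (auto simp: coord_basis nth_words)
    also have "\<dots> = (if z = y then 1 else 0)"
    proof (cases "z = y")
      case False
      then obtain i where i: "i < n" "y ! i \<noteq> z ! i"
        using y z by (metis length_words nth_equalityI)
      then have "(\<Prod>i<n. if y ! i = z ! i then 1 else (0::'k)) = 0" by (intro prod_zero) auto
      then show ?thesis using False by simp
    qed simp
    finally show ?thesis .
  qed
  then have "tcoord (tensor_of n c) y = (\<Sum>z\<in>words d n. if z = y then c z else 0)"
    unfolding tensor_of_def tcoord_def sum_fun_apply
    by (intro sum.cong) (auto simp: fun_scale_def tcoord_def)
  then show ?thesis using y by simp
qed

lemma subrep_tensor_power: "subrep G fun_scale (tensor_action \<rho>) (tensor_power s n)"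
  unfolding subrep_def
proof (intro conjI ballI)
  show "F.subspace (tensor_power s n)" unfolding tensor_power_def by (rule F.subspace_span)
next
  fix g t assume g: "g \<in> carrier G" and "t \<in> tensor_power s n"
  from this(2) show "tensor_action \<rho> g t \<in> tensor_power s n"
  proof (induction rule: tensor_power_induct)
    case zero
    show ?case using T.action_zero[OF g] unfolding tensor_power_def by (simp only: F.span_zero)
  next
    case (step c vs t)
    have "pure_tensor s (map (\<rho> g) vs) \<in> tensor_power s n"
      unfolding tensor_power_def using step(1) by (intro F.span_base) auto
    then show ?case
      using step(2) unfolding T.action_add[OF g] T.action_scale[OF g] tensor_action_pure_tensor[of \<rho> g, OF action[OF g]]
      unfolding tensor_power_def by (intro F.span_add F.span_scale)
  qed
qed

lemma tensor_power_finite_span: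
  "\<exists>T. finite T \<and> tensor_power s n \<subseteq> F.span T"
proof (intro exI conjI)
  show "finite (pure_tensor s ` {us. set us \<subseteq> set bs \<and> length us = n})"
    by (intro finite_imageI finite_lists_length_eq) simp
  show "tensor_power s n \<subseteq> F.span (pure_tensor s ` {us. set us \<subseteq> set bs \<and> length us = n})"
    by (simp add: tensor_power_eq_span[OF vector_space_axioms span_bs])
qed

abbreviation "TS n \<equiv> trivial_summands G fun_scale (tensor_action \<rho>) (tensor_power s n)"

text \<open>Split invariants are fixed by each single \<open>g\<close>. If the coefficients at
  \<open>Y\<close>, after the change of basis \<open>Q\<close>, determine a tensor fixed by
  \<open>g\<close>, they embed the span of a largest family of split invariants into the functions
  on \<open>Y\<close>.\<close>

lemma TS_upper:
  assumes g: "g \<in> carrier G" and Y: "finite Y"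
    and determined: "\<And>c. (\<And>y. y \<in> words d n \<Longrightarrow> kron d n (M g) c y = c y) \<Longrightarrow>
      (\<And>y. y \<in> Y \<Longrightarrow> kron d n Q c y = 0) \<Longrightarrow> \<forall>y\<in>words d n. c y = 0"
  shows "TS n \<le> card Y"
proof -
  obtain T where T: "finite T" "tensor_power s n \<subseteq> F.span T" using tensor_power_finite_span by blast
  obtain S where S: "T.split_invariants (tensor_power s n) S" "card S = TS n"
    using T.trivial_summands_attained[OF subrep_tensor_power T(2,1)] by blast
  have sub: "S \<subseteq> tensor_power s n" and indepS: "F.independent S"
    and inv: "\<And>t. t \<in> S \<Longrightarrow> tensor_action \<rho> g t = t"
    using S(1) g by (auto simp: T.split_invariants_def)
  interpret L: vector_space "fun_scale :: 'k \<Rightarrow> (nat list \<Rightarrow> 'k) \<Rightarrow> _" by (rule vector_space_fun_scale)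
  define \<Phi> where "\<Phi> t y = (if y \<in> Y then kron d n Q (tcoord t) y else 0)" for t y
  have lin: "Vector_Spaces.linear fun_scale fun_scale \<Phi>"
    unfolding Vector_Spaces.linear_iff
    by (intro conjI allI vector_space_fun_scale ext)
       (auto simp: \<Phi>_def kron_def tcoord_def fun_scale_def algebra_simps sum.distrib sum_distrib_left)
  interpret \<Phi>: Vector_Spaces.linear fun_scale fun_scale \<Phi> by (rule lin)
  have span_inv: "t \<in> tensor_power s n \<and> tensor_action \<rho> g t = t" if "t \<in> F.span S" for t
    using that
  proof (induction rule: F.span_induct_alt)
    case base
    show ?case using T.action_zero[OF g] unfolding tensor_power_def by (intro conjI F.span_zero)
  next
    case (step c x y)
    then have "x \<in> tensor_power s n" "tensor_action \<rho> g x = x" using sub inv by auto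
    then show ?case using step(2) unfolding tensor_power_def T.action_add[OF g] T.action_scale[OF g]
      by (intro conjI F.span_add F.span_scale) simp_all
  qed
  have "inj_on \<Phi> (F.span S)"
    unfolding \<Phi>.inj_on_iff_eq_0[OF F.subspace_span]
  proof (intro ballI impI)
    fix t assume t: "t \<in> F.span S" "\<Phi> t = 0"
    note t' = span_inv[OF t(1)]
    have "kron d n (M g) (tcoord t) y = tcoord t y" if "y \<in> words d n" for y
      using tcoord_action[OF g _ that] t' by metis
    moreover have "kron d n Q (tcoord t) y = 0" if "y \<in> Y" for y
      using fun_cong[OF t(2), of y] that by (simp add: \<Phi>_def)
    ultimately have "\<forall>y\<in>words d n. tcoord t y = 0" by (rule determined)
    then show "t = 0"
      using t' by (intro tensor_power_eqI[of _ n]) (auto simp: tensor_power_def F.span_zero tcoord_def)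
  qed
  then have inj: "L.independent (\<Phi> ` S)" "inj_on \<Phi> S"
    using indepS \<Phi>.independent_injective_image inj_on_subset F.span_superset by blast+
  define \<delta> where "\<delta> y = (\<lambda>x. if x = y then 1 else (0::'k))" for y :: "nat list"
  have "\<Phi> t \<in> L.span (\<delta> ` Y)" for t
  proof -
    have "\<Phi> t = (\<Sum>y\<in>Y. fun_scale (\<Phi> t y) (\<delta> y))"
    proof
      fix x
      have "(\<Sum>y\<in>Y. fun_scale (\<Phi> t y) (\<delta> y)) x = (\<Sum>y\<in>Y. if x = y then \<Phi> t y else 0)"
        unfolding sum_fun_apply by (intro sum.cong) (auto simp: fun_scale_def \<delta>_def)
      also have "\<dots> = \<Phi> t x" using Y by (simp add: \<Phi>_def)
      finally show "\<Phi> t x = (\<Sum>y\<in>Y. fun_scale (\<Phi> t y) (\<delta> y)) x" by simp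
    qed
    also have "\<dots> \<in> L.span (\<delta> ` Y)" by (intro L.span_sum L.span_scale L.span_base) auto
    finally show ?thesis .
  qed
  then have "card (\<Phi> ` S) \<le> card (\<delta> ` Y)"
    using L.independent_span_bound[OF _ inj(1), of "\<delta> ` Y"] Y by auto
  also have "\<dots> \<le> card Y" using Y by (rule card_image_le)
  finally show ?thesis using S(2) card_image[OF inj(2)] by simp
qed

lemma TS_le: "g \<in> carrier G \<Longrightarrow> TS n \<le> d ^ n"
  using TS_upper[of g "words d n" n "1\<^sub>m d"] by (simp add: card_words kron_one)

end

text \<open>Each integer family \<open>\<omega> x\<close> is used twice: as coefficients of the
  tensor \<open>\<epsilon> x\<close> and as coefficients of the functional \<open>pair x\<close>.
  The condition on the transposed matrix makes the functional invariant. Since the Gram matrix is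
  nonsingular, every nonzero vector of the span is nonzero under some \<open>pair x\<close>, whose
  kernel is the required complement.\<close>

lemma TS_lower:
  fixes s :: "'k::field_char_0 \<Rightarrow> 'v::ab_group_add \<Rightarrow> 'v" and \<omega> :: "'x \<Rightarrow> nat list \<Rightarrow> int"
  assumes rep: "tensor_rep s G \<rho> bs" and X: "finite X"
    and lin_indep: "\<And>a. (\<And>y. y \<in> words (length bs) n \<Longrightarrow> (\<Sum>x\<in>X. a x * \<omega> x y) = 0) \<Longrightarrow> \<forall>x\<in>X. a x = 0"
    and inv: "\<And>g x y. g \<in> carrier G \<Longrightarrow> x \<in> X \<Longrightarrow> y \<in> words (length bs) n \<Longrightarrow>
      kron (length bs) n (endo_matrix s bs (\<rho> g)) (\<lambda>z. of_int (\<omega> x z)) y = of_int (\<omega> x y)"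
    and inv': "\<And>g x y. g \<in> carrier G \<Longrightarrow> x \<in> X \<Longrightarrow> y \<in> words (length bs) n \<Longrightarrow>
      kron (length bs) n (transpose_mat (endo_matrix s bs (\<rho> g))) (\<lambda>z. of_int (\<omega> x z)) y = of_int (\<omega> x y)"
  shows "card X \<le> trivial_summands G fun_scale (tensor_action \<rho>) (tensor_power s n)"
proof -
  interpret tensor_rep s G \<rho> bs by (rule rep)
  define \<epsilon> where "\<epsilon> x = tensor_of n (\<lambda>y. of_int (\<omega> x y))" for x
  define pair where "pair x t = (\<Sum>y\<in>words d n. of_int (\<omega> x y) * tcoord t y)" for x t
  have pair_add: "pair x (t + u) = pair x t + pair x u"
    and pair_scale: "pair x (fun_scale c t) = c * pair x t" for x t u c
    by (simp_all add: pair_def tcoord_def fun_scale_def algebra_simps sum.distrib sum_distrib_left)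
  have pair_0: "pair x 0 = 0" for x by (simp add: pair_def tcoord_def)
  have pair_sum: "pair x (\<Sum>i\<in>I. f i) = (\<Sum>i\<in>I. pair x (f i))" for x I and f :: "'x \<Rightarrow> _"
    by (induction I rule: infinite_finite_induct) (simp_all only: sum.infinite sum.empty sum.insert pair_0 pair_add simp_thms)
  have pair_diff: "pair x (t - fun_scale c u) = pair x t - c * pair x u" for x t u c
    by (simp add: pair_def tcoord_def fun_scale_def algebra_simps sum_subtractf sum_distrib_left)
  have pair_\<epsilon>: "pair x (\<epsilon> x') = of_int (\<Sum>y\<in>words d n. \<omega> x y * \<omega> x' y)" for x x'
    by (simp add: pair_def \<epsilon>_def tcoord_tensor_of)
  have mem: "\<epsilon> x \<in> tensor_power s n" for x unfolding \<epsilon>_def by (rule tensor_of_mem)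
  \<comment> \<open>Nondegeneracy of the pairing in one statement; injectivity of
    \<open>\<epsilon>\<close>, independence of its image and the splitting all follow from
    it.\<close>
  have comb: "\<forall>x\<in>X. c x = 0" if "\<And>x. x \<in> X \<Longrightarrow> pair x (\<Sum>x'\<in>X. fun_scale (c x') (\<epsilon> x')) = 0" for c
  proof (rule gram_nonsingular[OF X finite_words[of d n], of \<omega>])
    show "\<forall>x\<in>X. a x = 0" if "\<And>y. y \<in> words d n \<Longrightarrow> (\<Sum>x\<in>X. a x * \<omega> x y) = 0" for a
      using lin_indep that by (simp add: d_def)
    show "(\<Sum>x'\<in>X. of_int (\<Sum>y\<in>words d n. \<omega> x y * \<omega> x' y) * c x') = 0" if "x \<in> X" for x
      using \<open>\<And>x. x \<in> X \<Longrightarrow> _\<close>[OF that]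
      by (simp add: pair_sum pair_scale pair_\<epsilon> mult.commute)
  qed
  have inj: "inj_on \<epsilon> X"
  proof (rule inj_onI, rule ccontr)
    fix x x' assume x: "x \<in> X" "x' \<in> X" "\<epsilon> x = \<epsilon> x'" "x \<noteq> x'"
    let ?c = "\<lambda>z. (if z = x then 1 else 0) - (if z = x' then 1 else 0) :: 'k"
    have "(\<Sum>z\<in>X. fun_scale (?c z) (\<epsilon> z)) = (\<Sum>z\<in>X. (if z = x then \<epsilon> x else 0) - (if z = x' then \<epsilon> x' else 0))"
      by (intro sum.cong) (auto simp: fun_scale_def)
    also have "\<dots> = 0" using x X by (simp only: sum_subtractf sum.delta if_True diff_self)
    finally have "pair z (\<Sum>z\<in>X. fun_scale (?c z) (\<epsilon> z)) = 0" for z using pair_0 by simp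
    then have "?c x = 0" using comb[of ?c] x(1) by blast
    then show False using x(4) by simp
  qed
  let ?S = "\<epsilon> ` X"
  have indepS: "F.independent ?S"
  proof (rule F.independent_if_scalars_zero)
    fix f t assume 0: "(\<Sum>t\<in>?S. fun_scale (f t) t) = 0" and t: "t \<in> ?S"
    have "(\<Sum>x\<in>X. fun_scale (f (\<epsilon> x)) (\<epsilon> x)) = 0" using 0 unfolding sum.reindex[OF inj] comp_def .
    then have "\<forall>x\<in>X. f (\<epsilon> x) = 0" using comb[of "\<lambda>x. f (\<epsilon> x)"] pair_0 by simp
    then show "f t = 0" using t by blast
  qed (use X in simp)
  have fixed: "tensor_action \<rho> g (\<epsilon> x) = \<epsilon> x" if g: "g \<in> carrier G" and x: "x \<in> X" for g x
  proof (rule tensor_power_eqI)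
    show "tensor_action \<rho> g (\<epsilon> x) \<in> tensor_power s n"
      using subrep_tensor_power g mem by (auto simp: subrep_def)
    show "\<epsilon> x \<in> tensor_power s n" by (rule mem)
    fix y assume y: "y \<in> words d n"
    have "tcoord (tensor_action \<rho> g (\<epsilon> x)) y = kron d n (M g) (tcoord (\<epsilon> x)) y"
      by (rule tcoord_action[OF g mem y])
    also have "\<dots> = kron d n (M g) (\<lambda>z. of_int (\<omega> x z)) y"
      by (rule kron_cong) (simp add: \<epsilon>_def tcoord_tensor_of)
    also have "\<dots> = tcoord (\<epsilon> x) y"
      using inv[OF g x] y by (simp add: \<epsilon>_def tcoord_tensor_of M_def d_def)
    finally show "tcoord (tensor_action \<rho> g (\<epsilon> x)) y = tcoord (\<epsilon> x) y" .
  qed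
  have pair_action: "pair x (tensor_action \<rho> g t) = pair x t"
    if g: "g \<in> carrier G" and x: "x \<in> X" and t: "t \<in> tensor_power s n" for g x t
  proof -
    have "pair x (tensor_action \<rho> g t) = (\<Sum>y\<in>words d n. of_int (\<omega> x y) * kron d n (M g) (tcoord t) y)"
      unfolding pair_def by (intro sum.cong) (simp_all add: tcoord_action[OF g t])
    \<comment> \<open>Exchanging the sums moves the operator to the other side of the pairing, where
      it appears transposed.\<close>
    also have "\<dots> = (\<Sum>z\<in>words d n. \<Sum>y\<in>words d n. of_int (\<omega> x y) * ((\<Prod>i<n. M g $$ (y ! i, z ! i)) * tcoord t z))"
      unfolding kron_def sum_distrib_left by (rule sum.swap)
    also have "\<dots> = (\<Sum>z\<in>words d n. kron d n (transpose_mat (M g)) (\<lambda>y. of_int (\<omega> x y)) z * tcoord t z)"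
    proof (rule sum.cong[OF refl])
      fix z assume z: "z \<in> words d n"
      have "(\<Prod>i<n. transpose_mat (M g) $$ (z ! i, y ! i)) = (\<Prod>i<n. M g $$ (y ! i, z ! i))"
        if "y \<in> words d n" for y
        using that z M_carrier[of g] by (intro prod.cong) (auto simp: nth_words)
      then show "(\<Sum>y\<in>words d n. of_int (\<omega> x y) * ((\<Prod>i<n. M g $$ (y ! i, z ! i)) * tcoord t z)) =
        kron d n (transpose_mat (M g)) (\<lambda>y. of_int (\<omega> x y)) z * tcoord t z"
        unfolding kron_def sum_distrib_right by (intro sum.cong) (simp_all add: algebra_simps)
    qed
    also have "\<dots> = pair x t"
      unfolding pair_def by (intro sum.cong) (use inv'[OF g x] in \<open>simp_all add: M_def d_def\<close>)
    finally show ?thesis .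
  qed
  have split: "\<exists>H. T.split_by (tensor_power s n) v H" if v: "v \<in> F.span ?S" "v \<noteq> 0" for v
  proof -
    obtain f where "v = (\<Sum>t\<in>?S. fun_scale (f t) t)"
      using v(1) X F.span_finite[of ?S] by auto
    then have f: "v = (\<Sum>x\<in>X. fun_scale (f (\<epsilon> x)) (\<epsilon> x))" unfolding sum.reindex[OF inj] comp_def .
    have "\<exists>x\<in>X. pair x v \<noteq> 0"
    proof (rule ccontr)
      assume "\<not> (\<exists>x\<in>X. pair x v \<noteq> 0)"
      then have "\<forall>x\<in>X. f (\<epsilon> x) = 0" using comb[of "\<lambda>x. f (\<epsilon> x)"] f by simp
      then have "v = (\<Sum>x\<in>X. 0)" unfolding f by (intro sum.cong) (auto simp: fun_scale_def)
      then show False using v(2) by simp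
    qed
    then obtain x where x: "x \<in> X" "pair x v \<noteq> 0" by blast
    define H where "H = {t \<in> tensor_power s n. pair x t = 0}"
    have W: "F.subspace (tensor_power s n)" unfolding tensor_power_def by (rule F.subspace_span)
    have "F.subspace H"
      by (rule F.subspaceI)
         (auto simp only: H_def mem_Collect_eq pair_0 pair_add pair_scale add_0_left mult_zero_right
            intro!: F.subspace_0[OF W] F.subspace_add[OF W] F.subspace_scale[OF W])
    then have "subrep G fun_scale (tensor_action \<rho>) H"
      using subrep_tensor_power pair_action x(1) by (auto simp: subrep_def H_def)
    moreover have "v \<notin> H" using x(2) by (simp add: H_def)
    moreover have "\<exists>c. w - fun_scale c v \<in> H" if w: "w \<in> tensor_power s n" for w
    proof
      have "?S \<subseteq> tensor_power s n" using mem by auto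
      then have "v \<in> tensor_power s n" using v(1) F.span_minimal[OF _ W] by auto
      then have "w - fun_scale (pair x w / pair x v) v \<in> tensor_power s n"
        by (intro F.subspace_diff[OF W w] F.subspace_scale[OF W])
      then show "w - fun_scale (pair x w / pair x v) v \<in> H"
        using x(2) by (simp only: H_def mem_Collect_eq pair_diff) simp
    qed
    ultimately show ?thesis by (auto simp only: T.split_by_def)
  qed
  obtain T where T: "finite T" "tensor_power s n \<subseteq> F.span T" using tensor_power_finite_span by blast
  have "T.split_invariants (tensor_power s n) ?S"
    unfolding T.split_invariants_def using X mem indepS fixed split by blast
  then have "card ?S \<le> TS n"
    by (rule T.card_split_invariants_le_trivial_summands[OF subrep_tensor_power T(2,1)])
  then show ?thesis using card_image[OF inj] by simp
qed

section \<open>Products of determinants\<close>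

definition occ :: "nat list \<Rightarrow> nat \<Rightarrow> nat list" where
  "occ x r = filter (\<lambda>i. x ! i = r) [0..<length x]"

lemma length_occ: "length (occ x r) = count_list x r"
proof -
  have "count_list x r = card {i. i < length x \<and> r = x ! i}"
    unfolding count_list_eq_length_filter length_filter_conv_card ..
  also have "\<dots> = length (occ x r)"
    unfolding occ_def length_filter_conv_card by (intro arg_cong[of _ _ card]) auto
  finally show ?thesis ..
qed

lemma distinct_occ: "distinct (occ x r)"
  by (simp add: occ_def)

lemma set_occ: "set (occ x r) = {i. i < length x \<and> x ! i = r}"
  by (auto simp: occ_def)

lemma occ_nth:
  assumes "j < count_list x r"
  shows "occ x r ! j < length x" "x ! (occ x r ! j) = r"
  using nth_mem[of j "occ x r"] assms by (auto simp: length_occ set_occ)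

lemma occ_nth_less_iff:
  assumes "j < count_list x r" "i \<le> length x"
  shows "occ x r ! j < i \<longleftrightarrow> j < count_list (take i x) r"
proof -
  have "[0..<length x] = [0..<i] @ [i..<length x]"
    using upt_add_eq_append[of 0 i "length x - i"] assms(2) by simp
  moreover have "filter (\<lambda>k. x ! k = r) [0..<i] = occ (take i x) r"
    unfolding occ_def using assms(2) by (intro filter_cong) auto
  ultimately have split: "occ x r = occ (take i x) r @ filter (\<lambda>k. x ! k = r) [i..<length x]"
    by (simp add: occ_def)
  show ?thesis
  proof (cases "j < count_list (take i x) r")
    case True
    then have "occ x r ! j < i"
      using occ_nth(1)[OF True] assms(2) by (simp add: split nth_append length_occ)
    then show ?thesis using True by simp
  next
    case False
    let ?k = "j - count_list (take i x) r"
    have eq: "occ x r ! j = filter (\<lambda>k. x ! k = r) [i..<length x] ! ?k"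
      using False by (simp add: split nth_append length_occ)
    have "?k < length (filter (\<lambda>k. x ! k = r) [i..<length x])"
      using assms(1) False length_occ[of x r] by (simp add: split length_occ)
    from nth_mem[OF this] have "i \<le> occ x r ! j" unfolding eq by auto
    then show ?thesis using False by simp
  qed
qed

text \<open>Lattice words with \<open>m\<close> copies of each letter, or standard Young tableaux
  with \<open>d\<close> rows of length \<open>m\<close>: the letter at a position is the row of that
  entry.\<close>

definition ballot :: "nat \<Rightarrow> nat \<Rightarrow> nat list \<Rightarrow> bool" where
  "ballot d m x \<longleftrightarrow> set x \<subseteq> {..<d} \<and> (\<forall>r<d. count_list x r = m) \<and>
     (\<forall>i\<le>length x. \<forall>r. Suc r < d \<longrightarrow> count_list (take i x) (Suc r) \<le> count_list (take i x) r)"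

text \<open>The columns of the tableau increase: a prefix that contains more than \<open>j\<close>
  letters \<open>Suc q\<close> contains more than \<open>j\<close> letters \<open>q\<close>.\<close>

lemma ballot_occ_less:
  assumes "ballot d m x" "j < m" "r' < d" "r < r'"
  shows "occ x r ! j < occ x r' ! j"
  using assms(3,4)
proof (induction r')
  case (Suc q)
  have cnt: "count_list x (Suc q) = m" "count_list x q = m" using assms(1) Suc.prems by (auto simp: ballot_def)
  let ?i = "Suc (occ x (Suc q) ! j)"
  have i: "?i \<le> length x" using occ_nth(1)[of j x "Suc q"] cnt assms(2) by simp
  have "j < count_list (take ?i x) (Suc q)"
    using occ_nth_less_iff[of j x "Suc q" ?i] i cnt assms(2) by simp
  also have "\<dots> \<le> count_list (take ?i x) q" using assms(1) i Suc.prems by (auto simp: ballot_def)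
  finally have "occ x q ! j < ?i" using occ_nth_less_iff[of j x q ?i] i cnt assms(2) by simp
  moreover have "occ x q ! j \<noteq> occ x (Suc q) ! j"
    using occ_nth(2)[of j x q] occ_nth(2)[of j x "Suc q"] cnt assms(2) by auto
  ultimately have less: "occ x q ! j < occ x (Suc q) ! j" by simp
  show ?case
  proof (cases "r = q")
    case False
    then show ?thesis using Suc less by simp
  qed (use less in simp)
qed simp

text \<open>\<open>a\<close> assigns a row vector to each position of \<open>x\<close>. Block
  \<open>j\<close> is column \<open>j\<close> of the tableau: it collects the \<open>j\<close>-th
  occurrences of all letters, ordered by letter.\<close>

definition block_det :: "nat \<Rightarrow> nat \<Rightarrow> nat list \<Rightarrow> (nat \<Rightarrow> nat \<Rightarrow> 'a) \<Rightarrow> 'a::comm_ring_1" where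
  "block_det d m x a = (\<Prod>j<m. det (mat d d (\<lambda>(r, c). a (occ x r ! j) c)))"

definition unit_rows :: "nat list \<Rightarrow> nat \<Rightarrow> nat \<Rightarrow> 'a::comm_ring_1" where
  "unit_rows y i c = (if y ! i = c then 1 else 0)"

text \<open>The coefficients of the product of determinants as a tensor; each is 0 or a product of
  signs of permutations, in particular an integer.\<close>

definition block_tensor :: "nat \<Rightarrow> nat \<Rightarrow> nat list \<Rightarrow> nat list \<Rightarrow> int" where
  "block_tensor d m x y = block_det d m x (unit_rows y)"

lemma of_int_block_det:
  "of_int (block_det d m x a) = (block_det d m x (\<lambda>i c. of_int (a i c)) :: 'a::comm_ring_1)"
proof -
  have "of_int (det (mat d d (\<lambda>(r, c). a (occ x r ! j) c)))
      = (det (mat d d (\<lambda>(r, c). of_int (a (occ x r ! j) c))) :: 'a)" for j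
    unfolding of_int_hom.hom_det[symmetric] by (intro arg_cong[of _ _ det] eq_matI) auto
  then show ?thesis by (simp add: block_det_def)
qed

lemma of_int_block_tensor:
  "of_int (block_tensor d m x y) = (block_det d m x (unit_rows y) :: 'a::comm_ring_1)"
  unfolding block_tensor_def of_int_block_det
  by (intro arg_cong[of _ _ "block_det d m x"] ext) (simp add: unit_rows_def)

lemma det_row_expand:
  fixes a :: "nat \<Rightarrow> nat \<Rightarrow> 'a::comm_ring_1"
  assumes k: "k < d"
  shows "det (mat d d (\<lambda>(r, c). a r c)) =
    (\<Sum>e<d. a k e * det (mat d d (\<lambda>(r, c). if r = k then (if e = c then 1 else 0) else a r c)))"
proof -
  let ?A = "mat d d (\<lambda>(r, c). a r c)"
  let ?B = "\<lambda>e. mat d d (\<lambda>(r, c). if r = k then (if e = c then 1 else 0) else a r c)"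
  have cof: "cofactor (?B e) k c = cofactor ?A k c" if "c < d" for e c
  proof -
    have "mat_delete (?B e) k c = mat_delete ?A k c"
      using that k by (intro eq_matI) (auto simp: mat_delete_def)
    then show ?thesis by (simp add: cofactor_def)
  qed
  have "det (?B e) = cofactor ?A k e" if e: "e < d" for e
  proof -
    have "det (?B e) = (\<Sum>c<d. ?B e $$ (k, c) * cofactor (?B e) k c)"
      by (rule laplace_expansion_row) (use k in auto)
    also have "\<dots> = (\<Sum>c<d. if c = e then cofactor ?A k e else 0)"
      using k by (intro sum.cong) (auto simp: cof)
    finally show ?thesis using e by simp
  qed
  moreover have "det ?A = (\<Sum>c<d. ?A $$ (k, c) * cofactor ?A k c)"
    by (rule laplace_expansion_row) (use k in auto)
  ultimately show ?thesis using k by simp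
qed

section \<open>Multilinearity and equivariance of block determinants\<close>

context
  fixes d m :: nat and x :: "nat list"
  assumes x: "ballot d m x"
begin

lemma count_x: "r < d \<Longrightarrow> count_list x r = m"
  using x by (simp add: ballot_def)

text \<open>Together with \<open>occ_surj\<close>: the pairs of a letter and an occurrence number
  enumerate the positions of \<open>x\<close>, so each position is one row of exactly one
  block.\<close>

lemma occ_inj:
  assumes "j < m" "j' < m" "r < d" "r' < d" "occ x r ! j = occ x r' ! j'"
  shows "r = r' \<and> j = j'"
proof -
  have "r = r'" using occ_nth(2)[of j x r] occ_nth(2)[of j' x r'] assms by (simp add: count_x)
  then show ?thesis using assms distinct_occ[of x r] by (simp add: nth_eq_iff_index_eq length_occ count_x)
qed

lemma occ_surj:
  assumes "p < length x"
  obtains r j where "r < d" "j < m" "p = occ x r ! j" "x ! p = r"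
proof -
  have r: "x ! p < d" using nth_mem[OF assms] x unfolding ballot_def by blast
  have "p \<in> set (occ x (x ! p))" using assms by (simp add: set_occ)
  then obtain j where "j < length (occ x (x ! p))" "occ x (x ! p) ! j = p"
    unfolding in_set_conv_nth by blast
  then show ?thesis using that[OF r, of j] r by (simp add: length_occ count_x)
qed

text \<open>Only one block contains position \<open>p\<close>, so the product is linear in
  \<open>a p\<close> through that one factor.\<close>

lemma block_det_row_expand:
  assumes p: "p < length x"
  shows "block_det d m x a = (\<Sum>e<d. a p e * block_det d m x (a(p := \<lambda>c. if e = c then 1 else 0)))"
proof -
  obtain r j where rj: "r < d" "j < m" "p = occ x r ! j" using occ_surj[OF p] by blast
  let ?F = "\<lambda>a j. det (mat d d (\<lambda>(r, c). a (occ x r ! j) c))"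
  have split: "block_det d m x b = ?F b j * (\<Prod>j'\<in>{..<m} - {j}. ?F b j')" for b :: "nat \<Rightarrow> nat \<Rightarrow> 'a"
    unfolding block_det_def using rj(2) by (intro prod.remove) auto
  have other: "?F (a(p := f)) j' = ?F a j'" if "j' < m" "j' \<noteq> j" for f j'
  proof (intro arg_cong[of _ _ det] eq_matI)
    fix r' c assume "r' < dim_row (mat d d (\<lambda>(r, c). a (occ x r ! j') c))"
      "c < dim_col (mat d d (\<lambda>(r, c). a (occ x r ! j') c))"
    then have "r' < d" "c < d" by auto
    moreover have "occ x r' ! j' \<noteq> p" using occ_inj[of j' j r' r] that rj \<open>r' < d\<close> by auto
    ultimately show "mat d d (\<lambda>(r, c). (a(p := f)) (occ x r ! j') c) $$ (r', c)
        = mat d d (\<lambda>(r, c). a (occ x r ! j') c) $$ (r', c)" by simp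
  qed auto
  have same: "?F (a(p := f)) j = det (mat d d (\<lambda>(r', c). if r' = r then f c else a (occ x r' ! j) c))" for f
  proof (intro arg_cong[of _ _ det] eq_matI)
    fix r' c assume "r' < dim_row (mat d d (\<lambda>(r', c). if r' = r then f c else a (occ x r' ! j) c))"
      "c < dim_col (mat d d (\<lambda>(r', c). if r' = r then f c else a (occ x r' ! j) c))"
    then have "r' < d" "c < d" by auto
    moreover have "occ x r' ! j = p \<longleftrightarrow> r' = r" using occ_inj[of j j r' r] rj \<open>r' < d\<close> by auto
    ultimately show "mat d d (\<lambda>(r, c). (a(p := f)) (occ x r ! j) c) $$ (r', c)
        = mat d d (\<lambda>(r', c). if r' = r then f c else a (occ x r' ! j) c) $$ (r', c)" by simp
  qed auto
  have "?F a j = (\<Sum>e<d. a p e * ?F (a(p := \<lambda>c. if e = c then 1 else 0)) j)"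
    unfolding same using det_row_expand[OF rj(1), of "\<lambda>r c. a (occ x r ! j) c"] rj(3) by simp
  moreover have "(\<Prod>j'\<in>{..<m} - {j}. ?F (a(p := f)) j') = (\<Prod>j'\<in>{..<m} - {j}. ?F a j')" for f
    using other by (intro prod.cong) auto
  ultimately show ?thesis unfolding split by (simp add: sum_distrib_right mult.assoc)
qed

text \<open>Multilinear expansion, one position at a time: after \<open>p\<close> steps the first
  \<open>p\<close> rows are unit vectors spelled by a word of length \<open>p\<close>.\<close>

lemma block_det_expand:
  fixes a :: "nat \<Rightarrow> nat \<Rightarrow> 'a::comm_ring_1"
  shows "block_det d m x a =
    (\<Sum>y\<in>words d (length x). (\<Prod>i<length x. a i (y ! i)) * block_det d m x (unit_rows y))"
proof -
  have "block_det d m x a = (\<Sum>y\<in>words d p. (\<Prod>i<p. a i (y ! i)) *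
      block_det d m x (\<lambda>i. if i < p then unit_rows y i else a i))" if "p \<le> length x" for p
    using that
  proof (induction p)
    case 0
    have "words d 0 = {[]}" by (auto simp: words_def)
    then show ?case by simp
  next
    case (Suc p)
    have eq: "words d (Suc p) = (\<lambda>(y, e). y @ [e]) ` (words d p \<times> {..<d})"
    proof (intro equalityI subsetI)
      fix u assume "u \<in> words d (Suc p)"
      then obtain y e where "u = y @ [e]" "e < d" "y \<in> words d p"
        by (cases u rule: rev_cases) (auto simp: words_def)
      then show "u \<in> (\<lambda>(y, e). y @ [e]) ` (words d p \<times> {..<d})" by auto
    qed (auto simp: words_def)
    have inj: "inj_on (\<lambda>(y, e). y @ [e]) (words d p \<times> {..<d})" by (auto simp: inj_on_def)
    have step: "(\<Prod>i<p. a i (y ! i)) * block_det d m x (\<lambda>i. if i < p then unit_rows y i else a i)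
      = (\<Sum>e<d. (\<Prod>i<Suc p. a i ((y @ [e]) ! i)) *
          block_det d m x (\<lambda>i. if i < Suc p then unit_rows (y @ [e]) i else a i))"
      if y: "y \<in> words d p" for y
    proof -
      have len: "length y = p" using y by (rule length_words)
      have fn: "(\<lambda>i. if i < p then unit_rows y i else a i)(p := \<lambda>c. if e = c then 1 else 0)
        = (\<lambda>i. if i < Suc p then unit_rows (y @ [e]) i else a i)" for e
        by (intro ext) (auto simp: unit_rows_def len nth_append less_Suc_eq)
      have pr: "(\<Prod>i<Suc p. a i ((y @ [e]) ! i)) = (\<Prod>i<p. a i (y ! i)) * a p e" for e
        by (simp add: len nth_append)
      show ?thesis
        unfolding pr fn[symmetric] using Suc.prems
        by (subst block_det_row_expand[of p]) (simp_all add: sum_distrib_left mult.assoc)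
    qed
    have "block_det d m x a = (\<Sum>y\<in>words d p. \<Sum>e<d. (\<Prod>i<Suc p. a i ((y @ [e]) ! i)) *
          block_det d m x (\<lambda>i. if i < Suc p then unit_rows (y @ [e]) i else a i))"
      using Suc step by simp
    also have "\<dots> = (\<Sum>y\<in>words d (Suc p). (\<Prod>i<Suc p. a i (y ! i)) *
          block_det d m x (\<lambda>i. if i < Suc p then unit_rows y i else a i))"
      unfolding eq sum.reindex[OF inj] sum.cartesian_product
      by (intro sum.cong) auto
    finally show ?case .
  qed
  from this[OF order_refl] have "block_det d m x a = (\<Sum>y\<in>words d (length x). (\<Prod>i<length x. a i (y ! i)) *
      block_det d m x (\<lambda>i. if i < length x then unit_rows y i else a i))" .
  moreover have "block_det d m x (\<lambda>i. if i < length x then unit_rows y i else a i)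
      = block_det d m x (unit_rows y)" for y
    unfolding block_det_def
    by (intro prod.cong refl arg_cong[of _ _ det] eq_matI) (auto simp: occ_nth(1) count_x)
  ultimately show ?thesis by simp
qed

text \<open>By multilinear expansion the left side is the block determinant with rows of
  \<open>A\<close> selected by \<open>y\<close>. In each block these rows are unit rows times
  \<open>A\<close>, so every one of the \<open>m\<close> blocks contributes one factor
  \<open>det A\<close>.\<close>

lemma kron_block_tensor:
  fixes A :: "'a::comm_ring_1 mat"
  assumes A: "A \<in> carrier_mat d d" and y: "y \<in> words d (length x)"
  shows "kron d (length x) A (\<lambda>z. of_int (block_tensor d m x z)) y
    = det A ^ m * of_int (block_tensor d m x y)"
proof -
  have "kron d (length x) A (\<lambda>z. of_int (block_tensor d m x z)) y
      = block_det d m x (\<lambda>i c. A $$ (y ! i, c))"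
    unfolding kron_def of_int_block_tensor by (rule block_det_expand[symmetric])
  also have "\<dots> = (\<Prod>j<m. det (mat d d (\<lambda>(r, c). unit_rows y (occ x r ! j) c)) * det A)"
    unfolding block_det_def
  proof (rule prod.cong[OF refl])
    fix j assume j: "j \<in> {..<m}"
    let ?E = "mat d d (\<lambda>(r, c). unit_rows y (occ x r ! j) c) :: 'a mat"
    have unit_mult: "(if b then 1 else 0) * z = (if b then z else 0)" for b and z :: 'a by simp
    have "mat d d (\<lambda>(r, c). A $$ (y ! (occ x r ! j), c)) = ?E * A"
    proof (rule eq_matI)
      fix r c assume "r < dim_row (?E * A)" "c < dim_col (?E * A)"
      then have rc: "r < d" "c < d" using A by auto
      have yd: "y ! (occ x r ! j) < d" using nth_words[OF y occ_nth(1)] j rc by (simp add: count_x)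
      have "(?E * A) $$ (r, c) = (\<Sum>k<d. (if y ! (occ x r ! j) = k then A $$ (k, c) else 0))"
        using rc A by (simp add: scalar_prod_def lessThan_atLeast0 unit_rows_def unit_mult)
      also have "\<dots> = A $$ (y ! (occ x r ! j), c)" using yd by simp
      finally show "mat d d (\<lambda>(r, c). A $$ (y ! (occ x r ! j), c)) $$ (r, c) = (?E * A) $$ (r, c)"
        using rc by simp
    qed (use A in auto)
    then show "det (mat d d (\<lambda>(r, c). A $$ (y ! (occ x r ! j), c))) = det ?E * det A"
      using A by (simp add: det_mult[of _ d])
  qed
  also have "\<dots> = det A ^ m * of_int (block_tensor d m x y)"
    unfolding of_int_block_tensor block_det_def by (simp add: prod.distrib mult.commute)
  finally show ?thesis .
qed

text \<open>Read along \<open>x\<close> itself, each block consists of the unit rows in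
  order.\<close>

lemma block_tensor_self: "block_tensor d m x x = 1"
proof -
  have "mat d d (\<lambda>(r, c). unit_rows x (occ x r ! j) c) = (1\<^sub>m d :: int mat)" if "j < m" for j
    using that by (intro eq_matI) (auto simp: unit_rows_def occ_nth(2) count_x)
  then show ?thesis by (simp add: block_tensor_def block_det_def)
qed

text \<open>At the first difference let \<open>x\<close> have letter \<open>r\<close>, in block
  \<open>j\<close>. The rows of this block for smaller letters come earlier, as columns of the
  tableau increase, and there \<open>y\<close> agrees with \<open>x\<close>. A letter of
  \<open>y\<close> below \<open>r\<close> would repeat one of these rows and make the block
  singular.\<close>

lemma block_tensor_leading:
  assumes y: "y \<in> words d (length x)" and nz: "block_tensor d m x y \<noteq> 0"
  shows "x \<le> y"
proof (cases "x = y")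
  case False
  have len: "length y = length x" using y by (rule length_words)
  define i where "i = (LEAST i. i < length x \<and> x ! i \<noteq> y ! i)"
  have ex: "\<exists>i. i < length x \<and> x ! i \<noteq> y ! i" using False len by (metis nth_equalityI)
  have i: "i < length x" "x ! i \<noteq> y ! i" using LeastI_ex[OF ex] by (auto simp: i_def)
  have before: "x ! k = y ! k" if "k < i" for k
    using not_less_Least[of k "\<lambda>i. i < length x \<and> x ! i \<noteq> y ! i"] that i(1) by (auto simp: i_def)
  obtain r j where rj: "r < d" "j < m" "i = occ x r ! j" "x ! i = r" using occ_surj[OF i(1)] by blast
  let ?E = "mat d d (\<lambda>(r, c). unit_rows y (occ x r ! j) c) :: int mat"
  have det: "det ?E \<noteq> 0" using nz rj(2) by (auto simp: block_tensor_def block_det_def)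
  have "y ! i \<noteq> r'" if r': "r' < r" for r'
  proof
    assume eq: "y ! i = r'"
    have "occ x r' ! j < i" using ballot_occ_less[OF x rj(2) rj(1) r'] rj(3) by simp
    then have "y ! (occ x r' ! j) = r'" using before occ_nth(2)[of j x r'] rj r' by (simp add: count_x)
    then have "row ?E r' = row ?E r"
      using eq rj r' by (intro eq_vecI) (auto simp: unit_rows_def)
    then have "det ?E = 0" using rj(1) r' by (intro det_identical_rows[of ?E d r' r]) auto
    then show False using det by simp
  qed
  then have "x ! i < y ! i" using i(2) rj(4) by (metis linorder_neqE_nat)
  moreover have "take i x = take i y" using before len i(1) by (intro nth_equalityI) auto
  ultimately have "x < y" unfolding list_less_def lexord_take_index_conv using i(1) len by auto
  then show ?thesis by simp
qed simp

end

text \<open>Unitriangularity: at the least word with nonzero coefficient only its own block tensor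
  survives.\<close>

lemma block_tensors_independent:
  assumes X: "finite X" "\<And>x. x \<in> X \<Longrightarrow> ballot d m x \<and> length x = n"
    and 0: "\<And>y. y \<in> words d n \<Longrightarrow> (\<Sum>x\<in>X. a x * block_tensor d m x y) = 0"
  shows "\<forall>x\<in>X. a x = 0"
proof (rule ccontr)
  assume "\<not> (\<forall>x\<in>X. a x = 0)"
  then have ne: "{x \<in> X. a x \<noteq> 0} \<noteq> {}" by blast
  have fin: "finite {x \<in> X. a x \<noteq> 0}" using X(1) by simp
  define x where "x = Min {x \<in> X. a x \<noteq> 0}"
  have x: "x \<in> X" "a x \<noteq> 0" using Min_in[OF fin ne] by (auto simp: x_def)
  have min: "x \<le> x'" if "x' \<in> X" "a x' \<noteq> 0" for x' unfolding x_def using fin that by (intro Min_le) auto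
  have xw: "x \<in> words d n" using X(2)[OF x(1)] by (simp add: ballot_def words_def)
  have "a x' * block_tensor d m x' x = (if x' = x then a x else 0)" if x': "x' \<in> X" for x'
  proof (cases "x' = x")
    case True
    then show ?thesis using block_tensor_self X(2)[OF x(1)] by simp
  next
    case False
    have "block_tensor d m x' x = 0 \<or> x' \<le> x"
      using block_tensor_leading[of d m x' x] X(2)[OF x'] xw by auto
    moreover have "a x' = 0 \<or> \<not> x' \<le> x" using False min[OF x'] by fastforce
    ultimately show ?thesis using False by auto
  qed
  then have "(\<Sum>x'\<in>X. a x' * block_tensor d m x' x) = (\<Sum>x'\<in>X. if x' = x then a x else 0)"
    by (intro sum.cong) auto
  then have "a x = 0" using 0[OF xw] x(1) X(1) by simp
  then show False using x(2) by simp
qed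

section \<open>Counting ballot words\<close>

definition letters :: "nat \<Rightarrow> (nat \<Rightarrow> nat) \<Rightarrow> nat multiset" where
  "letters d f = (\<Sum>r<d. replicate_mset (f r) r)"

lemma count_letters: "count (letters d f) r = (if r < d then f r else 0)"
  unfolding letters_def count_sum by simp

lemma count_list_mset: "count_list xs r = count (mset xs) r"
  by (simp add: count_list_eq_length_filter count_mset)

lemma set_letters:
  assumes "mset w = letters d f"
  shows "set w \<subseteq> {..<d}"
proof
  fix r assume "r \<in> set w"
  then have "count (letters d f) r \<noteq> 0" using assms by (metis count_eq_zero_iff set_mset_mset)
  then show "r \<in> {..<d}" by (simp add: count_letters split: if_splits)
qed

abbreviation "balanced d m \<equiv> permutations_of_multiset (letters d (\<lambda>_. m))"

lemma balancedD: "w \<in> balanced d m \<Longrightarrow> mset w = letters d (\<lambda>_. m)"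
  by (simp add: permutations_of_multiset_def)

lemma count_balanced: "w \<in> balanced d m \<Longrightarrow> r < d \<Longrightarrow> count_list w r = m"
  by (simp add: count_list_mset count_letters balancedD)

lemma length_balanced: "w \<in> balanced d m \<Longrightarrow> length w = d * m"
  by (subst size_mset[symmetric]) (simp add: balancedD letters_def size_multiset_sum)

lemma fact_add_ge: "fact a * a ^ e \<le> (fact (a + e) :: nat)"
proof (induction e)
  case (Suc e)
  have "fact a * a ^ Suc e = (fact a * a ^ e) * a" by simp
  also have "\<dots> \<le> fact (a + e) * Suc (a + e)" using Suc by (intro mult_mono) auto
  finally show ?case by (simp add: algebra_simps)
qed simp

text \<open>The multinomial coefficient is at least \<open>d ^ (d * m)\<close> up to the polynomial
  factor \<open>(d * m) ^ d\<close>, which disappears in the growth rate. From \<open>m\<close> to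
  \<open>m + 1\<close> the left side gains \<open>(d * (m + 1)) ^ d\<close>, the factorial at least
  \<open>(d * m) ^ d\<close>, and the extra factor telescopes. \<open>Suc m\<close> appears because
  for positive \<open>d\<close> the bound fails at zero.\<close>

lemma fact_multinomial_ge: "d ^ (d * Suc m) * fact (Suc m) ^ d \<le> (fact (d * Suc m) * (d * Suc m) ^ d :: nat)"
proof (induction m)
  case 0
  have "1 \<le> (fact d :: nat)" by simp
  then show ?case by simp
next
  case (Suc m)
  have "d ^ (d * Suc (Suc m)) * fact (Suc (Suc m)) ^ d
    = (d ^ (d * Suc m) * fact (Suc m) ^ d) * (d * Suc (Suc m)) ^ d"
  proof -
    have "d ^ (d * Suc (Suc m)) = d ^ (d * Suc m) * d ^ d" by (simp add: power_add[symmetric] add_ac)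
    moreover have "fact (Suc (Suc m)) ^ d = (fact (Suc m) ^ d * Suc (Suc m) ^ d :: nat)"
      by (simp only: fact_Suc[of "Suc m"] power_mult_distrib of_nat_id mult.commute)
    ultimately show ?thesis by (simp only: power_mult_distrib mult_ac)
  qed
  also have "\<dots> \<le> (fact (d * Suc m) * (d * Suc m) ^ d) * (d * Suc (Suc m)) ^ d"
    by (intro mult_right_mono Suc) simp
  also have "\<dots> \<le> fact (d * Suc m + d) * (d * Suc (Suc m)) ^ d"
    by (intro mult_right_mono fact_add_ge) simp
  finally show ?case by (simp add: algebra_simps)
qed

lemma card_balanced:
  assumes "m > 0"
  shows "d ^ (d * m) \<le> card (balanced d m) * (d * m) ^ d"
proof -
  obtain m' where m: "m = Suc m'" using assms by (cases m) auto
  have set: "set_mset (letters d (\<lambda>_. m)) = {..<d}"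
    using assms by (auto simp: letters_def set_mset_sum split: if_splits)
  have size: "size (letters d (\<lambda>_. m)) = d * m" by (simp add: letters_def size_multiset_sum)
  have "card (balanced d m) * fact m ^ d = fact (d * m)"
    using card_permutations_of_multiset_aux[of "letters d (\<lambda>_. m)"]
    by (simp add: set size count_letters)
  moreover have "card (balanced d m) * (d * m) ^ d * fact m ^ d
      = (card (balanced d m) * fact m ^ d) * (d * m) ^ d" by (simp only: mult_ac)
  ultimately have "d ^ (d * m) * fact m ^ d \<le> card (balanced d m) * (d * m) ^ d * fact m ^ d"
    using fact_multinomial_ge[of d m', folded m] by (simp only:)
  then show ?thesis by simp
qed

lemma count_take_sorted:
  assumes "sorted xs" "r < r'" "r' \<in> set (take i xs)"
  shows "count_list (take i xs) r = count_list xs r"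
proof -
  have "sorted (take i xs @ drop i xs)" using assms(1) by simp
  then have "r' \<le> b" if "b \<in> set (drop i xs)" for b
    using assms(3) that unfolding sorted_append by blast
  then have "r \<notin> set (drop i xs)" using assms(2) by force
  then have "count_list (take i xs @ drop i xs) r = count_list (take i xs) r"
    unfolding count_list_append by simp
  then show ?thesis by (simp only: append_take_drop_id)
qed

text \<open>The prefix creates a surplus of \<open>m\<close> of every letter over the next one, which no prefix of
  a balanced block can exhaust; the suffix restores the balance.\<close>

definition pad :: "nat \<Rightarrow> nat \<Rightarrow> nat list list \<Rightarrow> nat list" where
  "pad d m ws = sorted_list_of_multiset (letters d (\<lambda>r. (d - 1 - r) * m)) @ concat ws @
     sorted_list_of_multiset (letters d (\<lambda>r. r * m))"

text \<open>Letter \<open>r\<close> occurs \<open>(d - 1 - r) * m\<close> times in front,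
  \<open>length ws * m\<close> times in the blocks and \<open>r * m\<close> times at the end: the
  same total for all letters. The summand \<open>d - 1\<close> is the price of the padding.\<close>

lemma ballot_pad:
  assumes ws: "set ws \<subseteq> balanced d m"
  shows "ballot d ((length ws + (d - 1)) * m) (pad d m ws)"
proof -
  let ?u = "sorted_list_of_multiset (letters d (\<lambda>r. (d - 1 - r) * m))"
  let ?v = "sorted_list_of_multiset (letters d (\<lambda>r. r * m))"
  let ?c = "concat ws"
  have u: "count_list ?u r = (d - 1 - r) * m" if "r < d" for r
    using that by (simp add: count_list_mset count_letters)
  have v: "count_list ?v r = r * m" if "r < d" for r
    using that by (simp add: count_list_mset count_letters)
  have c: "count_list ?c r = length ws * m" if "r < d" for r
    using ws by (induction ws) (auto simp: count_balanced that)
  have "set ?u \<subseteq> {..<d}" "set ?v \<subseteq> {..<d}" by (rule set_letters, simp)+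
  moreover have "set ?c \<subseteq> {..<d}" using ws set_letters balancedD by fastforce
  ultimately have set: "set (pad d m ws) \<subseteq> {..<d}" by (auto simp: pad_def)
  have total: "count_list (pad d m ws) r = (length ws + (d - 1)) * m" if "r < d" for r
  proof -
    have "(d - 1 - r) * m + (length ws * m + r * m) = (length ws + (d - 1)) * m"
    proof -
      have "(d - 1 - r) + (length ws + r) = length ws + (d - 1)" using that by simp
      then show ?thesis by (simp only: add_mult_distrib[symmetric])
    qed
    then show ?thesis unfolding pad_def count_list_append u[OF that] v[OF that] c[OF that] .
  qed
  \<comment> \<open>Completed blocks contain equally many of both letters; only the block being read
    can favour \<open>Suc r\<close>, by at most \<open>m\<close>.\<close>
  have cj: "count_list (take j ?c) (Suc r) \<le> count_list (take j ?c) r + m" if "Suc r < d" for j r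
    using ws
  proof (induction ws arbitrary: j)
    case (Cons w ws)
    have w: "count_list w r = m" "count_list w (Suc r) = m" using Cons.prems that by (auto simp: count_balanced)
    show ?case
    proof (cases "j \<le> length w")
      case True
      have "count_list (take j w @ drop j w) (Suc r) = m" using w by simp
      then have "count_list (take j w) (Suc r) \<le> m" unfolding count_list_append by simp
      then show ?thesis using True by simp
    next
      case False
      then show ?thesis using Cons w by simp
    qed
  qed simp
  have prefix: "count_list (take i (pad d m ws)) (Suc r) \<le> count_list (take i (pad d m ws)) r"
    if r: "Suc r < d" for i r
  proof -
    have surplus: "(d - 1 - r) * m = (d - 1 - Suc r) * m + m"
    proof -
      have "d - 1 - r = Suc (d - 1 - Suc r)" using r by simp
      then show ?thesis by simp
    qed
    consider "i < length ?u" | "length ?u \<le> i" "i - length ?u < length ?c"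
      | "length ?u \<le> i" "length ?c \<le> i - length ?u" by linarith
    then show ?thesis
    proof cases
      case 1
      then have t: "take i (pad d m ws) = take i ?u" by (simp add: pad_def)
      show ?thesis
      proof (cases "Suc r \<in> set (take i ?u)")
        case True
        have "count_list (take i ?u @ drop i ?u) (Suc r) = (d - 1 - Suc r) * m" using u[OF r] by simp
        then have "count_list (take i ?u) (Suc r) \<le> (d - 1 - Suc r) * m" unfolding count_list_append by simp
        also have "\<dots> \<le> count_list (take i ?u) r"
          using count_take_sorted[OF _ lessI True] u[of r] r surplus by simp
        finally show ?thesis unfolding t .
      qed (simp add: t)
    next
      case 2
      then have t: "take i (pad d m ws) = ?u @ take (i - length ?u) ?c" by (simp add: pad_def)
      show ?thesis unfolding t count_list_append u[OF r] u[OF Suc_lessD[OF r]] surplus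
        using cj[OF r, of "i - length ?u"] by simp
    next
      case 3
      define l where "l = i - length ?u - length ?c"
      have t: "take i (pad d m ws) = ?u @ ?c @ take l ?v" using 3 by (simp add: pad_def l_def)
      show ?thesis
      proof (cases "Suc r \<in> set (take l ?v)")
        case True
        \<comment> \<open>By sortedness all \<open>r * m\<close> letters \<open>r\<close> of the
          suffix precede its first \<open>Suc r\<close>, so \<open>Suc r\<close> gains at most
          \<open>m\<close>, which the surplus of the prefix covers.\<close>
        have "count_list (take l ?v) r = r * m"
          using count_take_sorted[OF _ lessI True] v[of r] r by simp
        moreover have "count_list (take l ?v @ drop l ?v) (Suc r) = Suc r * m" using v[OF r] by simp
        then have "count_list (take l ?v) (Suc r) \<le> Suc r * m" unfolding count_list_append by simp
        ultimately show ?thesis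
          unfolding t count_list_append u[OF r] u[OF Suc_lessD[OF r]] c[OF r] c[OF Suc_lessD[OF r]] surplus
          by simp
      next
        case False
        then show ?thesis
          unfolding t count_list_append u[OF r] u[OF Suc_lessD[OF r]] c[OF r] c[OF Suc_lessD[OF r]] surplus
          by simp
      qed
    qed
  qed
  show ?thesis unfolding ballot_def using set total prefix by blast
qed

lemma length_ballot:
  assumes "ballot d m x"
  shows "length x = d * m"
proof -
  have "length x = (\<Sum>r<d. count_list x r)"
    using assms sum_count_set[of x "{..<d}"] by (simp add: ballot_def)
  also have "\<dots> = d * m" using assms by (simp add: ballot_def)
  finally show ?thesis .
qed

definition pads :: "nat \<Rightarrow> nat \<Rightarrow> nat \<Rightarrow> nat list set" where
  "pads d m k = pad d m ` {ws. set ws \<subseteq> balanced d m \<and> length ws = k}"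

lemma finite_pads: "finite (pads d m k)"
  unfolding pads_def by (intro finite_imageI finite_lists_length_eq finite_permutations_of_multiset)

text \<open>Balanced blocks have the common length \<open>d * m\<close>, so the concatenation
  determines the blocks.\<close>

lemma card_pads: "card (pads d m k) = card (balanced d m) ^ k"
proof -
  have "inj_on (pad d m) {ws. set ws \<subseteq> balanced d m \<and> length ws = k}"
  proof (rule inj_onI)
    fix xs ys assume xs: "xs \<in> {ws. set ws \<subseteq> balanced d m \<and> length ws = k}"
      and ys: "ys \<in> {ws. set ws \<subseteq> balanced d m \<and> length ws = k}" and eq: "pad d m xs = pad d m ys"
    have "concat xs = concat ys" using eq by (simp add: pad_def)
    moreover have "\<forall>(x, y)\<in>set (zip xs ys). length x = length y"
    proof clarify
      fix x y assume "(x, y) \<in> set (zip xs ys)"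
      then have "x \<in> balanced d m" "y \<in> balanced d m"
        using xs ys set_zip_leftD set_zip_rightD by fast+
      then show "length x = length y" by (simp add: length_balanced)
    qed
    ultimately show "xs = ys" using xs ys by (intro concat_injective) auto
  qed
  then have "card (pads d m k) = card {ws. set ws \<subseteq> balanced d m \<and> length ws = k}"
    unfolding pads_def by (rule card_image)
  also have "\<dots> = card (balanced d m) ^ k"
    by (rule card_lists_length_eq) (rule finite_permutations_of_multiset)
  finally show ?thesis .
qed

text \<open>Every padded word gives a product of \<open>M\<close> determinants, on whose tensor
  \<open>g\<close> acts by the factor \<open>det ^ M = 1\<close>; the transposed matrix has the same
  determinant, so tensor and functional are both invariant.\<close>

lemma TS_ge_balanced:
  fixes s :: "'k::field_char_0 \<Rightarrow> 'v::ab_group_add \<Rightarrow> 'v"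
  assumes rep: "tensor_rep s G \<rho> bs" and d: "d = length bs" and M: "M = (k + (d - 1)) * m"
    and det: "\<And>g. g \<in> carrier G \<Longrightarrow> det (endo_matrix s bs (\<rho> g)) ^ M = 1"
  shows "card (balanced d m) ^ k \<le>
    trivial_summands G fun_scale (tensor_action \<rho>) (tensor_power s (d * M))"
proof -
  have X: "ballot d M x \<and> length x = d * M" if "x \<in> pads d m k" for x
    using that ballot_pad[of _ d m] length_ballot by (auto simp: pads_def M)
  have carrier: "endo_matrix s bs (\<rho> g) \<in> carrier_mat d d" for g by (simp add: endo_matrix_def d)
  have "card (pads d m k) \<le> trivial_summands G fun_scale (tensor_action \<rho>) (tensor_power s (d * M))"
  proof (rule TS_lower[OF rep finite_pads, where \<omega> = "block_tensor d M"])
    show "\<forall>x\<in>pads d m k. a x = 0"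
      if "\<And>y. y \<in> words (length bs) (d * M) \<Longrightarrow> (\<Sum>x\<in>pads d m k. a x * block_tensor d M x y) = 0" for a
      by (rule block_tensors_independent[OF finite_pads X]) (use that d in auto)
  next
    fix g x y assume g: "g \<in> carrier G" and x: "x \<in> pads d m k" and y: "y \<in> words (length bs) (d * M)"
    have x': "ballot d M x" "length x = d * M" using X[OF x] by auto
    have y': "y \<in> words d (length x)" using y d x'(2) by simp
    show "kron (length bs) (d * M) (endo_matrix s bs (\<rho> g)) (\<lambda>z. of_int (block_tensor d M x z)) y
        = of_int (block_tensor d M x y)"
      using kron_block_tensor[OF x'(1) carrier y'] det[OF g] d x'(2) by simp
    show "kron (length bs) (d * M) (transpose_mat (endo_matrix s bs (\<rho> g))) (\<lambda>z. of_int (block_tensor d M x z)) y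
        = of_int (block_tensor d M x y)"
      using kron_block_tensor[OF x'(1) _ y', of "transpose_mat (endo_matrix s bs (\<rho> g))"]
        carrier[of g] det[OF g] d x'(2) by (simp add: det_transpose[OF carrier])
  qed
  then show ?thesis by (simp add: card_pads)
qed

section \<open>Growth for finitely many determinants\<close>

lemma limsup_root_le:
  fixes a :: "nat \<Rightarrow> nat"
  assumes "c \<ge> 0" "\<And>n. n > 0 \<Longrightarrow> real (a n) \<le> c ^ n"
  shows "limsup (\<lambda>n. ereal (root n (real (a n)))) \<le> ereal c"
proof (rule Limsup_bounded)
  show "\<forall>\<^sub>F n in sequentially. ereal (root n (real (a n))) \<le> ereal c"
    using eventually_gt_at_top[of 0]
  proof eventually_elim
    case (elim n)
    then have "root n (real (a n)) \<le> root n (c ^ n)" using assms(2) by simp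
    then show ?case using elim assms(1) by (simp add: real_root_power_cancel)
  qed
qed

text \<open>Two limits. For fixed \<open>m\<close>, letting \<open>k\<close> grow makes the
  \<open>d - 1\<close> padding units negligible, and the limsup is at least
  \<open>d * (d * m) powr (- 1 / m)\<close>, since the \<open>(d * m)\<close>-th power of that
  number is at most \<open>C m\<close>. This tends to \<open>d\<close> as \<open>m\<close> runs
  through the multiples of \<open>N\<close>.\<close>

lemma limsup_root_ge:
  fixes a C :: "nat \<Rightarrow> nat" and d N :: nat
  assumes d: "d > 0" and N: "N > 0"
    and C: "\<And>m. m > 0 \<Longrightarrow> d ^ (d * m) \<le> C m * (d * m) ^ d"
    and a: "\<And>m k. m > 0 \<Longrightarrow> N dvd m \<Longrightarrow> C m ^ k \<le> a (d * ((k + (d - 1)) * m))"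
  shows "ereal (real d) \<le> limsup (\<lambda>n. ereal (root n (real (a n))))" (is "_ \<le> ?L")
proof -
  have fixed_m: "ereal (real d * (d * m) powr (- 1 / m)) \<le> ?L" if m: "m > 0" "N dvd m" for m
  proof -
    define c where "c = real d * (d * m) powr (- 1 / m)"
    have c0: "c > 0" using d m by (simp add: c_def)
    have pow: "c ^ (d * m) \<le> real (C m)"
    proof -
      have "c ^ (d * m) = real d ^ (d * m) * ((d * m) powr (- 1 / m)) ^ (d * m)"
        by (simp add: c_def power_mult_distrib)
      also have "((d * m) powr (- 1 / m)) ^ (d * m) = (d * m) powr (- real d)"
        using m d by (simp add: powr_realpow[symmetric] powr_powr)
      also have "\<dots> = 1 / real (d * m) ^ d"
        using m d by (simp add: powr_minus powr_realpow inverse_eq_divide)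
      also have "real d ^ (d * m) * (1 / real (d * m) ^ d) \<le> real (C m)"
      proof -
        have "real (d ^ (d * m)) \<le> real (C m * (d * m) ^ d)" using C[OF m(1)] by (simp only: of_nat_le_iff)
        then show ?thesis using m d by (simp add: divide_le_eq)
      qed
      finally show ?thesis .
    qed
    define r where "r k = d * ((k + (d - 1)) * m)" for k
    have mono: "strict_mono r"
      unfolding r_def using d m(1)
      by (intro strict_monoI mult_strict_left_mono mult_strict_right_mono add_strict_right_mono) auto
    have lower: "c powr (real d * real m * real k / real (r k)) \<le> root (r k) (real (a (r k)))"
      if k: "k > 0" for k
    proof -
      have r0: "r k > 0" using k d m(1) by (simp add: r_def)
      have "(c ^ (d * m)) ^ k \<le> real (C m) ^ k" using pow c0 by (intro power_mono) auto
      also have "\<dots> \<le> real (a (r k))" using a[OF m, of k] unfolding r_def by (metis of_nat_le_iff of_nat_power)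
      finally have "root (r k) ((c ^ (d * m)) ^ k) \<le> root (r k) (real (a (r k)))" using r0 by simp
      moreover have "root (r k) ((c ^ (d * m)) ^ k) = c powr (real d * real m * real k / real (r k))"
        using r0 c0 by (simp add: root_powr_inverse powr_realpow[symmetric] powr_powr mult_ac)
      ultimately show ?thesis by simp
    qed
    have "(\<lambda>k. real d * real m * real k / (real d * ((real k + (real d - 1)) * real m))) \<longlonglongrightarrow> 1"
    proof -
      have "(\<lambda>k. real k / (real k + (real d - 1))) \<longlonglongrightarrow> 1" by real_asymp
      moreover have "real d * real m * real k / (real d * ((real k + (real d - 1)) * real m))
          = real k / (real k + (real d - 1))" for k
        using d m by simp
      ultimately show ?thesis by simp
    qed
    moreover have "real (r k) = real d * ((real k + (real d - 1)) * real m)" for k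
      using d by (simp add: r_def of_nat_diff)
    ultimately have "(\<lambda>k. real d * real m * real k / real (r k)) \<longlonglongrightarrow> 1" by simp
    then have "(\<lambda>k. c powr (real d * real m * real k / real (r k))) \<longlonglongrightarrow> c powr 1"
      using c0 by (intro tendsto_powr tendsto_const) auto
    then have "(\<lambda>k. ereal (c powr (real d * real m * real k / real (r k)))) \<longlonglongrightarrow> ereal c"
      using c0 by simp
    then have "ereal c = limsup (\<lambda>k. ereal (c powr (real d * real m * real k / real (r k))))"
      by (intro lim_imp_Limsup[symmetric]) auto
    also have "\<dots> \<le> limsup ((\<lambda>n. ereal (root n (real (a n)))) \<circ> r)"
      by (intro Limsup_mono eventually_mono[OF eventually_gt_at_top[of 0]]) (simp add: lower)
    also have "\<dots> \<le> ?L" by (rule limsup_subseq_mono[OF mono])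
    finally show ?thesis by (simp add: c_def)
  qed
  have "(\<lambda>j. real d * (real d * (real N * (real j + 1))) powr (- 1 / (real N * (real j + 1)))) \<longlonglongrightarrow> real d"
    using d N by real_asymp
  then have "(\<lambda>j. ereal (real d * (real d * (real N * (real j + 1))) powr (- 1 / (real N * (real j + 1)))))
      \<longlonglongrightarrow> ereal (real d)" by simp
  moreover have "ereal (real d * (real d * (real N * (real j + 1))) powr (- 1 / (real N * (real j + 1)))) \<le> ?L" for j
  proof -
    have "ereal (real d * real (d * (N * Suc j)) powr (- 1 / real (N * Suc j))) \<le> ?L"
      using N by (intro fixed_m) auto
    moreover have "real (N * Suc j) = real N * (real j + 1)"
      "real (d * (N * Suc j)) = real d * (real N * (real j + 1))" by (simp_all add: algebra_simps)
    ultimately show ?thesis by (simp only:)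
  qed
  ultimately show ?thesis using LIMSEQ_le_const2 by blast
qed

section \<open>Determinants as a multiplicative function on the group\<close>

context tensor_rep
begin

lemma M_comp:
  assumes "g \<in> carrier G" "k \<in> carrier G" "\<rho> k = \<rho> g \<circ> \<rho> h"
  shows "M k = M g * M h"
proof (rule eq_matI)
  fix i j assume "i < dim_row (M g * M h)" "j < dim_col (M g * M h)"
  then have ij: "i < d" "j < d" by (simp_all add: carrier_matD[OF M_carrier])
  interpret lg: Vector_Spaces.linear s s "\<rho> g" using linear_rho[OF assms(1)] .
  interpret lc: Vector_Spaces.linear s "(*)" "coord i" by (rule linear_coord)
  have "M k $$ (i, j) = coord i (\<rho> g (\<Sum>l<d. s (coord l (\<rho> h (bs ! j))) (bs ! l)))"
    unfolding coord_expand using ij assms(3) by (simp add: M_index)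
  also have "\<dots> = (\<Sum>l<d. coord l (\<rho> h (bs ! j)) * coord i (\<rho> g (bs ! l)))"
    by (simp only: lg.sum lg.scale lc.sum lc.scale)
  also have "\<dots> = (M g * M h) $$ (i, j)"
    using ij M_carrier[of g] M_carrier[of h]
    by (simp add: scalar_prod_def lessThan_atLeast0 M_index mult.commute)
  finally show "M k $$ (i, j) = (M g * M h) $$ (i, j)" .
qed (use M_carrier[of g] M_carrier[of h] M_carrier[of k] in auto)

lemma
  assumes "group G" and hom: "\<rho> \<in> hom G (GL s)"
  shows det_M_mult: "g \<in> carrier G \<Longrightarrow> h \<in> carrier G \<Longrightarrow> det (M (g \<otimes>\<^bsub>G\<^esub> h)) = det (M g) * det (M h)"
    and det_M_nonzero: "g \<in> carrier G \<Longrightarrow> det (M g) \<noteq> 0"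
proof -
  interpret group G by fact
  have mult: "\<rho> (g \<otimes>\<^bsub>G\<^esub> h) = \<rho> g \<circ> \<rho> h" if "g \<in> carrier G" "h \<in> carrier G" for g h
    using hom that by (auto simp: hom_def GL_def)
  have det: "det (M (g \<otimes>\<^bsub>G\<^esub> h)) = det (M g) * det (M h)" if "g \<in> carrier G" "h \<in> carrier G" for g h
    using M_comp[OF that(1) m_closed[OF that] mult[OF that]]
    by (simp add: det_mult[OF M_carrier M_carrier])
  \<comment> \<open>The identity of \<open>G\<close> acts as a bijective idempotent, hence as the
    identity map.\<close>
  have "bij (\<rho> \<one>\<^bsub>G\<^esub>)" using action by (auto simp: GL_def)
  moreover have "\<rho> \<one>\<^bsub>G\<^esub> \<circ> \<rho> \<one>\<^bsub>G\<^esub> = \<rho> \<one>\<^bsub>G\<^esub>" using mult[of "\<one>\<^bsub>G\<^esub>" "\<one>\<^bsub>G\<^esub>"] by simp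
  ultimately have "\<rho> \<one>\<^bsub>G\<^esub> v = v" for v by (metis bij_pointE comp_apply)
  then have "M \<one>\<^bsub>G\<^esub> = 1\<^sub>m d"
    using M_carrier by (intro eq_matI) (auto simp: M_index coord_basis)
  then have one: "det (M \<one>\<^bsub>G\<^esub>) = 1" by simp
  show "g \<in> carrier G \<Longrightarrow> h \<in> carrier G \<Longrightarrow> det (M (g \<otimes>\<^bsub>G\<^esub> h)) = det (M g) * det (M h)" by (rule det)
  show "det (M g) \<noteq> 0" if "g \<in> carrier G"
    using det[of g "inv\<^bsub>G\<^esub> g"] that one by (auto simp: r_inv)
qed

text \<open>The argument of Lagrange: multiplication by one determinant permutes the finite set of
  all of them, so their nonzero product does not change when multiplied by the power of that
  determinant with exponent the size of the set.\<close>

lemma det_power_eq_one: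
  assumes G: "group G" and hom: "\<rho> \<in> hom G (GL s)" and fin: "finite ((\<lambda>g. det (M g)) ` carrier G)"
  obtains N where "N > 0" "\<And>g. g \<in> carrier G \<Longrightarrow> det (M g) ^ N = 1"
proof -
  interpret group G by fact
  let ?D = "(\<lambda>g. det (M g)) ` carrier G"
  have "det (M g) ^ card ?D = 1" if g: "g \<in> carrier G" for g
  proof -
    have inj: "inj_on ((*) (det (M g))) ?D" using det_M_nonzero[OF G hom g] by (simp add: inj_on_def)
    have "(*) (det (M g)) ` ?D \<subseteq> ?D"
    proof clarify
      fix h assume "h \<in> carrier G"
      then show "det (M g) * det (M h) \<in> ?D"
        using det_M_mult[OF G hom g, of h] g by (intro image_eqI[of _ _ "g \<otimes>\<^bsub>G\<^esub> h"]) auto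
    qed
    then have "(*) (det (M g)) ` ?D = ?D" using fin inj by (intro endo_inj_surj)
    then have "\<Prod>?D = (\<Prod>x\<in>?D. det (M g) * x)" using prod.reindex[OF inj, of "\<lambda>x. x"] by (simp add: comp_def)
    also have "\<dots> = det (M g) ^ card ?D * \<Prod>?D" by (simp add: prod.distrib)
    finally have "det (M g) ^ card ?D * \<Prod>?D = 1 * \<Prod>?D" by simp
    moreover have "\<Prod>?D \<noteq> 0" using fin det_M_nonzero[OF G hom] by (auto simp: prod_zero_iff)
    ultimately show ?thesis using mult_right_cancel by blast
  qed
  moreover have "card ?D > 0" using fin by (auto simp: card_gt_0_iff)
  ultimately show ?thesis using that by blast
qed

end

lemma trivial_growth_ge:
  fixes s :: "'k::field_char_0 \<Rightarrow> 'v::ab_group_add \<Rightarrow> 'v"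
  assumes G: "group G" and hom: "\<rho> \<in> hom G (GL s)" and rep: "tensor_rep s G \<rho> bs" and "bs \<noteq> []"
    and fin: "finite ((\<lambda>g. det (endo_matrix s bs (\<rho> g))) ` carrier G)"
  shows "ereal (real (length bs)) \<le> trivial_growth G s \<rho>"
proof -
  interpret tensor_rep s G \<rho> bs by fact
  obtain N where N: "N > 0" "\<And>g. g \<in> carrier G \<Longrightarrow> det (endo_matrix s bs (\<rho> g)) ^ N = 1"
    using det_power_eq_one[OF G hom] fin unfolding M_def by blast
  have det: "det (endo_matrix s bs (\<rho> g)) ^ (j * m) = 1" if "g \<in> carrier G" "N dvd m" for g j m
    using that N(2)[OF that(1)] by (metis dvd_def dvd_mult power_mult power_one)
  show ?thesis
    unfolding trivial_growth_def
    by (rule limsup_root_ge[OF _ N(1) card_balanced])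
       (use \<open>bs \<noteq> []\<close> TS_ge_balanced[OF rep refl refl det] in auto)
qed

section \<open>Eigenvalues and fixed tensors\<close>

lemma inverse_mat_exists:
  assumes A: "(A :: 'a::field mat) \<in> carrier_mat n n" and "det A \<noteq> 0"
  obtains B where "B \<in> carrier_mat n n" "A * B = 1\<^sub>m n" "B * A = 1\<^sub>m n"
  using det_non_zero_imp_unit[OF assms, of "()"] by (auto simp: Units_def ring_mat_def)

text \<open>\<open>v\<close> replaces a unit vector \<open>k\<close> with
  \<open>v $ k \<noteq> 0\<close> and moves to the front; the unit vectors before \<open>k\<close>
  are shifted by one column.\<close>

lemma nonzero_vec_extends_to_basis:
  assumes v: "(v :: 'a::field vec) \<in> carrier_vec n" "v \<noteq> 0\<^sub>v n"
  obtains W where "W \<in> carrier_mat n n" "det W \<noteq> 0" "col W 0 = v" "n > 0"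
proof -
  obtain k where k: "k < n" "v $ k \<noteq> 0" using v by (metis eq_vecI carrier_vecD index_zero_vec)
  define W where "W = mat n n (\<lambda>(i, j). if j = 0 then v $ i else if i = (if j \<le> k then j - 1 else j) then 1 else 0)"
  have W: "W \<in> carrier_mat n n" by (simp add: W_def)
  have "det W \<noteq> 0"
  proof
    assume "det W = 0"
    then obtain x where x: "x \<in> carrier_vec n" "x \<noteq> 0\<^sub>v n" "W *\<^sub>v x = 0\<^sub>v n"
      using det_0_iff_vec_prod_zero_field[OF W] by blast
    have row: "(\<Sum>j<n. W $$ (i, j) * x $ j) = 0" if "i < n" for i
    proof -
      have "(W *\<^sub>v x) $ i = 0" using x(3) that by simp
      then show ?thesis using that x(1) W by (simp add: scalar_prod_def lessThan_atLeast0)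
    qed
    have split: "(\<Sum>j<n. W $$ (i, j) * x $ j) = v $ i * x $ 0 + (\<Sum>j\<in>{..<n} - {0}. W $$ (i, j) * x $ j)"
      if "i < n" for i
      using that by (subst sum.remove[of _ 0]) (auto simp: W_def)
    have "(\<Sum>j\<in>{..<n} - {0}. W $$ (k, j) * x $ j) = 0"
      using k(1) by (intro sum.neutral) (auto simp: W_def)
    then have x0: "x $ 0 = 0" using row[OF k(1)] split[OF k(1)] k(2) by simp
    have "x $ j = 0" if j: "j < n" "j > 0" for j
    proof -
      define i where "i = (if j \<le> k then j - 1 else j)"
      have i: "i < n" using j by (auto simp: i_def)
      have "(\<Sum>l\<in>{..<n} - {0}. W $$ (i, l) * x $ l) = (\<Sum>l\<in>{..<n} - {0}. if l = j then x $ j else 0)"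
        using i j by (intro sum.cong) (auto simp: W_def i_def split: if_splits)
      then show ?thesis using row[OF i] split[OF i] x0 j by simp
    qed
    then have "x $ j = 0" if "j < n" for j using that x0 by (cases "j = 0") auto
    then have "x = 0\<^sub>v n" using x(1) by (intro eq_vecI) auto
    then show False using x(2) by simp
  qed
  moreover have "col W 0 = v" using v(1) k(1) by (intro eq_vecI) (auto simp: W_def)
  ultimately show ?thesis using that W k(1) by blast
qed

text \<open>Deflation: an eigenvector taken as first basis vector leaves a one-by-one block above
  zeros, and the remaining block is triangularized by induction.\<close>

lemma triangularizable:
  fixes A :: "'a::alg_closed_field mat"
  assumes "A \<in> carrier_mat n n"
  shows "\<exists>U P Q. similar_mat_wit A U P Q \<and> upper_triangular U"
  using assms
proof (induction n arbitrary: A)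
  case 0
  then have "upper_triangular A" by auto
  then show ?case using similar_mat_wit_refl[OF 0] by blast
next
  case (Suc n)
  note A = Suc.prems
  have "degree (char_poly A) > 0" using degree_monic_char_poly[OF A] by simp
  then obtain e where "poly (char_poly A) e = 0" using alg_closed_imp_poly_has_root by blast
  then obtain v where "eigenvector A v e"
    using eigenvalue_root_char_poly[OF A] unfolding eigenvalue_def by blast
  then have v: "v \<in> carrier_vec (Suc n)" "v \<noteq> 0\<^sub>v (Suc n)" "A *\<^sub>v v = e \<cdot>\<^sub>v v"
    using A by (auto simp: eigenvector_def)
  obtain W where W: "W \<in> carrier_mat (Suc n) (Suc n)" "det W \<noteq> 0" "col W 0 = v"
    using nonzero_vec_extends_to_basis[OF v(1,2)] by blast
  obtain W' where W': "W' \<in> carrier_mat (Suc n) (Suc n)" "W * W' = 1\<^sub>m (Suc n)" "W' * W = 1\<^sub>m (Suc n)"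
    using inverse_mat_exists[OF W(1,2)] by blast
  define A' where "A' = W' * A * W"
  have A': "A' \<in> carrier_mat (Suc n) (Suc n)" using W W' A by (simp add: A'_def)
  have "similar_mat_wit A' A W' W"
    by (rule similar_mat_witI[of _ _ "Suc n"]) (use W W' A A' in \<open>auto simp: A'_def\<close>)
  then have sim: "similar_mat_wit A A' W W'" by (rule similar_mat_wit_sym)
  have col0: "A' $$ (i, 0) = (if i = 0 then e else 0)" if i: "i < Suc n" for i
  proof -
    have "col A' 0 = W' * A *\<^sub>v col W 0"
      unfolding A'_def using W W' A by (intro col_mult2) auto
    also have "\<dots> = W' *\<^sub>v (e \<cdot>\<^sub>v v)"
      unfolding W(3) using W' A v by (subst assoc_mult_mat_vec) auto
    also have "\<dots> = e \<cdot>\<^sub>v (W' *\<^sub>v col W 0)" unfolding W(3) using W' v by (intro mult_mat_vec) auto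
    also have "W' *\<^sub>v col W 0 = col (W' * W) 0" using W W' by (intro col_mult2[symmetric]) auto
    finally have "col A' 0 $ i = (e \<cdot>\<^sub>v col (1\<^sub>m (Suc n)) 0) $ i" unfolding W'(3) by simp
    then show ?thesis using i A' by simp
  qed
  obtain A1 A2 A0 A3 where split: "split_block A' 1 1 = (A1, A2, A0, A3)"
    by (cases "split_block A' 1 1") auto
  have dims: "dim_row A' = 1 + n" "dim_col A' = 1 + n" using A' by auto
  note blocks = split_block[OF split dims]
  have A0: "A0 = 0\<^sub>m n 1"
  proof (rule eq_matI)
    fix i j assume "i < dim_row (0\<^sub>m n 1 :: 'a mat)" "j < dim_col (0\<^sub>m n 1 :: 'a mat)"
    then have "A0 $$ (i, j) = A' $$ (Suc i, 0)" "i < n" "j < 1"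
      using blocks(1-4) arg_cong[OF blocks(5), of "\<lambda>B. B $$ (Suc i, 0)"] by auto
    then show "A0 $$ (i, j) = 0\<^sub>m n 1 $$ (i, j)" using col0 by simp
  qed (use blocks(3) in auto)
  obtain U P Q where U: "similar_mat_wit A3 U P Q" "upper_triangular U"
    using Suc.IH[OF blocks(4)] by blast
  note UPQ = similar_mat_witD2[OF blocks(4) U(1)]
  let ?U = "four_block_mat A1 (A2 * P) (0\<^sub>m n 1) U"
  have "similar_mat_wit A' ?U (four_block_mat (1\<^sub>m 1) (0\<^sub>m 1 n) (0\<^sub>m n 1) P)
    (four_block_mat (1\<^sub>m 1) (0\<^sub>m 1 n) (0\<^sub>m n 1) Q)"
    unfolding blocks(5) A0
  proof (rule similar_mat_wit_four_block[OF similar_mat_wit_refl[OF blocks(1)] U(1) _ _ blocks(1,4)])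
    have "1\<^sub>m 1 * (A2 * P) * Q = A2 * (P * Q)" using blocks(2) UPQ by (simp add: assoc_mult_mat[of _ 1 n])
    then show "A2 = 1\<^sub>m 1 * (A2 * P) * Q" using UPQ blocks(2) by simp
  qed (use UPQ blocks in auto)
  then have "\<exists>P Q. similar_mat_wit A ?U P Q" using similar_mat_wit_trans[OF sim] by blast
  moreover have "upper_triangular ?U"
    by (rule upper_triangular_four_block[OF blocks(1) UPQ(5) _ U(2)]) (use blocks(1) in auto)
  ultimately show ?case by blast
qed

text \<open>The entry of the Kronecker power at \<open>y\<close>, \<open>z\<close> vanishes unless
  \<open>z\<close> is at least \<open>y\<close> letter by letter, so besides \<open>y\<close> only
  words with larger letter sum enter the equation at \<open>y\<close>. Descending induction on the
  letter sum leaves \<open>c y = \<lambda> * c y\<close> with \<open>\<lambda>\<close> the product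
  of diagonal entries, which forces \<open>c y = 0\<close> unless
  \<open>\<lambda> = 1\<close>.\<close>

lemma kron_upper_triangular_fixed:
  fixes U :: "'a::field mat"
  assumes U: "U \<in> carrier_mat d d" "upper_triangular U"
    and fixed: "\<And>y. y \<in> words d n \<Longrightarrow> kron d n U c y = c y"
    and zero: "\<And>y. y \<in> words d n \<Longrightarrow> (\<Prod>i<n. U $$ (y ! i, y ! i)) = 1 \<Longrightarrow> c y = 0"
    and y: "y \<in> words d n"
  shows "c y = 0"
  using y
proof (induction "n * d - (\<Sum>i<n. y ! i)" arbitrary: y rule: less_induct)
  case less
  show ?case
  proof (cases "(\<Prod>i<n. U $$ (y ! i, y ! i)) = 1")
    case True
    then show ?thesis using zero less.prems by blast
  next
    case False
    have "(\<Prod>i<n. U $$ (y ! i, z ! i)) * c z = (if z = y then (\<Prod>i<n. U $$ (y ! i, y ! i)) * c y else 0)"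
      if z: "z \<in> words d n" for z
    proof (cases "z = y")
      case zy: False
      have "(\<Prod>i<n. U $$ (y ! i, z ! i)) = 0 \<or> c z = 0"
      proof (cases "\<exists>i<n. z ! i < y ! i")
        case True
        then obtain i where i: "i < n" "z ! i < y ! i" by blast
        then have "U $$ (y ! i, z ! i) = 0"
          using U nth_words[OF less.prems i(1)] by (intro upper_triangularD) auto
        then show ?thesis using i(1) by (intro disjI1 prod_zero) auto
      next
        case False
        then have le: "y ! i \<le> z ! i" if "i < n" for i using that by (meson not_less)
        obtain i where i: "i < n" "z ! i \<noteq> y ! i"
          using zy z less.prems by (metis length_words nth_equalityI)
        have "\<exists>i\<in>{..<n}. y ! i < z ! i" using le[OF i(1)] i by (intro bexI[of _ i]) auto
        then have "(\<Sum>i<n. y ! i) < (\<Sum>i<n. z ! i)"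
          using le by (intro sum_strict_mono_ex1) auto
        moreover have "(\<Sum>i<n. z ! i) \<le> n * d"
        proof -
          have "(\<Sum>i<n. z ! i) \<le> (\<Sum>i<n. d)" using nth_words[OF z] by (intro sum_mono) (auto simp: less_imp_le)
          then show ?thesis by simp
        qed
        ultimately have "c z = 0" using less.hyps[OF _ z] by simp
        then show ?thesis ..
      qed
      then show ?thesis using zy by auto
    qed simp
    then have "kron d n U c y = (\<Sum>z\<in>words d n. if z = y then (\<Prod>i<n. U $$ (y ! i, y ! i)) * c y else 0)"
      unfolding kron_def by (intro sum.cong) auto
    also have "\<dots> = (\<Prod>i<n. U $$ (y ! i, y ! i)) * c y" using less.prems by simp
    finally show ?thesis using fixed[OF less.prems] False by simp
  qed
qed

text \<open>Conjugation carries tensors fixed by \<open>M g\<close> to tensors fixed by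
  \<open>U\<close>, so a fixed tensor is determined by its coefficients, in the new basis, at the
  words of eigenvalues with product 1.\<close>

lemma (in tensor_rep) TS_le_eigenvalue_words:
  assumes g: "g \<in> carrier G" and sim: "similar_mat_wit (M g) U P Q" and tri: "upper_triangular U"
  shows "TS n \<le> card {y \<in> words d n. (\<Prod>i<n. U $$ (y ! i, y ! i)) = 1}"
proof (rule TS_upper[OF g, where Q = Q])
  note w = similar_mat_witD2[OF M_carrier sim]
  show "finite {y \<in> words d n. (\<Prod>i<n. U $$ (y ! i, y ! i)) = 1}" by simp
  fix c
  assume fixed: "\<And>y. y \<in> words d n \<Longrightarrow> kron d n (M g) c y = c y"
    and zero: "\<And>y. y \<in> {y \<in> words d n. (\<Prod>i<n. U $$ (y ! i, y ! i)) = 1} \<Longrightarrow> kron d n Q c y = 0"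
  have "M g = P * (U * Q)" using w(3,5-7) by (simp add: assoc_mult_mat[of P d d U d Q d])
  moreover have "Q * (P * (U * Q)) = (Q * P) * (U * Q)" using w(5-7) by (intro assoc_mult_mat[symmetric]) auto
  ultimately have QM: "Q * M g = U * Q" using w(2,5,7) by simp
  have "kron d n Q c y = 0" if y: "y \<in> words d n" for y
  proof (rule kron_upper_triangular_fixed[OF w(5) tri _ _ y])
    fix z assume z: "z \<in> words d n"
    have "kron d n U (kron d n Q c) z = kron d n (Q * M g) c z"
      unfolding QM by (rule kron_mult[symmetric]) (use w z in auto)
    also have "\<dots> = kron d n Q (kron d n (M g) c) z" by (rule kron_mult) (use w z in auto)
    also have "\<dots> = kron d n Q c z" by (rule kron_cong) (rule fixed)
    finally show "kron d n U (kron d n Q c) z = kron d n Q c z" .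
  qed (use zero in simp)
  then have "kron d n P (kron d n Q c) y = 0" for y
    by (simp add: kron_def[of d n P])
  moreover have "kron d n P (kron d n Q c) y = c y" if y: "y \<in> words d n" for y
    using kron_mult[OF w(6,7) y, of c] kron_one[OF y, of c] w(1) by simp
  ultimately show "\<forall>y\<in>words d n. c y = 0" by metis
qed

section \<open>Growth for infinitely many determinants\<close>

lemma power_int_prod: "(\<Prod>i\<in>A. f i) powi n = (\<Prod>i\<in>A. f i powi n :: 'a::field)"
  by (induction A rule: infinite_finite_induct) (simp_all add: power_int_mult_distrib)

lemma prod_list_letters:
  fixes \<mu> :: "nat \<Rightarrow> 'a::comm_monoid_mult"
  assumes "y \<in> words d n"
  shows "(\<Prod>i<n. \<mu> (y ! i)) = (\<Prod>r<d. \<mu> r ^ count_list y r)"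
proof -
  have "prod_list (map \<mu> y) = (\<Prod>r<d. \<mu> r ^ count_list y r)" if "set y \<subseteq> {..<d}" for y
    using that
  proof (induction y)
    case (Cons a y)
    have "(\<Prod>r<d. \<mu> r ^ count_list (a # y) r) = (\<Prod>r<d. (if r = a then \<mu> a else 1) * \<mu> r ^ count_list y r)"
      by (intro prod.cong) auto
    then show ?case using Cons by (simp add: prod.distrib)
  qed simp
  moreover have "(\<Prod>i<n. \<mu> (y ! i)) = prod_list (map \<mu> y)"
    using length_words[OF assms] by (simp add: prod.list_conv_set_nth lessThan_atLeast0)
  ultimately show ?thesis using assms by (simp add: words_def)
qed

lemma sum_list_letters:
  fixes w :: "nat \<Rightarrow> 'a::comm_semiring_1"
  assumes "y \<in> words d n"
  shows "(\<Sum>i<n. w (y ! i)) = (\<Sum>r<d. of_nat (count_list y r) * w r)"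
proof -
  have "sum_list (map w y) = (\<Sum>r<d. of_nat (count_list y r) * w r)" if "set y \<subseteq> {..<d}" for y
    using that
  proof (induction y)
    case (Cons a y)
    have "(\<Sum>r<d. of_nat (count_list (a # y) r) * w r)
        = (\<Sum>r<d. (if r = a then w a else 0) + of_nat (count_list y r) * w r)"
      by (intro sum.cong) (auto simp: algebra_simps)
    then show ?case using Cons by (simp add: sum.distrib)
  qed simp
  moreover have "(\<Sum>i<n. w (y ! i)) = sum_list (map w y)"
    using length_words[OF assms] by (simp add: sum_list_sum_nth lessThan_atLeast0)
  ultimately show ?thesis using assms by (simp add: words_def)
qed

text \<open>Every single product may have finite order; only a common bound on the orders is
  excluded.\<close>

definition unbounded_order :: "nat \<Rightarrow> (nat \<Rightarrow> 'a::field) set \<Rightarrow> bool" where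
  "unbounded_order d \<Lambda> \<longleftrightarrow> (\<forall>N. \<exists>\<mu>\<in>\<Lambda>. \<forall>j. 0 < j \<and> j \<le> N \<longrightarrow> (\<Prod>i<d. \<mu> i) ^ j \<noteq> 1)"

text \<open>Bounded orders on each of finitely many pieces would give a bound on the union, here the
  sum of the individual bounds.\<close>

lemma unbounded_order_UN:
  assumes "finite Y" "unbounded_order d \<Lambda>" "\<Lambda> \<subseteq> (\<Union>y\<in>Y. \<Lambda>' y)"
  obtains y where "y \<in> Y" "unbounded_order d (\<Lambda>' y)"
proof (rule ccontr)
  assume "\<not> thesis"
  then have "\<forall>y\<in>Y. \<exists>N. \<forall>\<mu>\<in>\<Lambda>' y. \<exists>j. 0 < j \<and> j \<le> N \<and> (\<Prod>i<d. \<mu> i) ^ j = 1"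
    using that unfolding unbounded_order_def by metis
  then obtain N where N: "\<forall>y\<in>Y. \<forall>\<mu>\<in>\<Lambda>' y. \<exists>j. 0 < j \<and> j \<le> N y \<and> (\<Prod>i<d. \<mu> i) ^ j = 1"
    by (rule bchoice[THEN exE])
  have "N y \<le> (\<Sum>y\<in>Y. N y)" if "y \<in> Y" for y using assms(1) that by (intro member_le_sum) auto
  moreover obtain \<mu> where "\<mu> \<in> \<Lambda>" "\<forall>j. 0 < j \<and> j \<le> (\<Sum>y\<in>Y. N y) \<longrightarrow> (\<Prod>i<d. \<mu> i) ^ j \<noteq> 1"
    using assms(2) unfolding unbounded_order_def by blast
  moreover from this obtain y where "y \<in> Y" "\<mu> \<in> \<Lambda>' y" using assms(3) by blast
  ultimately show False using N by (meson order_trans)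
qed

text \<open>The rational exponent vectors some positive multiple of which is a multiplicative relation
  between the entries of every \<open>\<mu> \<in> \<Lambda>\<close>; the multiple must not depend on \<open>\<mu>\<close>.\<close>

definition relations :: "nat \<Rightarrow> (nat \<Rightarrow> 'a::field) set \<Rightarrow> (nat \<Rightarrow> rat) set" where
  "relations d \<Lambda> = {v. \<exists>k>0. \<exists>a::nat \<Rightarrow> int. (\<forall>i<d. of_nat k * v i = of_int (a i)) \<and>
     (\<forall>\<mu>\<in>\<Lambda>. (\<Prod>i<d. \<mu> i powi a i) = 1)}"

lemma relations_antimono: "\<Lambda>' \<subseteq> \<Lambda> \<Longrightarrow> relations d \<Lambda> \<subseteq> relations d \<Lambda>'"
  unfolding relations_def by blast

text \<open>Relations can be multiplied and raised to integer powers; denominators are cleared by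
  the product of the two multipliers, respectively by the denominator of the scalar. Adding
  exponents of either sign relies on nonzero entries.\<close>

lemma subspace_relations:
  assumes nz: "\<And>\<mu> i. \<mu> \<in> \<Lambda> \<Longrightarrow> i < d \<Longrightarrow> \<mu> i \<noteq> 0"
  shows "Modules.module.subspace fun_scale (relations d \<Lambda>)"
proof -
  interpret F: vector_space "fun_scale :: rat \<Rightarrow> (nat \<Rightarrow> rat) \<Rightarrow> _" by (rule vector_space_fun_scale)
  show ?thesis
  proof (rule F.subspaceI)
    show "0 \<in> relations d \<Lambda>"
      unfolding relations_def by (intro CollectI exI[of _ "1::nat"] conjI exI[of _ "\<lambda>_. 0::int"]) auto
  next
    fix u v assume "u \<in> relations d \<Lambda>" "v \<in> relations d \<Lambda>"
    then obtain k a l b where k: "k > 0" "\<forall>i<d. of_nat k * u i = of_int (a i)" "\<forall>\<mu>\<in>\<Lambda>. (\<Prod>i<d. \<mu> i powi a i) = 1"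
      and l: "l > 0" "\<forall>i<d. of_nat l * v i = of_int (b i)" "\<forall>\<mu>\<in>\<Lambda>. (\<Prod>i<d. \<mu> i powi b i) = 1"
      unfolding relations_def by blast
    have "(\<Prod>i<d. \<mu> i powi (a i * int l + b i * int k)) = 1" if \<mu>: "\<mu> \<in> \<Lambda>" for \<mu>
    proof -
      have "(\<Prod>i<d. \<mu> i powi (a i * int l + b i * int k))
          = (\<Prod>i<d. (\<mu> i powi a i) powi int l * (\<mu> i powi b i) powi int k)"
        using nz[OF \<mu>] by (intro prod.cong) (auto simp: power_int_add power_int_mult)
      also have "\<dots> = (\<Prod>i<d. \<mu> i powi a i) powi int l * (\<Prod>i<d. \<mu> i powi b i) powi int k"
        by (simp only: prod.distrib power_int_prod)
      finally show ?thesis using k(3) l(3) \<mu> by simp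
    qed
    moreover have "of_nat (k * l) * (u + v) i = of_int (a i * int l + b i * int k)" if "i < d" for i
    proof -
      have "of_nat (k * l) * (u + v) i = (of_nat k * u i) * of_nat l + (of_nat l * v i) * of_nat k"
        by (simp add: algebra_simps)
      then show ?thesis using k(2) l(2) that by simp
    qed
    ultimately show "u + v \<in> relations d \<Lambda>"
      unfolding relations_def using k(1) l(1)
      by (intro CollectI exI[of _ "k * l"] conjI exI[of _ "\<lambda>i. a i * int l + b i * int k"]) auto
  next
    fix c u assume "u \<in> relations d \<Lambda>"
    then obtain k a where k: "k > 0" "\<forall>i<d. of_nat k * u i = of_int (a i)" "\<forall>\<mu>\<in>\<Lambda>. (\<Prod>i<d. \<mu> i powi a i) = 1"
      unfolding relations_def by blast
    obtain p q where pq: "quotient_of c = (p, q)" by (cases "quotient_of c")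
    then have q: "q > 0" "c = of_int p / of_int q" using quotient_of_denom_pos quotient_of_div by auto
    have "(\<Prod>i<d. \<mu> i powi (a i * p)) = 1" if \<mu>: "\<mu> \<in> \<Lambda>" for \<mu>
      using k(3) \<mu> by (simp add: power_int_mult power_int_prod[symmetric])
    moreover have "of_nat (k * nat q) * fun_scale c u i = of_int (a i * p)" if "i < d" for i
    proof -
      have "of_nat (k * nat q) * fun_scale c u i = (of_nat k * u i) * of_int p"
        using q by (simp add: fun_scale_def of_nat_nat)
      then show ?thesis using k(2) that by simp
    qed
    ultimately show "fun_scale c u \<in> relations d \<Lambda>"
      unfolding relations_def using k(1) q(1)
      by (intro CollectI exI[of _ "k * nat q"] conjI exI[of _ "\<lambda>i. a i * p"]) auto
  qed
qed

text \<open>For a subfamily of unbounded order satisfying as many independent relations as possible, a word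
  that is not a consequence of these relations is not a relation of all its members, and finitely many such
  words can be excluded at once.\<close>

lemma weight_exists:
  fixes \<Lambda> :: "(nat \<Rightarrow> 'a::field) set"
  assumes unb: "unbounded_order d \<Lambda>" and nz: "\<And>\<mu> i. \<mu> \<in> \<Lambda> \<Longrightarrow> i < d \<Longrightarrow> \<mu> i \<noteq> 0"
  obtains w :: "nat \<Rightarrow> real" where "(\<Sum>i<d. w i) \<noteq> 0"
    "\<And>n. \<exists>\<mu>\<in>\<Lambda>. \<forall>y\<in>words d n. (\<Prod>i<n. \<mu> (y ! i)) = 1 \<longrightarrow> (\<Sum>i<n. w (y ! i)) = 0"
proof -
  interpret F: vector_space "fun_scale :: rat \<Rightarrow> (nat \<Rightarrow> rat) \<Rightarrow> _" by (rule vector_space_fun_scale)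
  interpret P: vector_space_pair "fun_scale :: rat \<Rightarrow> (nat \<Rightarrow> rat) \<Rightarrow> _" "(*) :: rat \<Rightarrow> rat \<Rightarrow> rat"
    by unfold_locales (auto simp: algebra_simps)
  define \<delta> :: "nat \<Rightarrow> nat \<Rightarrow> rat" where "\<delta> r = (\<lambda>i. if i = r then 1 else 0)" for r
  define content :: "nat list \<Rightarrow> nat \<Rightarrow> rat" where "content y = (\<lambda>r. of_nat (count_list y r))" for y
  define one :: "nat \<Rightarrow> rat" where "one = (\<lambda>i. if i < d then 1 else 0)"
  define supp where "supp = {v :: nat \<Rightarrow> rat. \<forall>i\<ge>d. v i = 0}"
  have expand: "v = (\<Sum>r<d. fun_scale (v r) (\<delta> r))" if "v \<in> supp" for v
  proof
    fix i
    have "(\<Sum>r<d. fun_scale (v r) (\<delta> r)) i = (\<Sum>r<d. if r = i then v i else 0)"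
      unfolding sum_fun_apply by (intro sum.cong) (auto simp: fun_scale_def \<delta>_def)
    then show "v i = (\<Sum>r<d. fun_scale (v r) (\<delta> r)) i" using that by (auto simp: supp_def)
  qed
  have supp_span: "supp \<subseteq> F.span (\<delta> ` {..<d})"
  proof
    fix v assume "v \<in> supp"
    show "v \<in> F.span (\<delta> ` {..<d})"
      by (subst expand[OF \<open>v \<in> supp\<close>]) (intro F.span_sum F.span_scale F.span_base imageI)
  qed
  have content_supp: "content y \<in> supp" if "y \<in> words d n" for y n
    using that by (fastforce simp: supp_def content_def words_def count_list_0_iff)
  have one_supp: "one \<in> supp" by (simp add: supp_def one_def)
  \<comment> \<open>Some subfamily, still of unbounded order, satisfies \<open>b\<close> independent
    relations. Intersecting with \<open>supp\<close> bounds \<open>b\<close> by \<open>d\<close>,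
    since \<open>relations\<close> does not constrain coordinates beyond the first
    \<open>d\<close>.\<close>
  define good where "good b \<longleftrightarrow> (\<exists>\<Lambda>' B. \<Lambda>' \<subseteq> \<Lambda> \<and> unbounded_order d \<Lambda>' \<and> B \<subseteq> relations d \<Lambda>' \<inter> supp \<and>
    F.independent B \<and> card B = b)" for b
  have indep_bound: "finite B \<and> card B \<le> d" if "F.independent B" "B \<subseteq> supp" for B
  proof -
    have "B \<subseteq> F.span (\<delta> ` {..<d})" using that(2) supp_span by (rule subset_trans)
    then have "finite B \<and> card B \<le> card (\<delta> ` {..<d})" using that(1) by (intro F.independent_span_bound) auto
    moreover have "card (\<delta> ` {..<d}) \<le> d" using card_image_le[of "{..<d}" \<delta>] by simp
    ultimately show ?thesis by linarith
  qed
  have "good 0" unfolding good_def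
    by (rule exI[of _ \<Lambda>], rule exI[of _ "{}"]) (use unb F.independent_empty in simp)
  moreover have bound: "b \<le> d" if "good b" for b using that indep_bound unfolding good_def by blast
  ultimately have "good (Greatest good)" by (rule GreatestI_nat)
  moreover have "b' \<le> Greatest good" if "good b'" for b' using that bound by (rule Greatest_le_nat)
  ultimately obtain b where b: "good b" "\<And>b'. good b' \<Longrightarrow> b' \<le> b" by blast
  obtain \<Lambda>' B where \<Lambda>': "\<Lambda>' \<subseteq> \<Lambda>" "unbounded_order d \<Lambda>'" and B: "B \<subseteq> relations d \<Lambda>'" "B \<subseteq> supp"
    "F.independent B" "card B = b" using b(1) unfolding good_def by blast
  have sub: "F.span B \<subseteq> relations d \<Lambda>'"
    by (rule F.span_minimal[OF B(1) subspace_relations]) (use nz \<Lambda>'(1) in blast)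
  \<comment> \<open>The all-ones vector stands for the product of all entries. Were it a relation,
    one exponent would make this product 1 on the whole subfamily, against its unbounded
    order.\<close>
  have one: "one \<notin> F.span B"
  proof
    assume "one \<in> F.span B"
    then have "one \<in> relations d \<Lambda>'" using sub by blast
    then obtain k a where k: "k > 0" "\<forall>i<d. of_nat k * one i = of_int (a i)" "\<forall>\<mu>\<in>\<Lambda>'. (\<Prod>i<d. \<mu> i powi a i) = 1"
      unfolding relations_def by blast
    have "a i = int k" if "i < d" for i
    proof -
      have "(of_int (int k) :: rat) = of_int (a i)" using k(2) that by (simp add: one_def)
      then show ?thesis by (simp only: of_int_eq_iff)
    qed
    then have "(\<Prod>i<d. \<mu> i) ^ k = (\<Prod>i<d. \<mu> i powi a i)" for \<mu> :: "nat \<Rightarrow> 'a"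
      by (simp add: prod_power_distrib)
    then have "(\<Prod>i<d. \<mu> i) ^ k = 1" if "\<mu> \<in> \<Lambda>'" for \<mu> using k(3) that by simp
    then show False using \<Lambda>'(2) k(1) unfolding unbounded_order_def by blast
  qed
  have indep1: "F.independent (insert one B)" using one B(3) by (rule F.independent_insertI)
  \<comment> \<open>A functional that vanishes on the maximal relations but not on
    \<open>one\<close>. Its values on unit vectors become the weights, so a word whose content is in
    the span of the relations has weight zero.\<close>
  define f where "f = P.construct (insert one B) (\<lambda>v. if v = one then 1 else 0)"
  interpret f: Vector_Spaces.linear fun_scale "(*)" f unfolding f_def by (rule P.linear_construct[OF indep1])
  have f_one: "f one = 1" unfolding f_def by (subst P.construct_basis[OF indep1]) auto
  have f_B: "f v = 0" if "v \<in> F.span B" for v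
  proof (rule f.eq_0_on_span[OF _ that])
    fix v assume "v \<in> B"
    then have "v \<noteq> one" using one F.span_base by blast
    then show "f v = 0" unfolding f_def using \<open>v \<in> B\<close> by (subst P.construct_basis[OF indep1]) auto
  qed
  have f_expand: "f v = (\<Sum>r<d. v r * f (\<delta> r))" if "v \<in> supp" for v
    by (subst expand[OF that]) (simp only: f.sum f.scale)
  define w where "w r = real_of_rat (f (\<delta> r))" for r
  have "(\<Sum>r<d. w r) = real_of_rat (\<Sum>r<d. one r * f (\<delta> r))"
    by (simp add: w_def of_rat_sum one_def)
  also have "\<dots> = 1" using f_expand[OF one_supp] f_one by simp
  finally have w1: "(\<Sum>r<d. w r) \<noteq> 0" by simp
  have "\<exists>\<mu>\<in>\<Lambda>. \<forall>y\<in>words d n. (\<Prod>i<n. \<mu> (y ! i)) = 1 \<longrightarrow> (\<Sum>i<n. w (y ! i)) = 0" for n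
  proof -
    \<comment> \<open>Otherwise finitely many words outside the span cover the subfamily, one of
      them is a relation on a part that is still of unbounded order, and \<open>b\<close> is not
      maximal.\<close>
    have "\<exists>\<mu>\<in>\<Lambda>'. \<forall>y\<in>words d n. (\<Prod>i<n. \<mu> (y ! i)) = 1 \<longrightarrow> content y \<in> F.span B"
    proof (rule ccontr)
      assume "\<not> ?thesis"
      then have cover: "\<Lambda>' \<subseteq> (\<Union>y\<in>{y \<in> words d n. content y \<notin> F.span B}. {\<mu> \<in> \<Lambda>'. (\<Prod>i<n. \<mu> (y ! i)) = 1})"
        by blast
      obtain y where y: "y \<in> words d n" "content y \<notin> F.span B"
        and unb': "unbounded_order d {\<mu> \<in> \<Lambda>'. (\<Prod>i<n. \<mu> (y ! i)) = 1}" (is "unbounded_order d ?\<Lambda>y")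
        using unbounded_order_UN[OF _ \<Lambda>'(2) cover] by auto
      have "content y \<in> relations d ?\<Lambda>y"
        unfolding relations_def
        by (intro CollectI exI[of _ "1::nat"] conjI exI[of _ "\<lambda>r. int (count_list y r)"])
           (auto simp: content_def prod_list_letters[OF y(1)])
      moreover have "relations d \<Lambda>' \<subseteq> relations d ?\<Lambda>y" by (rule relations_antimono) blast
      ultimately have "insert (content y) B \<subseteq> relations d ?\<Lambda>y \<inter> supp"
        using B(1,2) content_supp[OF y(1)] by blast
      moreover have "F.independent (insert (content y) B)" using y(2) B(3) by (rule F.independent_insertI)
      moreover have "?\<Lambda>y \<subseteq> \<Lambda>" using \<Lambda>'(1) by blast
      moreover have "card (insert (content y) B) = Suc b"
        using indep_bound[OF B(3,2)] B(4) y(2) F.span_base by (subst card_insert_disjoint) auto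
      ultimately have "good (Suc b)" unfolding good_def using unb' by blast
      then show False using b(2) by fastforce
    qed
    then obtain \<mu> where \<mu>: "\<mu> \<in> \<Lambda>'" "\<And>y. y \<in> words d n \<Longrightarrow> (\<Prod>i<n. \<mu> (y ! i)) = 1 \<Longrightarrow> content y \<in> F.span B"
      by blast
    have "(\<Sum>i<n. w (y ! i)) = 0" if y: "y \<in> words d n" "(\<Prod>i<n. \<mu> (y ! i)) = 1" for y
    proof -
      have "(\<Sum>i<n. w (y ! i)) = real_of_rat (\<Sum>r<d. content y r * f (\<delta> r))"
        unfolding sum_list_letters[OF y(1), of w] by (simp add: w_def content_def of_rat_sum of_rat_mult)
      also have "\<dots> = 0" using f_expand[OF content_supp[OF y(1)]] f_B[OF \<mu>(2)[OF y]] by simp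
      finally show ?thesis .
    qed
    then show ?thesis using \<mu>(1) \<Lambda>'(1) by blast
  qed
  then show ?thesis using w1 that by blast
qed

text \<open>Chernoff's bound. At \<open>t = 0\<close> the sum \<open>\<phi> t\<close> of
  exponentials is \<open>d\<close> with derivative the nonzero total weight, so it drops below
  \<open>d\<close> on one side of 0. Every word of weight zero contributes exactly 1 to the
  expansion of \<open>\<phi> t ^ n\<close>, and all other terms are positive.\<close>

lemma card_zero_weight_words:
  fixes w :: "nat \<Rightarrow> real"
  assumes "(\<Sum>i<d. w i) \<noteq> 0"
  obtains c where "0 \<le> c" "c < real d" "\<And>n. real (card {y \<in> words d n. (\<Sum>i<n. w (y ! i)) = 0}) \<le> c ^ n"
proof -
  define \<phi> where "\<phi> t = (\<Sum>i<d. exp (t * w i))" for t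
  have deriv: "(\<phi> has_real_derivative (\<Sum>i<d. w i)) (at 0)"
    unfolding \<phi>_def by (auto intro!: derivative_eq_intros)
  have \<phi>0: "\<phi> 0 = real d" by (simp add: \<phi>_def)
  have "\<exists>t. \<phi> t < real d"
  proof (cases "(\<Sum>i<d. w i) < 0")
    case True
    then obtain e where "e > 0" "\<forall>h>0. h < e \<longrightarrow> \<phi> (0 + h) < \<phi> 0"
      using DERIV_neg_dec_right[OF deriv] by blast
    then have "\<phi> (0 + e / 2) < \<phi> 0" by simp
    then show ?thesis using \<phi>0 by metis
  next
    case False
    then have "(\<Sum>i<d. w i) > 0" using assms by simp
    then obtain e where "e > 0" "\<forall>h>0. h < e \<longrightarrow> \<phi> (0 - h) < \<phi> 0"
      using DERIV_pos_inc_left[OF deriv] by blast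
    then have "\<phi> (0 - e / 2) < \<phi> 0" by simp
    then show ?thesis using \<phi>0 by metis
  qed
  then obtain t where t: "\<phi> t < real d" by blast
  have "real (card {y \<in> words d n. (\<Sum>i<n. w (y ! i)) = 0}) \<le> \<phi> t ^ n" for n
  proof -
    have "real (card {y \<in> words d n. (\<Sum>i<n. w (y ! i)) = 0})
        = (\<Sum>y\<in>{y \<in> words d n. (\<Sum>i<n. w (y ! i)) = 0}. exp (t * (\<Sum>i<n. w (y ! i))))" by simp
    also have "\<dots> \<le> (\<Sum>y\<in>words d n. exp (t * (\<Sum>i<n. w (y ! i))))" by (intro sum_mono2) auto
    also have "\<dots> = (\<Sum>y\<in>words d n. \<Prod>i<n. exp (t * w (y ! i)))"
      by (simp add: sum_distrib_left exp_sum)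
    also have "\<dots> = \<phi> t ^ n" using prod_sum_words[of "\<lambda>_ j. exp (t * w j)" d n] by (simp add: \<phi>_def)
    finally show ?thesis .
  qed
  moreover have "0 \<le> \<phi> t" by (simp add: \<phi>_def sum_nonneg)
  ultimately show ?thesis using that t by blast
qed

text \<open>The base \<open>c\<close> is fixed before \<open>n\<close>; for each \<open>n\<close> an
  element \<open>g\<close> is chosen whose eigenvalue words of product 1 all have weight
  zero.\<close>

lemma trivial_growth_less:
  fixes s :: "'k::alg_closed_field \<Rightarrow> 'v::ab_group_add \<Rightarrow> 'v"
  assumes G: "group G" and hom: "\<rho> \<in> hom G (GL s)" and rep: "tensor_rep s G \<rho> bs"
    and inf: "infinite ((\<lambda>g. det (endo_matrix s bs (\<rho> g))) ` carrier G)"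
  shows "trivial_growth G s \<rho> < ereal (real (length bs))"
proof -
  interpret tensor_rep s G \<rho> bs by fact
  have "\<forall>g. \<exists>U P Q. similar_mat_wit (M g) U P Q \<and> upper_triangular U"
    using triangularizable[OF M_carrier] by blast
  then obtain U P Q where U: "\<And>g. similar_mat_wit (M g) (U g) (P g) (Q g)" "\<And>g. upper_triangular (U g)"
    by metis
  have Uc: "U g \<in> carrier_mat d d" for g using similar_mat_witD2(5)[OF M_carrier U(1)] .
  define \<mu> where "\<mu> g i = U g $$ (i, i)" for g i
  have det: "det (M g) = (\<Prod>i<d. \<mu> g i)" for g
  proof -
    have "det (M g) = det (U g)" using U(1)[of g] by (intro det_similar) (auto simp: similar_mat_def)
    also have "\<dots> = (\<Prod>i<d. \<mu> g i)"
      using Uc[of g] unfolding det_upper_triangular[OF U(2) Uc]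
      by (simp add: diag_mat_def prod.list_conv_set_nth \<mu>_def lessThan_atLeast0)
    finally show ?thesis .
  qed
  have "unbounded_order d (\<mu> ` carrier G)"
    unfolding unbounded_order_def
  proof (rule allI, rule ccontr)
    fix N
    assume "\<not> (\<exists>l\<in>\<mu> ` carrier G. \<forall>j. 0 < j \<and> j \<le> N \<longrightarrow> (\<Prod>i<d. l i) ^ j \<noteq> 1)"
    then have ex: "\<exists>j. 0 < j \<and> j \<le> N \<and> det (M g) ^ j = 1" if "g \<in> carrier G" for g
      using that by (auto simp: det)
    \<comment> \<open>Orders bounded by \<open>N\<close> would confine the determinants to the roots
      of finitely many nonzero polynomials.\<close>
    have "(\<lambda>g. det (M g)) ` carrier G \<subseteq> (\<Union>j\<in>{0<..N}. {z. poly (monom 1 j - 1) z = 0})"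
    proof clarify
      fix g assume "g \<in> carrier G"
      then obtain j where "0 < j" "j \<le> N" "det (M g) ^ j = 1" using ex by blast
      then show "det (M g) \<in> (\<Union>j\<in>{0<..N}. {z. poly (monom 1 j - 1) z = 0})"
        by (intro UN_I[of j]) (auto simp: poly_monom)
    qed
    moreover have "finite (\<Union>j\<in>{0<..N}. {z :: 'k. poly (monom 1 j - 1) z = 0})"
    proof (intro finite_UN_I poly_roots_finite)
      fix j assume "j \<in> {0<..N}"
      then have "poly (monom (1::'k) j - 1) 0 = -1" by (simp add: poly_monom)
      then show "monom (1::'k) j - 1 \<noteq> 0" by force
    qed simp
    ultimately show False using inf finite_subset unfolding M_def by blast
  qed
  moreover have "l i \<noteq> 0" if "l \<in> \<mu> ` carrier G" "i < d" for l i
    using that det det_M_nonzero[OF G hom] by (fastforce simp: prod_zero_iff)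
  ultimately obtain w :: "nat \<Rightarrow> real" where w: "(\<Sum>i<d. w i) \<noteq> 0"
    "\<And>n. \<exists>l\<in>\<mu> ` carrier G. \<forall>y\<in>words d n. (\<Prod>i<n. l (y ! i)) = 1 \<longrightarrow> (\<Sum>i<n. w (y ! i)) = 0"
    using weight_exists by blast
  obtain c where c: "0 \<le> c" "c < real d" "\<And>n. real (card {y \<in> words d n. (\<Sum>i<n. w (y ! i)) = 0}) \<le> c ^ n"
    using card_zero_weight_words[OF w(1)] by blast
  have "real (TS n) \<le> c ^ n" for n
  proof -
    obtain g where g: "g \<in> carrier G"
      "\<forall>y\<in>words d n. (\<Prod>i<n. \<mu> g (y ! i)) = 1 \<longrightarrow> (\<Sum>i<n. w (y ! i)) = 0" using w(2) by blast
    have "TS n \<le> card {y \<in> words d n. (\<Prod>i<n. U g $$ (y ! i, y ! i)) = 1}"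
      by (rule TS_le_eigenvalue_words[OF g(1) U])
    also have "\<dots> \<le> card {y \<in> words d n. (\<Sum>i<n. w (y ! i)) = 0}"
      using g(2) by (intro card_mono) (auto simp: \<mu>_def)
    finally show ?thesis using c(3)[of n] by linarith
  qed
  then have "trivial_growth G s \<rho> \<le> ereal c"
    unfolding trivial_growth_def using c(1) by (intro limsup_root_le) auto
  also have "\<dots> < ereal (real (length bs))" using c(2) by (simp add: d_def)
  finally show ?thesis .
qed

theorem theorem1p1:
  fixes G :: "('g, 'm) monoid_scheme"
    and s :: "'k::{alg_closed_field, field_char_0} \<Rightarrow> 'v::ab_group_add \<Rightarrow> 'v"
    and B :: "'v set"
    and \<rho> :: "'g \<Rightarrow> 'v \<Rightarrow> 'v"
  assumes "group G"
    and "finite_dimensional_vector_space s B"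
    and "\<rho> \<in> hom G (GL s)"
  shows "trivial_growth G s \<rho> = ereal (real (vector_space.dim s UNIV))
    \<longleftrightarrow> finite {endo_det s (\<rho> g) | g. g \<in> carrier G}"
proof -
  interpret group G by fact
  interpret V: finite_dimensional_vector_space s B by fact
  \<comment> \<open>The basis chosen in \<open>endo_det\<close>, so that its determinants are those
    of the matrices studied above.\<close>
  define bs where "bs = (SOME bs. ordered_basis s bs)"
  obtain bs0 where "set bs0 = B" "distinct bs0" using finite_distinct_list[OF V.finite_Basis] by blast
  then have "ordered_basis s bs0"
    using V.independent_Basis V.span_Basis by (simp add: ordered_basis_def)
  then have bs: "ordered_basis s bs" unfolding bs_def by (rule someI)
  interpret tensor_rep s G \<rho> bs
    by unfold_locales (use bs assms(3) in \<open>auto simp: hom_def\<close>)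
  have rep: "tensor_rep s G \<rho> bs" by unfold_locales
  have dim: "V.dim UNIV = length bs"
  proof -
    have "V.dim (V.span (set bs)) = card (set bs)"
      using bs by (intro V.dim_span_eq_card_independent) (simp add: ordered_basis_def)
    then show ?thesis using bs distinct_card[of bs] unfolding ordered_basis_def by metis
  qed
  have img: "{endo_det s (\<rho> g) | g. g \<in> carrier G} = (\<lambda>g. det (endo_matrix s bs (\<rho> g))) ` carrier G"
    by (auto simp: endo_det_def bs_def)
  have le: "trivial_growth G s \<rho> \<le> ereal (real (length bs))"
    unfolding trivial_growth_def
  proof (rule limsup_root_le)
    show "real (TS n) \<le> real (length bs) ^ n" for n
      using TS_le[OF one_closed, of n] unfolding d_def by (simp only: of_nat_le_iff flip: of_nat_power)
  qed simp
  have ge: "ereal (real (length bs)) \<le> trivial_growth G s \<rho>"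
    if fin: "finite ((\<lambda>g. det (endo_matrix s bs (\<rho> g))) ` carrier G)"
  proof (cases "bs = []")
    case True
    have "0 \<le> trivial_growth G s \<rho>"
      unfolding trivial_growth_def by (intro le_Limsup) (auto intro!: always_eventually real_root_ge_zero)
    then show ?thesis using True by (simp add: zero_ereal_def)
  qed (rule trivial_growth_ge[OF assms(1,3) rep _ fin])
  show ?thesis
    unfolding dim img using antisym[OF le ge] trivial_growth_less[OF assms(1,3) rep] by (metis less_irrefl)
qed

end
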